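(* There exist universal constants $c_0,c_1,c_2\ge 1$ and $c_3>0$ such that the following holds. Let $d\in\mathbb N$, let $\{\Psi_{\nu}\}_{\nu\in\mathbb N_0^d}\subset L^2_{\varrho}(\mathcal U)$ be either the orthonormal Chebyshev or the orthonormal Legendre basis, and let $\{\varphi_k\}_{k=1}^K$ be a basis for $\mathcal V_h$. Let $m\ge 3$, $0<\epsilon<1$, $K\ge 1$, $L=L(m,d,\epsilon)$, $n=\lceil m/L\rceil$ and $N=\Theta(n,d)$. Then, for every $t\ge1$, there exists an algorithm (for polynomial approximation of Hilbert-valued functions from sample values) $$\mathcal A_t:\mathcal U^m\times\mathbb C^{m\times K}\to\mathbb C^{N\times K}$$ with the following property. Let $f\in\mathcal B(\rho)$ for arbitrary $\rho>\mathbf 1$, draw $y_1,\dots,y_m$ randomly and independently according to $\varrho$, and let $(d_{ik})\in\mathbb C^{m\times K}$ be the data of $f$ for arbitrary noise terms $\mathbf n=(n_i)_{i=1}^m\in\mathcal V^m$. Let $(\hat c_{jk})=\mathcal A_t((y_i),(d_{ik}))$ and define $\hat f=\sum_{j=1}^N\big(\sum_{k=1}^K\hat c_{jk}\varphi_k\big)\Psi_{\nu_j}$, where $\nu_1,\dots,\nu_N$ is the indexing of $\Lambda=\Lambda^{\mathsf{HC}}_{n,d}$. Then with probability at least $1-\epsilon$ the error satisfies $$\|f-\hat f\|_{L^2_\varrho(\mathcal U;\mathcal V)}\le c_1\Big(\zeta+\frac1t\Big),\qquad \|f-\hat f\|_{L^\infty(\mathcal U;\mathcal V)}\le c_2\sqrt{\tfrac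 mL}\,\Big(\zeta+\frac1t\Big),$$ for any $0<p\le1$, where $$\zeta:=C\cdot\Big(\frac{m}{c_0L}\Big)^{1/2-1/p}+\frac{\|\mathbf n\|_{2;\mathcal V}}{\sqrt m}+\|f-\mathcal P_h(f)\|_{L^\infty(\mathcal U;\mathcal V)}$$ and $C=C(d,p,\rho)$ depends on $d$, $p$ and $\rho$ only. The computational cost of the algorithm is bounded by $$c_3\cdot\Big[m\cdot\Theta(n,d)\cdot d+t\cdot\big(m\cdot\Theta(n,d)\cdot K+(\Theta(n,d)+m)\cdot(F(G)+K)\big)\cdot(\Theta(n,d))^{\alpha}\Big].$$
   Context: Domain and bases: $\mathcal U=[-1,1]^d$ and $\varrho$ is either the uniform probability measure $2^{-d}\,dy$ (Legendre case) or the Chebyshev (arcsine) measure $\prod_{k=1}^d\frac{1}{\pi\sqrt{1-y_k^2}}\,dy$ (Chebyshev case). $\Psi_\nu(y)=\prod_{k}\Psi_{\nu_k}(y_k)$, where $\{\Psi_j\}_{j\ge0}$ are the univariate polynomials ($\deg\Psi_j=j$) orthonormal with respect to the corresponding one-dimensional probability measure. Spaces: $\mathcal V$ is a separable complex Hilbert space; $\mathcal V_h\subseteq\mathcal V$ is a finite-dimensional subspace with a (not necessarily orthonormal) basis $\{\varphi_k\}_{k=1}^K$, $K=\dim\mathcal V_h$; $\mathcal P_h:\mathcal V\to\mathcal V_h$ is the orthogonal projection and $(\mathcal P_hf)(y)=\mathcal P_h(f(y))$. $\|\cdot\|_{L^q_\varrho(\mathcal U;\mathcal V)}$ are the Lebesgue–Bochner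 norms. $\|\mathbf n\|_{2;\mathcal V}=(\sum_i\|n_i\|_{\mathcal V}^2)^{1/2}$. Holomorphy: for $\rho\ge1$, $\mathcal E_\rho=\{\frac12(z+z^{-1}):z\in\mathbb C,\ 1\le|z|\le\rho\}$, and $\mathcal E(\rho)=\mathcal E_{\rho_1}\times\cdots\times\mathcal E_{\rho_d}\subset\mathbb C^d$ for a vector $\rho=(\rho_j)$. $\rho>\mathbf 1$ is componentwise. A function on an open set is holomorphic if it is (complex) differentiable in each variable; $f:\mathcal U\to\mathcal V$ is holomorphic in $\mathcal E(\rho)$ if it extends to a holomorphic function on an open neighbourhood of $\mathcal E(\rho)$; $\|f\|_{L^\infty(\mathcal E(\rho);\mathcal V)}$ is the norm of the extension. $\mathcal B(\rho)$ is the set of $f:\mathcal U\to\mathcal V$ holomorphic in $\mathcal E(\rho)$ with $\|f\|_{L^\infty(\mathcal E(\rho);\mathcal V)}\le1$. Index sets: $\Lambda^{\mathsf{HC}}_{n,d}=\{\nu\in\mathbb N_0^d:\prod_{k=1}^d(\nu_k+1)\le n\}$, $\Theta(n,d)=|\Lambda^{\mathsf{HC}}_{n,d}|$, with a fixed indexing $\nu_1,\dots,\nu_N$ of its elements. With $\log$ the natural logarithm, $$L(m,d,\epsilon)=\log(m)\cdot\big(\log(m)\cdot\min\{\log(m)+d,\ \log(\mathrm e d)\cdot\log(m)\}+\log(\epsilon^{-1})\big).$$ $\alpha=1$ in the Legendre case and $\alpha=\log(3)/\log(4)$ in the Chebyshev case. Data: the noisy samples are $f(y_i)+n_i\in\mathcal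 V_h$ (the noise $n_i\in\mathcal V$ is such that this holds), $i=1,\dots,m$, and the data $(d_{ik})$ are their coefficients: $f(y_i)+n_i=\sum_{k=1}^Kd_{ik}\varphi_k$. Algorithms: $G=(\langle\varphi_j,\varphi_k\rangle_{\mathcal V})_{j,k=1}^K$ is the Gram matrix, $\mathcal T_G:\mathbb C^K\to\mathbb C^K$, $x\mapsto Gx$, and $F(G)$ is the maximum number of arithmetic operations and comparisons required to evaluate $\mathcal T_G(x)$ for arbitrary $x$. Given the finite index set $\Lambda$ with its indexing, an algorithm for polynomial approximation of Hilbert-valued functions from sample values is a mapping $\mathcal A:\mathcal U^m\times\mathbb C^{m\times K}\to\mathbb C^{N\times K}$, $((y_i),(d_{ik}))\mapsto(\hat c_{jk})$, whose evaluation involves only finitely many arithmetic operations (including square roots), comparisons and evaluations of $\mathcal T_G$. Its computational cost is the maximum number of arithmetic operations and comparisons (including those used in evaluating $\mathcal T_G$) used to compute the output from any input. "Universal constant" means a number independent of all other quantities. *)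

theory Defs
  imports "HOL-Probability.Probability" "HOL-Computational_Algebra.Polynomial"
begin

section \<open>Complex Hilbert spaces\<close>

text \<open>The inner product is conjugate-linear in its first argument, so that the Gram matrix
  \<open>G\<close> of \<open>\<phi>\<close> satisfies \<open>\<parallel>\<Sum>\<^sub>k x\<^sub>k \<phi>\<^sub>k\<parallel>\<^sup>2 = x\<^sup>* G x\<close>.\<close>

class scaleC =
  fixes scaleC :: "complex \<Rightarrow> 'a \<Rightarrow> 'a"  (infixr "*\<^sub>C" 75)

class complex_inner = real_normed_vector + scaleC +
  fixes cinner :: "'a \<Rightarrow> 'a \<Rightarrow> complex"
  assumes scaleC_add_right: "a *\<^sub>C (x + y) = a *\<^sub>C x + a *\<^sub>C y"
    and scaleC_add_left: "(a + b) *\<^sub>C x = a *\<^sub>C x + b *\<^sub>C x"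
    and scaleC_scaleC: "a *\<^sub>C b *\<^sub>C x = (a * b) *\<^sub>C x"
    and scaleC_of_real: "complex_of_real r *\<^sub>C x = r *\<^sub>R x"
    and cinner_commute: "cinner x y = cnj (cinner y x)"
    and cinner_add_right: "cinner x (y + z) = cinner x y + cinner x z"
    and cinner_scaleC_right: "cinner x (a *\<^sub>C y) = a * cinner x y"
    and cinner_self: "cinner x x = complex_of_real ((norm x)\<^sup>2)"

class complex_hilbert = complex_inner + complete_space

interpretation complex_vector: vector_space "scaleC :: complex \<Rightarrow> 'v::complex_inner \<Rightarrow> 'v"
proof
  fix x :: 'v
  show "1 *\<^sub>C x = x" using scaleC_of_real[of 1 x] by simp
qed (simp_all add: scaleC_add_right scaleC_add_left scaleC_scaleC)

definition basis_of :: "nat \<Rightarrow> (nat \<Rightarrow> 'v::complex_inner) \<Rightarrow> 'v set \<Rightarrow> bool" where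
  "basis_of K \<phi> Vh \<longleftrightarrow>
     inj_on \<phi> {..<K} \<and> complex_vector.independent (\<phi> ` {..<K}) \<and>
     complex_vector.span (\<phi> ` {..<K}) = Vh"

definition orth_proj :: "'v::complex_inner set \<Rightarrow> 'v \<Rightarrow> 'v" where
  "orth_proj S x = (THE u. u \<in> S \<and> (\<forall>v\<in>S. cinner v (x - u) = 0))"


subsection \<open>The sequence space \<open>\<ell>\<^sup>2\<close>\<close>

text \<open>A universal separable complex Hilbert space: every other one embeds into it isometrically.  It
  serves to state that constants do not depend on the Hilbert space, which is a type here.\<close>

typedef ell2 = "{x :: nat \<Rightarrow> complex. summable (\<lambda>i. (cmod (x i))\<^sup>2)}"
  morphisms seq_of Abs_ell2
  by (rule exI[of _ "\<lambda>_. 0"]) simp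

setup_lifting type_definition_ell2

lemma ell2_summable: "summable (\<lambda>i. (cmod (seq_of x i))\<^sup>2)"
  using seq_of[of x] by simp

lemma ell2_eqI: "(\<And>i. seq_of x i = seq_of y i) \<Longrightarrow> x = y"
  by (simp add: seq_of_inject[symmetric] ext)

lemma cmod_add_square_le: "(cmod (a + b))\<^sup>2 \<le> 2 * (cmod a)\<^sup>2 + 2 * (cmod b)\<^sup>2"
proof -
  have "(cmod (a + b))\<^sup>2 \<le> (cmod a + cmod b)\<^sup>2"
    by (simp add: norm_triangle_ineq power_mono)
  also have "\<dots> \<le> 2 * (cmod a)\<^sup>2 + 2 * (cmod b)\<^sup>2"
    using sum_squares_bound[of "cmod a" "cmod b"] by (simp add: power2_sum)
  finally show ?thesis .
qed

lemma square_summable_add: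
  assumes "summable (\<lambda>i. (cmod (x i))\<^sup>2)" "summable (\<lambda>i. (cmod (y i))\<^sup>2)"
  shows "summable (\<lambda>i. (cmod (x i + y i))\<^sup>2)"
proof (rule summable_comparison_test')
  show "summable (\<lambda>i. 2 * (cmod (x i))\<^sup>2 + 2 * (cmod (y i))\<^sup>2)"
    using assms by (intro summable_add summable_mult)
qed (simp add: cmod_add_square_le)

lemma square_summable_cmult:
  "summable (\<lambda>i. (cmod (x i))\<^sup>2) \<Longrightarrow> summable (\<lambda>i. (cmod (c * x i))\<^sup>2)"
  by (simp add: norm_mult power_mult_distrib summable_mult)

lemma summable_cinner_norm:
  assumes "summable (\<lambda>i. (cmod (x i))\<^sup>2)" "summable (\<lambda>i. (cmod (y i))\<^sup>2)"
  shows "summable (\<lambda>i. cmod (cnj (x i) * y i))"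
proof (rule summable_comparison_test')
  show "summable (\<lambda>i. (cmod (x i))\<^sup>2 + (cmod (y i))\<^sup>2)"
    using assms by (rule summable_add)
next
  fix i
  have "cmod (x i) * cmod (y i) \<ge> 0" by simp
  then have "cmod (x i) * cmod (y i) \<le> (cmod (x i))\<^sup>2 + (cmod (y i))\<^sup>2"
    using sum_squares_bound[of "cmod (x i)" "cmod (y i)"] by linarith
  then show "norm (cmod (cnj (x i) * y i)) \<le> (cmod (x i))\<^sup>2 + (cmod (y i))\<^sup>2"
    by (simp add: norm_mult)
qed

lemmas summable_cinner = summable_norm_cancel[OF summable_cinner_norm]

instantiation ell2 :: "{zero, plus, uminus, minus, scaleR, scaleC}"
begin

lift_definition zero_ell2 :: ell2 is "\<lambda>_. 0" by simp
lift_definition plus_ell2 :: "ell2 \<Rightarrow> ell2 \<Rightarrow> ell2" is "\<lambda>x y i. x i + y i"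
  by (rule square_summable_add)
lift_definition uminus_ell2 :: "ell2 \<Rightarrow> ell2" is "\<lambda>x i. - x i" by simp
lift_definition minus_ell2 :: "ell2 \<Rightarrow> ell2 \<Rightarrow> ell2" is "\<lambda>x y i. x i - y i"
  subgoal for x y using square_summable_add[of x "\<lambda>i. - y i"] by simp
  done
lift_definition scaleC_ell2 :: "complex \<Rightarrow> ell2 \<Rightarrow> ell2" is "\<lambda>c x i. c * x i"
  by (rule square_summable_cmult)
lift_definition scaleR_ell2 :: "real \<Rightarrow> ell2 \<Rightarrow> ell2" is "\<lambda>r x i. complex_of_real r * x i"
  by (rule square_summable_cmult)

instance ..
end

definition ell2_norm :: "ell2 \<Rightarrow> real" where
  "ell2_norm x = sqrt (\<Sum>i. (cmod (seq_of x i))\<^sup>2)"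

lemmas ell2_coord [simp] =
  zero_ell2.rep_eq plus_ell2.rep_eq uminus_ell2.rep_eq minus_ell2.rep_eq
  scaleC_ell2.rep_eq scaleR_ell2.rep_eq

definition ell2_inner :: "ell2 \<Rightarrow> ell2 \<Rightarrow> complex" where
  "ell2_inner x y = (\<Sum>i. cnj (seq_of x i) * seq_of y i)"

lemma ell2_norm_power2: "(ell2_norm x)\<^sup>2 = (\<Sum>i. (cmod (seq_of x i))\<^sup>2)"
  unfolding ell2_norm_def by (simp add: suminf_nonneg ell2_summable)

lemma ell2_norm_nonneg: "0 \<le> ell2_norm x"
  unfolding ell2_norm_def by (simp add: suminf_nonneg ell2_summable)

lemma ell2_inner_summable: "summable (\<lambda>i. cnj (seq_of x i) * seq_of y i)"
  by (rule summable_cinner[OF ell2_summable ell2_summable])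

lemma ell2_inner_add_right: "ell2_inner x (y + z) = ell2_inner x y + ell2_inner x z"
  unfolding ell2_inner_def
  by (simp add: distrib_left suminf_add[OF ell2_inner_summable ell2_inner_summable])

lemma ell2_inner_scaleC_right: "ell2_inner x (a *\<^sub>C y) = a * ell2_inner x y"
  unfolding ell2_inner_def
  by (simp add: suminf_mult[OF ell2_inner_summable, symmetric] mult.left_commute)

lemma ell2_inner_commute: "ell2_inner x y = cnj (ell2_inner y x)"
proof -
  have "(\<lambda>i. cnj (cnj (seq_of y i) * seq_of x i)) sums cnj (ell2_inner y x)"
    unfolding ell2_inner_def sums_cnj by (rule summable_sums[OF ell2_inner_summable])
  then show ?thesis
    unfolding ell2_inner_def by (simp add: sums_iff mult.commute)
qed

lemma ell2_inner_self: "ell2_inner x x = complex_of_real ((ell2_norm x)\<^sup>2)"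
proof -
  have "ell2_inner x x = (\<Sum>i. complex_of_real ((cmod (seq_of x i))\<^sup>2))"
    unfolding ell2_inner_def by (intro suminf_cong) (metis complex_norm_square mult.commute)
  also have "\<dots> = complex_of_real ((ell2_norm x)\<^sup>2)"
    unfolding ell2_norm_power2 by (rule suminf_of_real[OF ell2_summable, symmetric])
  finally show ?thesis .
qed

lemma sum_le_ell2_norm: "(\<Sum>i<k. (cmod (seq_of x i))\<^sup>2) \<le> (ell2_norm x)\<^sup>2"
  unfolding ell2_norm_power2 by (rule sum_le_suminf) (auto simp: ell2_summable)

lemma coord_le_ell2_norm: "cmod (seq_of x i) \<le> ell2_norm x"
proof -
  have "(cmod (seq_of x i))\<^sup>2 \<le> (\<Sum>j<Suc i. (cmod (seq_of x j))\<^sup>2)"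
    by (rule member_le_sum) auto
  then have "(cmod (seq_of x i))\<^sup>2 \<le> (ell2_norm x)\<^sup>2"
    using sum_le_ell2_norm order_trans by blast
  then show ?thesis using ell2_norm_nonneg power2_le_imp_le by blast
qed

lemma ell2_Cauchy_Schwarz: "cmod (ell2_inner x y) \<le> ell2_norm x * ell2_norm y"
proof -
  have "cmod (ell2_inner x y) \<le> (\<Sum>i. cmod (cnj (seq_of x i) * seq_of y i))"
    unfolding ell2_inner_def
    by (rule summable_norm[OF summable_cinner_norm[OF ell2_summable ell2_summable]])
  also have "\<dots> \<le> ell2_norm x * ell2_norm y"
  proof (rule suminf_le_const[OF summable_cinner_norm[OF ell2_summable ell2_summable]])
    fix k
    have "(\<Sum>i<k. cmod (cnj (seq_of x i) * seq_of y i)) =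
        (\<Sum>i<k. cmod (seq_of x i) * cmod (seq_of y i))"
      by (simp add: norm_mult)
    also have "\<dots> \<le> sqrt (\<Sum>i<k. (cmod (seq_of x i))\<^sup>2) * sqrt (\<Sum>i<k. (cmod (seq_of y i))\<^sup>2)"
      using L2_set_mult_ineq[of "\<lambda>i. cmod (seq_of x i)" "\<lambda>i. cmod (seq_of y i)" "{..<k}"]
      by (simp add: L2_set_def)
    also have "\<dots> \<le> ell2_norm x * ell2_norm y"
      using sum_le_ell2_norm ell2_norm_nonneg
      by (intro mult_mono) (auto intro: real_le_lsqrt simp: sum_nonneg)
    finally show "(\<Sum>i<k. cmod (cnj (seq_of x i) * seq_of y i)) \<le> ell2_norm x * ell2_norm y" .
  qed
  finally show ?thesis .
qed

instantiation ell2 :: complex_inner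
begin

definition cinner_ell2 :: "ell2 \<Rightarrow> ell2 \<Rightarrow> complex" where "cinner_ell2 = ell2_inner"
definition norm_ell2 :: "ell2 \<Rightarrow> real" where "norm_ell2 = ell2_norm"
definition sgn_ell2 :: "ell2 \<Rightarrow> ell2" where "sgn_ell2 x = x /\<^sub>R norm x"
definition dist_ell2 :: "ell2 \<Rightarrow> ell2 \<Rightarrow> real" where "dist_ell2 x y = norm (x - y)"
definition uniformity_ell2 :: "(ell2 \<times> ell2) filter" where
  "uniformity_ell2 = (INF e\<in>{0<..}. principal {(x, y). dist x y < e})"
definition open_ell2 :: "ell2 set \<Rightarrow> bool" where
  "open_ell2 U \<longleftrightarrow> (\<forall>x\<in>U. \<forall>\<^sub>F (x', y) in uniformity. x' = x \<longrightarrow> y \<in> U)"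

instance
proof
  fix x y z :: ell2 and a b :: complex and r s :: real
  show "x + y + z = x + (y + z)" "x + y = y + x" "0 + x = x" "- x + x = 0" "x - y = x + - y"
    by (rule ell2_eqI; simp)+
  show "r *\<^sub>R (x + y) = r *\<^sub>R x + r *\<^sub>R y" "(r + s) *\<^sub>R x = r *\<^sub>R x + s *\<^sub>R x"
    "r *\<^sub>R s *\<^sub>R x = (r * s) *\<^sub>R x" "1 *\<^sub>R x = x"
    "a *\<^sub>C (x + y) = a *\<^sub>C x + a *\<^sub>C y" "(a + b) *\<^sub>C x = a *\<^sub>C x + b *\<^sub>C x"
    "a *\<^sub>C b *\<^sub>C x = (a * b) *\<^sub>C x" "complex_of_real r *\<^sub>C x = r *\<^sub>R x"
    by (rule ell2_eqI; simp add: distrib_left distrib_right)+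
  show "cinner x y = cnj (cinner y x)" "cinner x (y + z) = cinner x y + cinner x z"
    "cinner x (a *\<^sub>C y) = a * cinner x y" "cinner x x = complex_of_real ((norm x)\<^sup>2)"
    unfolding cinner_ell2_def norm_ell2_def
    by (rule ell2_inner_commute ell2_inner_add_right ell2_inner_scaleC_right ell2_inner_self)+
  show "dist x y = norm (x - y)" "sgn x = x /\<^sub>R norm x"
    by (simp_all add: dist_ell2_def sgn_ell2_def)
  show "(uniformity :: (ell2 \<times> ell2) filter) = (INF e\<in>{0<..}. principal {(x, y). dist x y < e})"
    by (rule uniformity_ell2_def)
  show "open U \<longleftrightarrow> (\<forall>x\<in>U. \<forall>\<^sub>F (x', y) in uniformity. x' = x \<longrightarrow> y \<in> U)" for U :: "ell2 set"
    by (rule open_ell2_def)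
  show "norm x = 0 \<longleftrightarrow> x = 0"
  proof
    assume "norm x = 0"
    then have "seq_of x i = 0" for i using coord_le_ell2_norm[of x i] by (simp add: norm_ell2_def)
    then show "x = 0" by (intro ell2_eqI) simp
  qed (simp add: norm_ell2_def ell2_norm_def)
  show "norm (r *\<^sub>R x) = \<bar>r\<bar> * norm x"
    unfolding norm_ell2_def ell2_norm_def
    by (simp add: norm_mult power_mult_distrib suminf_mult ell2_summable real_sqrt_mult)
  show "norm (x + y) \<le> norm x + norm y"
  proof -
    have "complex_of_real ((ell2_norm (x + y))\<^sup>2) =
        ell2_inner x x + ell2_inner x y + cnj (ell2_inner x y) + ell2_inner y y"
      unfolding ell2_inner_self[symmetric] ell2_inner_add_right ell2_inner_commute[of "x + y"]
      by (simp add: ell2_inner_commute[symmetric])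
    from arg_cong[OF this, of Re]
    have "(ell2_norm (x + y))\<^sup>2 = (ell2_norm x)\<^sup>2 + 2 * Re (ell2_inner x y) + (ell2_norm y)\<^sup>2"
      unfolding ell2_inner_self plus_complex.sel Re_complex_of_real cnj.simps by linarith
    also have "\<dots> \<le> (ell2_norm x + ell2_norm y)\<^sup>2"
      using ell2_Cauchy_Schwarz[of x y] complex_Re_le_cmod[of "ell2_inner x y"]
      by (simp add: power2_sum)
    finally have "ell2_norm (x + y) \<le> ell2_norm x + ell2_norm y"
      by (rule power2_le_imp_le) (simp add: ell2_norm_nonneg)
    then show ?thesis by (simp add: norm_ell2_def)
  qed
qed

end

lemmas norm_ell2_power2 = ell2_norm_power2[folded norm_ell2_def]
  and sum_le_norm_ell2 = sum_le_ell2_norm[folded norm_ell2_def]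
  and coord_le_norm_ell2 = coord_le_ell2_norm[folded norm_ell2_def]

instance ell2 :: complex_hilbert
proof
  fix X :: "nat \<Rightarrow> ell2"
  assume X: "Cauchy X"
  have "Cauchy (\<lambda>n. seq_of (X n) i)" for i
  proof (rule CauchyI)
    fix e :: real assume "0 < e"
    from CauchyD[OF X this] obtain M where M: "\<forall>m\<ge>M. \<forall>n\<ge>M. norm (X m - X n) < e" by blast
    have "norm (seq_of (X m) i - seq_of (X n) i) < e" if "m \<ge> M" "n \<ge> M" for m n
      using M that coord_le_norm_ell2[of "X m - X n" i] by (auto intro: le_less_trans)
    then show "\<exists>M. \<forall>m\<ge>M. \<forall>n\<ge>M. norm (seq_of (X m) i - seq_of (X n) i) < e" by blast
  qed
  then obtain x where x: "\<And>i. (\<lambda>n. seq_of (X n) i) \<longlonglongrightarrow> x i"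
    unfolding Cauchy_convergent_iff convergent_def by metis
  have key: "\<exists>M. \<forall>n\<ge>M. \<forall>k. (\<Sum>i<k. (cmod (seq_of (X n) i - x i))\<^sup>2) \<le> e\<^sup>2" if "0 < e" for e :: real
  proof -
    from CauchyD[OF X that] obtain M where M: "\<forall>m\<ge>M. \<forall>n\<ge>M. norm (X m - X n) < e" by blast
    have "(\<Sum>i<k. (cmod (seq_of (X n) i - x i))\<^sup>2) \<le> e\<^sup>2" if n: "n \<ge> M" for n k
    proof (rule LIMSEQ_le_const2)
      show "(\<lambda>m. \<Sum>i<k. (cmod (seq_of (X n) i - seq_of (X m) i))\<^sup>2) \<longlonglongrightarrow>
          (\<Sum>i<k. (cmod (seq_of (X n) i - x i))\<^sup>2)"
        by (intro tendsto_intros x)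
      have "(\<Sum>i<k. (cmod (seq_of (X n) i - seq_of (X m) i))\<^sup>2) \<le> e\<^sup>2" if "m \<ge> M" for m
      proof -
        have "(\<Sum>i<k. (cmod (seq_of (X n - X m) i))\<^sup>2) \<le> (norm (X n - X m))\<^sup>2"
          by (rule sum_le_norm_ell2)
        also have "\<dots> \<le> e\<^sup>2" using M n that by (intro power_mono) (auto intro: less_imp_le)
        finally show ?thesis by simp
      qed
      then show "\<exists>N. \<forall>m\<ge>N. (\<Sum>i<k. (cmod (seq_of (X n) i - seq_of (X m) i))\<^sup>2) \<le> e\<^sup>2" by blast
    qed
    then show ?thesis by blast
  qed
  have diff: "summable (\<lambda>i. (cmod (seq_of (X n) i - x i))\<^sup>2)"
    if "\<forall>k. (\<Sum>i<k. (cmod (seq_of (X n) i - x i))\<^sup>2) \<le> B" for n B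
    using that by (intro summableI_nonneg_bounded[where x = B]) auto
  obtain M where "\<forall>n\<ge>M. \<forall>k. (\<Sum>i<k. (cmod (seq_of (X n) i - x i))\<^sup>2) \<le> 1\<^sup>2"
    using key[of 1] by auto
  then have "summable (\<lambda>i. (cmod (seq_of (X M) i - x i))\<^sup>2)" using diff by blast
  then have "summable (\<lambda>i. (cmod ((-1) * (seq_of (X M) i - x i)))\<^sup>2)"
    by (rule square_summable_cmult)
  from square_summable_add[OF ell2_summable[of "X M"] this]
  have "summable (\<lambda>i. (cmod (x i))\<^sup>2)" by simp
  then have rep: "seq_of (Abs_ell2 x) = x" by (simp add: Abs_ell2_inverse)
  have "X \<longlonglongrightarrow> Abs_ell2 x"
  proof (rule LIMSEQ_I)
    fix e :: real assume e: "0 < e"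
    then obtain M where M: "\<forall>n\<ge>M. \<forall>k. (\<Sum>i<k. (cmod (seq_of (X n) i - x i))\<^sup>2) \<le> (e / 2)\<^sup>2"
      using key[of "e / 2"] by auto
    have "norm (X n - Abs_ell2 x) < e" if "n \<ge> M" for n
    proof -
      have "(norm (X n - Abs_ell2 x))\<^sup>2 \<le> (e / 2)\<^sup>2"
        unfolding norm_ell2_power2 using M that rep
        by (intro suminf_le_const ell2_summable) auto
      then have "norm (X n - Abs_ell2 x) \<le> e / 2" by (rule power2_le_imp_le) (use e in simp)
      then show ?thesis using e by simp
    qed
    then show "\<exists>M. \<forall>n\<ge>M. norm (X n - Abs_ell2 x) < e" by blast
  qed
  then show "convergent X" by (auto simp: convergent_def)
qed

definition ell2_of_list :: "complex list \<Rightarrow> ell2" where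
  "ell2_of_list l = Abs_ell2 (\<lambda>i. if i < length l then l ! i else 0)"

lemma seq_of_ell2_of_list: "seq_of (ell2_of_list l) = (\<lambda>i. if i < length l then l ! i else 0)"
proof -
  have "summable (\<lambda>i. (cmod (if i < length l then l ! i else 0))\<^sup>2)"
    by (rule summable_finite[of "{..<length l}"]) auto
  then show ?thesis unfolding ell2_of_list_def by (simp add: Abs_ell2_inverse)
qed

instance ell2 :: second_countable_topology
proof
  obtain Q :: "complex set" where Q: "countable Q"
      "\<And>U. open U \<Longrightarrow> U \<noteq> {} \<Longrightarrow> \<exists>q\<in>Q. q \<in> U"
    by (rule countable_dense_setE) blast
  define D where "D = ell2_of_list ` lists Q"
  have D: "countable D" unfolding D_def using Q(1) by (intro countable_image countable_lists)
  have dense: "\<exists>q\<in>D. dist x q < e" if e: "0 < e" for x :: ell2 and e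
  proof -
    define s where "s = (\<lambda>i. (cmod (seq_of x i))\<^sup>2)"
    have s: "summable s" unfolding s_def by (rule ell2_summable)
    obtain k where k: "norm (\<Sum>i. s (i + k)) < e\<^sup>2 / 2"
      using suminf_exist_split[OF _ s, of "e\<^sup>2 / 2"] e by auto
    define r where "r = sqrt (e\<^sup>2 / (2 * (real k + 1)))"
    have r: "r > 0" unfolding r_def using e by simp
    have "\<exists>q\<in>Q. q \<in> ball (seq_of x i) r" for i using r by (intro Q(2)) auto
    then obtain q where q: "\<And>i. q i \<in> Q" "\<And>i. cmod (seq_of x i - q i) < r"
      unfolding mem_ball dist_norm by metis
    define y where "y = ell2_of_list (map q [0..<k])"
    have yD: "y \<in> D" unfolding y_def D_def using q(1) by (intro imageI) auto
    have y: "seq_of y = (\<lambda>i. if i < k then q i else 0)"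
      unfolding y_def seq_of_ell2_of_list by auto
    have "(norm (x - y))\<^sup>2 = (\<Sum>i. (cmod (seq_of (x - y) (i + k)))\<^sup>2) + (\<Sum>i<k. (cmod (seq_of (x - y) i))\<^sup>2)"
      unfolding norm_ell2_power2 by (rule suminf_split_initial_segment[OF ell2_summable])
    also have "\<dots> = (\<Sum>i. s (i + k)) + (\<Sum>i<k. (cmod (seq_of x i - q i))\<^sup>2)"
      by (simp add: y s_def)
    also have "(\<Sum>i<k. (cmod (seq_of x i - q i))\<^sup>2) \<le> (\<Sum>i<k. r\<^sup>2)"
      using q(2) by (intro sum_mono power_mono) (auto intro: less_imp_le)
    also have "(\<Sum>i<k. r\<^sup>2) \<le> e\<^sup>2 / 2"
      unfolding r_def using e by (simp add: field_simps)
    finally have "(norm (x - y))\<^sup>2 < e\<^sup>2" using k by simp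
    then have "norm (x - y) < e" by (rule power2_less_imp_less) (use e in simp)
    then show ?thesis using yD by (auto simp: dist_norm)
  qed
  define B where "B = (\<lambda>(q, n). ball q (1 / real (Suc n))) ` (D \<times> UNIV)"
  have "topological_basis B"
  proof (rule topological_basisI)
    show "open b" if "b \<in> B" for b using that unfolding B_def by auto
    fix U :: "ell2 set" and x assume "open U" "x \<in> U"
    then obtain e where e: "0 < e" "ball x e \<subseteq> U" using openE by blast
    obtain n where n: "1 / real (Suc n) < e / 2" using e(1) nat_approx_posE[of "e / 2"] by auto
    obtain q where q: "q \<in> D" "dist x q < 1 / real (Suc n)"
      using dense[of "1 / real (Suc n)" x] by auto
    have "ball q (1 / real (Suc n)) \<subseteq> ball x e"
    proof
      fix z assume "z \<in> ball q (1 / real (Suc n))"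
      then show "z \<in> ball x e" using n q(2) dist_triangle[of x z q] by simp
    qed
    moreover have "ball q (1 / real (Suc n)) \<in> B" using q(1) unfolding B_def by force
    ultimately show "\<exists>b\<in>B. x \<in> b \<and> b \<subseteq> U" 
      using e(2) q(2) by (intro bexI[of _ "ball q (1 / real (Suc n))"]) (simp_all add: dist_commute)
  qed
  moreover have "countable B" unfolding B_def using D by auto
  ultimately show "\<exists>B :: ell2 set set. countable B \<and> open = generate_topology B"
    using topological_basis_imp_subbasis by blast
qed


section \<open>Domain, measures and polynomial bases\<close>

datatype family = Legendre | Chebyshev

fun weight :: "family \<Rightarrow> real \<Rightarrow> real" where
  "weight Legendre y = 1 / 2"
| "weight Chebyshev y = 1 / (pi * sqrt (1 - y\<^sup>2))"

definition measure_1d :: "family \<Rightarrow> real measure" where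
  "measure_1d b = density (restrict_space lborel {-1..1}) (\<lambda>y. ennreal (weight b y))"

text \<open>Points of \<open>\<real>\<^sup>d\<close> and \<open>\<complex>\<^sup>d\<close> are extensional functions on \<open>{..<d}\<close>, because \<open>d\<close> is quantified
  after the universal constants.\<close>

definition cube :: "nat \<Rightarrow> (nat \<Rightarrow> real) set" where
  "cube d = {..<d} \<rightarrow>\<^sub>E {-1..1}"

definition cube_measure :: "family \<Rightarrow> nat \<Rightarrow> (nat \<Rightarrow> real) measure" where
  "cube_measure b d = (\<Pi>\<^sub>M k\<in>{..<d}. measure_1d b)"

lemma space_cube_measure: "space (cube_measure b d) = cube d"
  by (simp add: cube_measure_def cube_def space_PiM measure_1d_def space_restrict_space)

definition sample_measure :: "family \<Rightarrow> nat \<Rightarrow> nat \<Rightarrow> (nat \<Rightarrow> nat \<Rightarrow> real) measure" where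
  "sample_measure b d m = (\<Pi>\<^sub>M i\<in>{..<m}. cube_measure b d)"

text \<open>Orthonormality and the degree condition determine \<open>\<Psi>\<close> up to the sign of each polynomial.\<close>

definition orthonormal_polys :: "real measure \<Rightarrow> (nat \<Rightarrow> real poly) \<Rightarrow> bool" where
  "orthonormal_polys \<mu> \<Psi> \<longleftrightarrow>
     (\<forall>j. degree (\<Psi> j) = j) \<and>
     (\<forall>i j. (\<integral>y. poly (\<Psi> i) y * poly (\<Psi> j) y \<partial>\<mu>) = (if i = j then 1 else 0))"

definition tensor_poly :: "(nat \<Rightarrow> real poly) \<Rightarrow> nat \<Rightarrow> (nat \<Rightarrow> nat) \<Rightarrow> (nat \<Rightarrow> real) \<Rightarrow> real" where
  "tensor_poly \<Psi> d \<nu> y = (\<Prod>k<d. poly (\<Psi> (\<nu> k)) (y k))"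

text \<open>Lebesgue--Bochner norms, infinite on functions outside the space.  Since the target space is
  separable, Borel measurability is strong measurability.\<close>

definition L2_norm :: "'a measure \<Rightarrow> ('a \<Rightarrow> 'v::{real_normed_vector,second_countable_topology}) \<Rightarrow> ereal" where
  "L2_norm M g =
     (if g \<in> borel_measurable M \<and> integrable M (\<lambda>y. (norm (g y))\<^sup>2)
      then ereal (sqrt (\<integral>y. (norm (g y))\<^sup>2 \<partial>M)) else \<infinity>)"

definition Linf_norm :: "'a measure \<Rightarrow> ('a \<Rightarrow> 'v::{real_normed_vector,second_countable_topology}) \<Rightarrow> ereal" where
  "Linf_norm M g =
     (if g \<in> borel_measurable M then esssup M (\<lambda>y. ereal (norm (g y))) else \<infinity>)"


section \<open>Holomorphic functions\<close>

definition bernstein_ellipse :: "real \<Rightarrow> complex set" where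
  "bernstein_ellipse r = {(z + inverse z) / 2 | z. 1 \<le> cmod z \<and> cmod z \<le> r}"

definition polyellipse :: "nat \<Rightarrow> (nat \<Rightarrow> real) \<Rightarrow> (nat \<Rightarrow> complex) set" where
  "polyellipse d \<rho> = (\<Pi>\<^sub>E k\<in>{..<d}. bernstein_ellipse (\<rho> k))"

definition separately_holomorphic_on ::
    "nat \<Rightarrow> ((nat \<Rightarrow> complex) \<Rightarrow> 'v::complex_inner) \<Rightarrow> (nat \<Rightarrow> complex) set \<Rightarrow> bool" where
  "separately_holomorphic_on d g W \<longleftrightarrow>
     (\<forall>z\<in>W. \<forall>k<d. \<exists>D. ((\<lambda>w. g (z(k := w))) has_derivative (\<lambda>h. h *\<^sub>C D)) (at (z k)))"

definition holomorphic_ball :: "nat \<Rightarrow> (nat \<Rightarrow> real) \<Rightarrow> ((nat \<Rightarrow> real) \<Rightarrow> 'v::complex_inner) set" where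
  "holomorphic_ball d \<rho> =
     {f. \<exists>W g. openin (product_topology (\<lambda>_. euclidean) {..<d}) W \<and> polyellipse d \<rho> \<subseteq> W \<and>
        separately_holomorphic_on d g W \<and>
        (\<forall>y\<in>cube d. g (\<lambda>k\<in>{..<d}. complex_of_real (y k)) = f y) \<and>
        (SUP z\<in>polyellipse d \<rho>. ereal (norm (g z))) \<le> 1}"


section \<open>Hyperbolic crosses and parameters\<close>

definition hyp_cross :: "nat \<Rightarrow> nat \<Rightarrow> (nat \<Rightarrow> nat) set" where
  "hyp_cross n d = {\<nu> \<in> {..<d} \<rightarrow>\<^sub>E UNIV. (\<Prod>k<d. \<nu> k + 1) \<le> n}"

definition Theta :: "nat \<Rightarrow> nat \<Rightarrow> nat" where
  "Theta n d = card (hyp_cross n d)"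

definition log_factor :: "nat \<Rightarrow> nat \<Rightarrow> real \<Rightarrow> real" where
  "log_factor m d \<epsilon> =
     ln m * (ln m * min (ln m + d) (ln (exp 1 * d) * ln m) + ln (inverse \<epsilon>))"

fun cost_exponent :: "family \<Rightarrow> real" where
  "cost_exponent Legendre = 1"
| "cost_exponent Chebyshev = ln 3 / ln 4"


section \<open>Algorithms and their cost\<close>

text \<open>An algorithm is a finite computation tree over \<open>\<complex>\<close> with an oracle \<open>T\<close> for the map
  \<open>x \<mapsto> G x\<close>.  Its state is the list of values available so far: the input followed by all results
  computed.  Each step except \<open>Output\<close> appends its result (\<open>Gram\<close> appends the \<open>K\<close> entries of
  \<open>G x\<close>) or, for \<open>IfLe\<close>, branches on a comparison of real parts; on real numbers this is the
  usual comparison.  Conjugation and square root (principal branch, hence the usual one on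
  nonnegative reals) count as arithmetic operations, and division by zero yields zero.  Literal
  constants and copying are free.\<close>

datatype operand = Reg nat | Lit complex

datatype arith = Plus | Minus | Times | Divide

datatype algorithm =
    Output "operand list"
  | Arith arith operand operand algorithm
  | Conj operand algorithm
  | Sqrt operand algorithm
  | IfLe operand operand algorithm algorithm
  | Gram "operand list" algorithm

fun operand_value :: "complex list \<Rightarrow> operand \<Rightarrow> complex" where
  "operand_value s (Reg i) = s ! i"
| "operand_value s (Lit c) = c"

fun arith_value :: "arith \<Rightarrow> complex \<Rightarrow> complex \<Rightarrow> complex" where
  "arith_value Plus a b = a + b"
| "arith_value Minus a b = a - b"
| "arith_value Times a b = a * b"
| "arith_value Divide a b = a / b"

primrec run :: "(complex list \<Rightarrow> complex list) \<Rightarrow> algorithm \<Rightarrow> complex list \<Rightarrow> complex list" where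
  "run T (Output xs) s = map (operand_value s) xs"
| "run T (Arith c a b A) s =
     run T A (s @ [arith_value c (operand_value s a) (operand_value s b)])"
| "run T (Conj a A) s = run T A (s @ [cnj (operand_value s a)])"
| "run T (Sqrt a A) s = run T A (s @ [csqrt (operand_value s a)])"
| "run T (IfLe a b A B) s =
     (if Re (operand_value s a) \<le> Re (operand_value s b) then run T A s else run T B s)"
| "run T (Gram xs A) s = run T A (s @ T (map (operand_value s) xs))"

text \<open>The number of operations and comparisons performed on a given input, where \<open>F\<close> is charged for
  each evaluation of \<open>T\<close>.\<close>

primrec ops :: "(complex list \<Rightarrow> complex list) \<Rightarrow> nat \<Rightarrow> algorithm \<Rightarrow> complex list \<Rightarrow> nat" where
  "ops T F (Output xs) s = 0"
| "ops T F (Arith c a b A) s =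
     1 + ops T F A (s @ [arith_value c (operand_value s a) (operand_value s b)])"
| "ops T F (Conj a A) s = 1 + ops T F A (s @ [cnj (operand_value s a)])"
| "ops T F (Sqrt a A) s = 1 + ops T F A (s @ [csqrt (operand_value s a)])"
| "ops T F (IfLe a b A B) s =
     1 + (if Re (operand_value s a) \<le> Re (operand_value s b) then ops T F A s else ops T F B s)"
| "ops T F (Gram xs A) s = F + ops T F A (s @ T (map (operand_value s) xs))"

definition comp_cost ::
    "(complex list \<Rightarrow> complex list) \<Rightarrow> nat \<Rightarrow> algorithm \<Rightarrow> complex list set \<Rightarrow> nat" where
  "comp_cost T F A S = (SUP s\<in>S. ops T F A s)"

text \<open>The supremum is a maximum: on \<^typ>\<open>nat\<close> this only needs a bound.\<close>

lemma ops_bounded: "\<exists>B. \<forall>s. ops T F A s \<le> B"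
proof (induction A)
  case (IfLe a b A A')
  then obtain B B' where "\<forall>s. ops T F A s \<le> B" "\<forall>s. ops T F A' s \<le> B'" by blast
  then have "\<forall>s. ops T F (IfLe a b A A') s \<le> 1 + max B B'" by (simp add: le_max_iff_disj)
  then show ?case by blast
next
  case (Gram xs A)
  then obtain B where "\<forall>s. ops T F A s \<le> B" by blast
  then have "\<forall>s. ops T F (Gram xs A) s \<le> F + B" by simp
  then show ?case by blast
qed (auto intro: exI[of _ "Suc _"])

lemma comp_cost_le_iff:
  assumes "S \<noteq> {}"
  shows "comp_cost T F A S \<le> c \<longleftrightarrow> (\<forall>s\<in>S. ops T F A s \<le> c)"
proof -
  obtain B where "\<forall>s. ops T F A s \<le> B" using ops_bounded by blast
  then have "bdd_above (ops T F A ` S)" by (auto intro: bdd_aboveI)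
  then show ?thesis unfolding comp_cost_def using assms by (intro cSUP_le_iff) auto
qed

text \<open>\<open>wf_algorithm K q r A\<close>: on a state with \<open>r\<close> entries, \<open>A\<close> reads only existing entries, applies
  the oracle only to vectors in \<open>\<complex>\<^sup>K\<close> and outputs \<open>q\<close> numbers.\<close>

fun wf_operand :: "nat \<Rightarrow> operand \<Rightarrow> bool" where
  "wf_operand r (Reg i) \<longleftrightarrow> i < r"
| "wf_operand r (Lit c) \<longleftrightarrow> True"

primrec wf_algorithm :: "nat \<Rightarrow> nat \<Rightarrow> nat \<Rightarrow> algorithm \<Rightarrow> bool" where
  "wf_algorithm K q r (Output xs) \<longleftrightarrow> length xs = q \<and> (\<forall>x\<in>set xs. wf_operand r x)"
| "wf_algorithm K q r (Arith c a b A) \<longleftrightarrow>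
     wf_operand r a \<and> wf_operand r b \<and> wf_algorithm K q (Suc r) A"
| "wf_algorithm K q r (Conj a A) \<longleftrightarrow> wf_operand r a \<and> wf_algorithm K q (Suc r) A"
| "wf_algorithm K q r (Sqrt a A) \<longleftrightarrow> wf_operand r a \<and> wf_algorithm K q (Suc r) A"
| "wf_algorithm K q r (IfLe a b A B) \<longleftrightarrow>
     wf_operand r a \<and> wf_operand r b \<and> wf_algorithm K q r A \<and> wf_algorithm K q r B"
| "wf_algorithm K q r (Gram xs A) \<longleftrightarrow>
     length xs = K \<and> (\<forall>x\<in>set xs. wf_operand r x) \<and> wf_algorithm K q (r + K) A"

primrec gram_free :: "algorithm \<Rightarrow> bool" where
  "gram_free (Output xs) \<longleftrightarrow> True"
| "gram_free (Arith c a b A) \<longleftrightarrow> gram_free A"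
| "gram_free (Conj a A) \<longleftrightarrow> gram_free A"
| "gram_free (Sqrt a A) \<longleftrightarrow> gram_free A"
| "gram_free (IfLe a b A B) \<longleftrightarrow> gram_free A \<and> gram_free B"
| "gram_free (Gram xs A) \<longleftrightarrow> False"

definition gram_map :: "nat \<Rightarrow> (nat \<Rightarrow> 'v::complex_inner) \<Rightarrow> complex list \<Rightarrow> complex list" where
  "gram_map K \<phi> x = map (\<lambda>j. \<Sum>k<K. cinner (\<phi> j) (\<phi> k) * x ! k) [0..<K]"

text \<open>\<open>F(G)\<close>: the least worst-case cost of an oracle-free algorithm for \<open>x \<mapsto> G x\<close>.\<close>

definition gram_cost :: "nat \<Rightarrow> (nat \<Rightarrow> 'v::complex_inner) \<Rightarrow> nat" where
  "gram_cost K \<phi> =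
     (LEAST c. \<exists>P. gram_free P \<and> wf_algorithm K K K P \<and>
        (\<forall>x. length x = K \<longrightarrow> run (gram_map K \<phi>) P x = gram_map K \<phi> x) \<and>
        comp_cost (gram_map K \<phi>) 0 P {x. length x = K} = c)"

text \<open>The input \<open>((y\<^sub>i), (d\<^sub>i\<^sub>k))\<close> as a list of \<open>m d + m K\<close> numbers, and the output \<open>(c\<^sub>j\<^sub>k)\<close> as a list of
  \<open>N K\<close> numbers, both row by row.\<close>

definition encode_input ::
    "nat \<Rightarrow> nat \<Rightarrow> nat \<Rightarrow> (nat \<Rightarrow> nat \<Rightarrow> real) \<Rightarrow> (nat \<Rightarrow> nat \<Rightarrow> complex) \<Rightarrow> complex list" where
  "encode_input d m K y D =
     concat (map (\<lambda>i. map (\<lambda>k. complex_of_real (y i k)) [0..<d]) [0..<m]) @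
     concat (map (\<lambda>i. map (D i) [0..<K]) [0..<m])"

definition inputs :: "nat \<Rightarrow> nat \<Rightarrow> nat \<Rightarrow> complex list set" where
  "inputs d m K = {encode_input d m K y D | y D. \<forall>i<m. y i \<in> cube d}"

definition approx_algorithm :: "nat \<Rightarrow> nat \<Rightarrow> nat \<Rightarrow> nat \<Rightarrow> algorithm \<Rightarrow> bool" where
  "approx_algorithm d m K N A \<longleftrightarrow> wf_algorithm K (N * K) (m * d + m * K) A"

definition algorithm_output ::
    "nat \<Rightarrow> nat \<Rightarrow> nat \<Rightarrow> (nat \<Rightarrow> 'v::complex_inner) \<Rightarrow> algorithm \<Rightarrow>
     (nat \<Rightarrow> nat \<Rightarrow> real) \<Rightarrow> (nat \<Rightarrow> nat \<Rightarrow> complex) \<Rightarrow> nat \<Rightarrow> nat \<Rightarrow> complex" where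
  "algorithm_output d m K \<phi> A y D j k =
     run (gram_map K \<phi>) A (encode_input d m K y D) ! (j * K + k)"

definition algorithm_cost ::
    "nat \<Rightarrow> nat \<Rightarrow> nat \<Rightarrow> (nat \<Rightarrow> 'v::complex_inner) \<Rightarrow> algorithm \<Rightarrow> nat" where
  "algorithm_cost d m K \<phi> A = comp_cost (gram_map K \<phi>) (gram_cost K \<phi>) A (inputs d m K)"


section \<open>The approximation guarantee\<close>

definition is_data ::
    "nat \<Rightarrow> nat \<Rightarrow> (nat \<Rightarrow> 'v::complex_inner) \<Rightarrow> ((nat \<Rightarrow> real) \<Rightarrow> 'v) \<Rightarrow>
     (nat \<Rightarrow> nat \<Rightarrow> real) \<Rightarrow> (nat \<Rightarrow> 'v) \<Rightarrow> (nat \<Rightarrow> nat \<Rightarrow> complex) \<Rightarrow> bool" where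
  "is_data m K \<phi> f y noise D \<longleftrightarrow> (\<forall>i<m. f (y i) + noise i = (\<Sum>k<K. D i k *\<^sub>C \<phi> k))"

definition approximant ::
    "nat \<Rightarrow> nat \<Rightarrow> nat \<Rightarrow> (nat \<Rightarrow> 'v::complex_inner) \<Rightarrow> (nat \<Rightarrow> real poly) \<Rightarrow>
     (nat \<Rightarrow> nat \<Rightarrow> nat) \<Rightarrow> (nat \<Rightarrow> nat \<Rightarrow> complex) \<Rightarrow> (nat \<Rightarrow> real) \<Rightarrow> 'v" where
  "approximant d K N \<phi> \<Psi> \<nu> c y =
     (\<Sum>j<N. tensor_poly \<Psi> d (\<nu> j) y *\<^sub>R (\<Sum>k<K. c j k *\<^sub>C \<phi> k))"

definition error_term ::
    "family \<Rightarrow> nat \<Rightarrow> nat \<Rightarrow> real \<Rightarrow> real \<Rightarrow> real \<Rightarrow> real \<Rightarrow> 'v set \<Rightarrow>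
     ((nat \<Rightarrow> real) \<Rightarrow> 'v::{complex_inner,second_countable_topology}) \<Rightarrow> (nat \<Rightarrow> 'v) \<Rightarrow> ereal" where
  "error_term b d m L c0 p Cp Vh f noise =
     ereal (Cp * (m / (c0 * L)) powr (1 / 2 - 1 / p)) +
     ereal (sqrt (\<Sum>i<m. (norm (noise i))\<^sup>2) / sqrt m) +
     Linf_norm (cube_measure b d) (\<lambda>y. f y - orth_proj Vh (f y))"

text \<open>The guarantee for one space \<open>'v\<close> with given constants.  The event \<open>E\<close> is chosen before the
  noise, which depends on the sample points through the requirement that
  \<open>f (y\<^sub>i) + n\<^sub>i\<close> lies in \<open>V\<^sub>h\<close>.  The vector \<open>\<rho>\<close> is extensional so that \<open>C d p \<rho>\<close> depends on its \<open>d\<close>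
  entries only.\<close>

definition approx_guarantee ::
    "'v::{complex_hilbert,second_countable_topology} itself \<Rightarrow>
     real \<Rightarrow> real \<Rightarrow> real \<Rightarrow> real \<Rightarrow> (nat \<Rightarrow> real \<Rightarrow> (nat \<Rightarrow> real) \<Rightarrow> real) \<Rightarrow> bool" where
  "approx_guarantee _ c0 c1 c2 c3 C \<longleftrightarrow>
     (\<forall>(b :: family) (d :: nat) (\<Psi> :: nat \<Rightarrow> real poly) (Vh :: 'v set) (\<phi> :: nat \<Rightarrow> 'v)
        (m :: nat) (\<epsilon> :: real) (K :: nat) (L :: real) (n :: nat) (N :: nat)
        (\<nu> :: nat \<Rightarrow> nat \<Rightarrow> nat) (t :: real).
      d \<ge> 1 \<and> orthonormal_polys (measure_1d b) \<Psi> \<and> basis_of K \<phi> Vh \<and>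
      m \<ge> 3 \<and> 0 < \<epsilon> \<and> \<epsilon> < 1 \<and> K \<ge> 1 \<and>
      L = log_factor m d \<epsilon> \<and> n = nat \<lceil>m / L\<rceil> \<and> N = Theta n d \<and>
      bij_betw \<nu> {..<N} (hyp_cross n d) \<and> t \<ge> 1 \<longrightarrow>
      (\<exists>A. approx_algorithm d m K N A \<and>
         (\<forall>\<rho> \<in> {..<d} \<rightarrow>\<^sub>E {1<..}. \<forall>f \<in> holomorphic_ball d \<rho>.
            \<exists>E \<in> sets (sample_measure b d m).
              measure (sample_measure b d m) E \<ge> 1 - \<epsilon> \<and>
              (\<forall>y\<in>E. \<forall>noise D. is_data m K \<phi> f y noise D \<longrightarrow>
                 (let f_hat = approximant d K N \<phi> \<Psi> \<nu> (algorithm_output d m K \<phi> A y D)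
                  in \<forall>p. 0 < p \<and> p \<le> 1 \<longrightarrow>
                    (let \<zeta> = error_term b d m L c0 p (C d p \<rho>) Vh f noise in
                       L2_norm (cube_measure b d) (\<lambda>x. f x - f_hat x) \<le>
                         ereal c1 * (\<zeta> + ereal (1 / t)) \<and>
                       Linf_norm (cube_measure b d) (\<lambda>x. f x - f_hat x) \<le>
                         ereal (c2 * sqrt (m / L)) * (\<zeta> + ereal (1 / t)))))) \<and>
         real (algorithm_cost d m K \<phi> A) \<le>
           c3 * (m * N * d +
                 t * (m * N * K + (N + m) * (gram_cost K \<phi> + K)) * N powr cost_exponent b)))"

end

theory Submission
  imports Defs "HOL-Complex_Analysis.Complex_Analysis"
begin

text \<open>
  The constant \<open>C d p \<rho>\<close> may depend on \<open>d\<close>, \<open>p\<close> and \<open>\<rho>\<close> in any way, and the algorithm may be chosen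
  freely.  This leaves room for a much simpler method than sparse recovery: least squares on a small box of
  indices.  Put \<open>X = m / L\<close>, choose \<open>s\<close> with \<open>s ^ (14 d) \<le> X < (s + 1) ^ (14 d)\<close> and let
  \<open>S = {0, \<dots>, s - 1} ^ d\<close>, which lies in the hyperbolic cross because \<open>s ^ d \<le> n\<close>.

  \<^item> \<^emph>\<open>Approximation.\<close>  A function in the unit ball of a polyellipse is approximated on the cube by
    polynomials with indices in \<open>S\<close> up to an error that decays geometrically in \<open>s\<close>, hence faster than
    every power of \<open>X\<close> (\<open>tensor_polynomial_approximation\<close>, \<open>approximation_constant\<close>).  The approximant is
    the tensor product Lagrange interpolant at Fekete points; its error is controlled one variable at a
    time, so that separate holomorphy is all that enters, and scalar Laurent expansions suffice.

  \<^item> \<^emph>\<open>Stability.\<close>  Both orthonormal families obey a polynomial sup-norm bound (\<open>Nikolskii\<close>).  As \<open>m / L\<close>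
    is at least a high power of \<open>s ^ d\<close>, Hoeffding's inequality for the single entries of the empirical Gram matrix and
    a union bound already give a matrix within \<open>1 / 2\<close> of the identity, with probability \<open>1 - \<epsilon>\<close>
    (\<open>good_samples_probability\<close>, \<open>failure_probability_le\<close>).

  \<^item> \<^emph>\<open>Algorithm.\<close>  On such samples every Landweber step \<open>x \<mapsto> x + A\<^sup>* (D - A x) / m\<close> halves the error, up to
    a multiple of the residual, that is of the approximation error plus the noise (\<open>landweber_error\<close>).
    So \<open>\<lceil>t\<rceil>\<close> steps reach accuracy \<open>1 / t\<close>, and each step costs \<open>O(m s ^ d K)\<close> operations
    (\<open>landweber_algorithm\<close>, \<open>landweber_cost_le\<close>).

  \<^item> \<^emph>\<open>Small samples.\<close>  If \<open>s < 16\<close>, then \<open>X\<close> is bounded in terms of \<open>d\<close> and the zero function is accurate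
    enough, for a suitable \<open>C d p \<rho>\<close>.

  For the second half of the theorem, a separable Hilbert space embeds isometrically into \<open>\<ell>\<^sup>2\<close>, and all
  quantities in the guarantee are invariant under linear isometries (\<open>approx_guarantee_pullback\<close>).
\<close>

section \<open>Complex inner product spaces\<close>

lemma scaleC_zero_left [simp]:
  fixes x :: "'v::complex_inner"
  shows "0 *\<^sub>C x = 0"
  using scaleC_of_real[of 0 x] by simp

lemma scaleC_zero_right [simp]:
  shows "a *\<^sub>C (0::'v::complex_inner) = 0"
  using scaleC_add_right[of a "0::'v" 0] by simp

lemma scaleC_one [simp]:
  fixes x :: "'v::complex_inner"
  shows "1 *\<^sub>C x = x"
  using scaleC_of_real[of 1 x] by simp

lemma scaleC_minus_right:
  fixes x :: "'v::complex_inner"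
  shows "a *\<^sub>C (- x) = - (a *\<^sub>C x)"
  using scaleC_add_right[of a x "-x"] by (simp add: eq_neg_iff_add_eq_0 add.commute)

lemma scaleC_minus_left:
  fixes x :: "'v::complex_inner"
  shows "(- a) *\<^sub>C x = - (a *\<^sub>C x)"
  using scaleC_add_left[of a "-a" x] by (simp add: eq_neg_iff_add_eq_0 add.commute)

lemma scaleC_diff_left:
  fixes x :: "'v::complex_inner"
  shows "(a - b) *\<^sub>C x = a *\<^sub>C x - b *\<^sub>C x"
  using scaleC_add_left[of a "-b" x] by (simp add: scaleC_minus_left)

lemma cinner_add_left:
  fixes x y z :: "'v::complex_inner"
  shows "cinner (x + y) z = cinner x z + cinner y z"
  by (metis cinner_commute cinner_add_right complex_cnj_add)

lemma cinner_scaleC_left: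
  fixes x y :: "'v::complex_inner"
  shows "cinner (a *\<^sub>C x) y = cnj a * cinner x y"
  by (metis cinner_commute cinner_scaleC_right complex_cnj_mult)

lemma cinner_zero_right [simp]:
  fixes x :: "'v::complex_inner"
  shows "cinner x 0 = 0"
  using cinner_scaleC_right[of x 0 x] by simp

lemma cinner_zero_left [simp]:
  fixes x :: "'v::complex_inner"
  shows "cinner 0 x = 0"
  using cinner_scaleC_left[of 0 x x] by simp

lemma cinner_minus_right:
  fixes x y :: "'v::complex_inner"
  shows "cinner x (- y) = - cinner x y"
  using cinner_add_right[of x y "-y"] by (simp add: eq_neg_iff_add_eq_0 add.commute)

lemma cinner_minus_left:
  fixes x y :: "'v::complex_inner"
  shows "cinner (- x) y = - cinner x y"
  using cinner_add_left by (metis cinner_commute cinner_minus_right complex_cnj_minus)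

lemma cinner_diff_right:
  fixes x y z :: "'v::complex_inner"
  shows "cinner x (y - z) = cinner x y - cinner x z"
  using cinner_add_right[of x y "-z"] by (simp add: cinner_minus_right)

lemma cinner_scaleR_right:
  fixes x y :: "'v::complex_inner"
  shows "cinner x (r *\<^sub>R y) = of_real r * cinner x y"
  using cinner_scaleC_right[of x "of_real r" y] by (simp add: scaleC_of_real)

lemma cinner_scaleR_left:
  fixes x y :: "'v::complex_inner"
  shows "cinner (r *\<^sub>R x) y = of_real r * cinner x y"
  using cinner_scaleC_left[of "of_real r" x y] by (simp add: scaleC_of_real)

lemma scaleC_sum_right: "a *\<^sub>C (\<Sum>i\<in>I. f i) = (\<Sum>i\<in>I. a *\<^sub>C (f i :: 'v::complex_inner))"
  by (induction I rule: infinite_finite_induct) (auto simp: scaleC_add_right)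

lemma scaleC_sum_left: "(\<Sum>i\<in>I. f i) *\<^sub>C x = (\<Sum>i\<in>I. f i *\<^sub>C (x :: 'v::complex_inner))"
  by (induction I rule: infinite_finite_induct) (auto simp: scaleC_add_left)

lemma cinner_sum_right: "cinner x (\<Sum>i\<in>I. f i) = (\<Sum>i\<in>I. cinner x (f i :: 'v::complex_inner))"
  by (induction I rule: infinite_finite_induct) (auto simp: cinner_add_right)

lemma cinner_sum_left: "cinner (\<Sum>i\<in>I. f i) x = (\<Sum>i\<in>I. cinner (f i :: 'v::complex_inner) x)"
  by (induction I rule: infinite_finite_induct) (auto simp: cinner_add_left)

lemma norm_square_cinner: "(norm (x :: 'v::complex_inner))\<^sup>2 = Re (cinner x x)"
  by (simp add: cinner_self)

lemma norm_scaleC: "norm (a *\<^sub>C (x :: 'v::complex_inner)) = cmod a * norm x"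
proof -
  have "cinner (a *\<^sub>C x) (a *\<^sub>C x) = (a * cnj a) * cinner x x"
    by (simp add: cinner_scaleC_left cinner_scaleC_right)
  then have "(norm (a *\<^sub>C x))\<^sup>2 = Re ((a * cnj a) * cinner x x)" by (simp add: norm_square_cinner)
  also have "\<dots> = Re (of_real ((cmod a)\<^sup>2 * (norm x)\<^sup>2))"
    by (simp only: complex_norm_square[symmetric] cinner_self of_real_mult)
  also have "\<dots> = (cmod a * norm x)\<^sup>2" by (simp only: Re_complex_of_real power_mult_distrib)
  finally show ?thesis by (simp add: power2_eq_iff_nonneg)
qed

lemma norm_add_square:
  "(norm (x + y :: 'v::complex_inner))\<^sup>2 = (norm x)\<^sup>2 + 2 * Re (cinner x y) + (norm y)\<^sup>2"
proof -
  have "Re (cinner y x) = Re (cinner x y)" by (subst cinner_commute) simp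
  then show ?thesis by (simp add: norm_square_cinner cinner_add_left cinner_add_right)
qed

lemma norm_Pythagoras:
  "cinner x y = 0 \<Longrightarrow> (norm (x + y :: 'v::complex_inner))\<^sup>2 = (norm x)\<^sup>2 + (norm y)\<^sup>2"
  by (simp add: norm_add_square)

lemma cmod_cinner_le: "cmod (cinner x y) \<le> norm x * norm (y :: 'v::complex_inner)"
proof (cases "x = 0")
  case False
  define c where "c = cinner x y / of_real ((norm x)\<^sup>2)"
  have "cinner x (y - c *\<^sub>C x) = 0"
    using False by (simp add: cinner_diff_right cinner_scaleC_right cinner_self c_def)
  then have orth: "cinner (c *\<^sub>C x) (y - c *\<^sub>C x) = 0" by (simp add: cinner_scaleC_left)
  have "(norm y)\<^sup>2 = (norm (c *\<^sub>C x))\<^sup>2 + (norm (y - c *\<^sub>C x))\<^sup>2"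
    using norm_Pythagoras[OF orth] by simp
  then have "(cmod c * norm x)\<^sup>2 \<le> (norm y)\<^sup>2" by (simp add: norm_scaleC)
  then have "cmod c * norm x \<le> norm y" by (rule power2_le_imp_le) simp
  then have "cmod c * norm x * norm x \<le> norm y * norm x" by (rule mult_right_mono) simp
  moreover have "cmod c * norm x * norm x = cmod (cinner x y)"
    using False by (simp add: c_def norm_divide power2_eq_square norm_mult)
  ultimately show ?thesis by (simp add: mult.commute)
qed simp

lemma Re_cinner_le: "Re (cinner x y) \<le> norm x * norm (y :: 'v::complex_inner)"
  using complex_Re_le_cmod cmod_cinner_le order_trans by blast

subsection \<open>Gram--Schmidt orthonormalization\<close>

text \<open>Vectors that depend on their predecessors give the entry \<open>0\<close>, so that arbitrary sequences
  can be orthonormalized without selecting a subsequence.\<close>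

fun gram_schmidt :: "(nat \<Rightarrow> 'v::complex_inner) \<Rightarrow> nat \<Rightarrow> 'v" where
  "gram_schmidt v n = sgn (v n - (\<Sum>i<n. cinner (gram_schmidt v i) (v n) *\<^sub>C gram_schmidt v i))"

declare gram_schmidt.simps [simp del]

definition partial_proj :: "(nat \<Rightarrow> 'v::complex_inner) \<Rightarrow> nat \<Rightarrow> 'v \<Rightarrow> 'v" where
  "partial_proj v n x = (\<Sum>i<n. cinner (gram_schmidt v i) x *\<^sub>C gram_schmidt v i)"

lemma gram_schmidt_eq: "gram_schmidt v n = sgn (v n - partial_proj v n (v n))"
  unfolding partial_proj_def by (subst gram_schmidt.simps) simp

lemma sgn_scaleR_norm: "norm x *\<^sub>R sgn (x::'v::real_normed_vector) = x"
  by (cases "x = 0") (simp_all add: sgn_div_norm)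

lemma gram_schmidt_self:
  "cinner (gram_schmidt v n) (gram_schmidt v n) = (if gram_schmidt v n = 0 then 0 else 1)"
  by (simp add: cinner_self gram_schmidt_eq norm_sgn sgn_zero_iff)

lemma gram_schmidt_orth_aux:
  "\<forall>i j. i < n \<and> j < n \<and> i \<noteq> j \<longrightarrow> cinner (gram_schmidt v i) (gram_schmidt v j) = 0"
proof (induction n)
  case (Suc n)
  let ?e = "gram_schmidt v"
  have new: "cinner (?e j) (?e n) = 0" if j: "j < n" for j
  proof -
    have "cinner (?e j) (partial_proj v n (v n)) =
        (\<Sum>i<n. cinner (?e i) (v n) * cinner (?e j) (?e i))"
      unfolding partial_proj_def by (simp add: cinner_sum_right cinner_scaleC_right)
    also have "\<dots> = (\<Sum>i<n. if i = j then cinner (?e j) (v n) * cinner (?e j) (?e j) else 0)"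
      using Suc j by (intro sum.cong) auto
    also have "\<dots> = cinner (?e j) (v n) * cinner (?e j) (?e j)" using j by simp
    also have "\<dots> = cinner (?e j) (v n)" by (auto simp: gram_schmidt_self)
    finally have "cinner (?e j) (v n - partial_proj v n (v n)) = 0" by (simp add: cinner_diff_right)
    then show ?thesis by (simp add: gram_schmidt_eq[of v n] sgn_div_norm cinner_scaleR_right)
  qed
  then have new': "cinner (?e n) (?e j) = 0" if "j < n" for j
    using that by (metis cinner_commute complex_cnj_zero)
  show ?case using Suc new new' by (auto simp: less_Suc_eq)
qed simp

lemma gram_schmidt_orth: "i \<noteq> j \<Longrightarrow> cinner (gram_schmidt v i) (gram_schmidt v j) = 0"
  using gram_schmidt_orth_aux[of "Suc (max i j)" v, rule_format, of i j] by (simp add: less_Suc_eq_le)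

lemma cinner_partial_proj:
  assumes "j < n"
  shows "cinner (gram_schmidt v j) (partial_proj v n x) = cinner (gram_schmidt v j) x"
proof -
  let ?e = "gram_schmidt v"
  have "cinner (?e j) (partial_proj v n x) = (\<Sum>i<n. cinner (?e i) x * cinner (?e j) (?e i))"
    unfolding partial_proj_def by (simp add: cinner_sum_right cinner_scaleC_right)
  also have "\<dots> = (\<Sum>i<n. if i = j then cinner (?e j) x * cinner (?e j) (?e j) else 0)"
    by (intro sum.cong) (auto simp: gram_schmidt_orth)
  also have "\<dots> = cinner (?e j) x * cinner (?e j) (?e j)" using assms by simp
  also have "\<dots> = cinner (?e j) x" by (auto simp: gram_schmidt_self)
  finally show ?thesis .
qed

lemma partial_proj_in_span: "partial_proj v n x \<in> complex_vector.span (v ` {..<n})"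
proof -
  have gs: "gram_schmidt v i \<in> complex_vector.span (v ` {..<n})" if "i < n" for i
    using that
  proof (induction i rule: less_induct)
    case (less i)
    have "partial_proj v i (v i) \<in> complex_vector.span (v ` {..<n})"
      unfolding partial_proj_def using less
      by (intro complex_vector.span_sum complex_vector.span_scale) auto
    then have "v i - partial_proj v i (v i) \<in> complex_vector.span (v ` {..<n})"
      using less by (intro complex_vector.span_diff) (auto intro: complex_vector.span_base)
    then show ?case
      unfolding gram_schmidt_eq[of v i] sgn_div_norm scaleC_of_real[symmetric]
      by (rule complex_vector.span_scale)
  qed
  show ?thesis unfolding partial_proj_def
    by (intro complex_vector.span_sum complex_vector.span_scale gs) auto
qed

lemma cinner_partial_proj_partial_proj:
  "cinner (partial_proj v n z) (x - partial_proj v n x) = 0"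
  unfolding partial_proj_def[of v n z]
  by (simp add: cinner_sum_left cinner_scaleC_left cinner_diff_right cinner_partial_proj)

lemma partial_proj_generator:
  assumes "j < n"
  shows "partial_proj v n (v j) = v j"
proof -
  let ?e = "gram_schmidt v"
  define w where "w = v j - partial_proj v j (v j)"
  have w: "norm w *\<^sub>R ?e j = w"
    unfolding gram_schmidt_eq[of v j] w_def by (rule sgn_scaleR_norm)
  have fix_e: "partial_proj v n (?e i) = ?e i" if "i < n" for i
  proof -
    have "partial_proj v n (?e i) = (\<Sum>k<n. if k = i then cinner (?e i) (?e i) *\<^sub>C ?e i else 0)"
      unfolding partial_proj_def by (intro sum.cong) (auto simp: gram_schmidt_orth)
    also have "\<dots> = cinner (?e i) (?e i) *\<^sub>C ?e i" using that by simp
    also have "\<dots> = ?e i" by (simp add: gram_schmidt_self)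
    finally show ?thesis .
  qed
  have add: "partial_proj v n (a + b) = partial_proj v n a + partial_proj v n b" for a b
    by (simp add: partial_proj_def cinner_add_right scaleC_add_left sum.distrib)
  have scale: "partial_proj v n (c *\<^sub>C a) = c *\<^sub>C partial_proj v n a" for a c
    by (simp add: partial_proj_def cinner_scaleC_right scaleC_sum_right scaleC_scaleC)
  have sum: "partial_proj v n (\<Sum>i\<in>I. f i) = (\<Sum>i\<in>I. partial_proj v n (f i))" for I :: "nat set" and f
    by (induction I rule: infinite_finite_induct) (auto simp: add, simp_all add: partial_proj_def)
  have 1: "partial_proj v n (partial_proj v j (v j)) = partial_proj v j (v j)"
    unfolding partial_proj_def[of v j] sum scale using assms by (intro sum.cong) (auto simp: fix_e)
  have "partial_proj v n (norm w *\<^sub>R ?e j) = norm w *\<^sub>R ?e j"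
    by (simp add: scale fix_e assms scaleC_of_real[symmetric])
  then have 2: "partial_proj v n w = w" by (simp only: w)
  show ?thesis using add[of "partial_proj v j (v j)" w] 1 2 by (simp add: w_def)
qed

lemma norm_partial_proj:
  "(norm (partial_proj v n x))\<^sup>2 = (\<Sum>i<n. (cmod (cinner (gram_schmidt v i) x))\<^sup>2)"
proof -
  let ?e = "gram_schmidt v"
  have "cinner (partial_proj v n x) (partial_proj v n x) =
      (\<Sum>i<n. cnj (cinner (?e i) x) * cinner (?e i) (partial_proj v n x))"
    by (subst partial_proj_def) (simp add: cinner_sum_left cinner_scaleC_left)
  also have "\<dots> = (\<Sum>i<n. of_real ((cmod (cinner (?e i) x))\<^sup>2))"
    using complex_norm_square by (intro sum.cong) (auto simp: cinner_partial_proj mult.commute)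
  finally show ?thesis unfolding norm_square_cinner by simp
qed

lemma norm_partial_proj_split:
  "(norm x)\<^sup>2 = (norm (partial_proj v n x))\<^sup>2 + (norm (x - partial_proj v n x))\<^sup>2"
  using norm_Pythagoras[OF cinner_partial_proj_partial_proj[of v n x x]] by simp

lemma partial_proj_best:
  assumes "u \<in> complex_vector.span (v ` {..<n})"
  shows "cinner u (x - partial_proj v n x) = 0"
  using assms
proof (induction rule: complex_vector.span_induct_alt)
  case (step c a b)
  then obtain j where j: "a = v j" "j < n" by auto
  have "cinner a (x - partial_proj v n x) = 0"
    using cinner_partial_proj_partial_proj[of v n "v j" x] partial_proj_generator[OF j(2), of v] j by simp
  then show ?case using step by (simp add: cinner_add_left cinner_scaleC_left)
qed simp

lemma norm_diff_partial_proj_le: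
  assumes "u \<in> complex_vector.span (v ` {..<n})"
  shows "norm (x - partial_proj v n x) \<le> norm (x - u)"
proof -
  have "partial_proj v n x - u \<in> complex_vector.span (v ` {..<n})"
    using assms partial_proj_in_span by (rule complex_vector.span_diff[rotated])
  from norm_Pythagoras[OF partial_proj_best[OF this, of x]]
  have "(norm (x - u))\<^sup>2 = (norm (partial_proj v n x - u))\<^sup>2 + (norm (x - partial_proj v n x))\<^sup>2"
    by simp
  then have "(norm (x - partial_proj v n x))\<^sup>2 \<le> (norm (x - u))\<^sup>2" by simp
  then show ?thesis by (rule power2_le_imp_le) simp
qed

lemma orth_proj_eqI:
  assumes "complex_vector.subspace S" "u \<in> S" "\<And>v. v \<in> S \<Longrightarrow> cinner v (x - u) = 0"
  shows "orth_proj S x = u"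
  unfolding orth_proj_def
proof (rule the_equality)
  fix u' assume u': "u' \<in> S \<and> (\<forall>v\<in>S. cinner v (x - u') = 0)"
  have d: "u - u' \<in> S" using assms u' by (intro complex_vector.subspace_diff) auto
  have "cinner (u - u') (u - u') = cinner (u - u') (x - u') - cinner (u - u') (x - u)"
    by (simp add: cinner_diff_right)
  also have "\<dots> = 0" using assms(3)[OF d] u' d by simp
  finally show "u' = u" by (simp add: cinner_self)
qed (use assms in auto)

text \<open>The orthogonal projection is a definite description; on a finite-dimensional space it exists because
  \<^term>\<open>partial_proj\<close> for the given basis is one.\<close>

lemma orth_proj_props:
  assumes "basis_of K \<phi> Vh"
  shows "complex_vector.subspace Vh" "orth_proj Vh x \<in> Vh"
    "v \<in> Vh \<Longrightarrow> cinner v (x - orth_proj Vh x) = 0"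
proof -
  have Vh: "Vh = complex_vector.span (\<phi> ` {..<K})" using assms by (simp add: basis_of_def)
  show S: "complex_vector.subspace Vh" unfolding Vh by (rule complex_vector.subspace_span)
  have eq: "orth_proj Vh x = partial_proj \<phi> K x"
    using S partial_proj_in_span partial_proj_best unfolding Vh by (rule orth_proj_eqI)
  show "orth_proj Vh x \<in> Vh" unfolding eq unfolding Vh by (rule partial_proj_in_span)
  show "v \<in> Vh \<Longrightarrow> cinner v (x - orth_proj Vh x) = 0"
    unfolding eq unfolding Vh by (rule partial_proj_best)
qed

section \<open>Transfer between Hilbert spaces\<close>

text \<open>The coordinates with respect to the orthonormalization of a dense sequence \<open>v\<close>.  Parseval's identity
  holds since the distance of \<open>x\<close> to its projection onto the span of \<open>v\<^sub>0, \<dots>, v\<^sub>n\<^sub>-\<^sub>1\<close> is at most its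
  distance to each of these vectors, and some \<open>v\<^sub>j\<close> is arbitrarily close to \<open>x\<close>.\<close>

lemma separable_isometry:
  obtains U :: "'v::{complex_hilbert,second_countable_topology} \<Rightarrow> ell2"
  where "\<And>x y. U (x + y) = U x + U y" "\<And>a x. U (a *\<^sub>C x) = a *\<^sub>C U x"
    "\<And>x y. cinner (U x) (U y) = cinner x y"
proof -
  obtain Q :: "'v set" where Q: "countable Q" "\<And>V. open V \<Longrightarrow> V \<noteq> {} \<Longrightarrow> \<exists>q\<in>Q. q \<in> V"
    by (rule countable_dense_setE) blast
  then have "Q \<noteq> {}" using Q(2)[of UNIV] by auto
  define v where "v = from_nat_into Q"
  have v: "range v = Q" unfolding v_def using Q(1) \<open>Q \<noteq> {}\<close> by simp
  let ?e = "gram_schmidt v"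
  have Bessel: "(\<Sum>i<n. (cmod (cinner (?e i) x))\<^sup>2) \<le> (norm x)\<^sup>2" for n x
    using norm_partial_proj[of v n x] norm_partial_proj_split[of x v n] by simp
  have summ: "summable (\<lambda>i. (cmod (cinner (?e i) x))\<^sup>2)" for x
    by (rule summableI_nonneg_bounded[where x = "(norm x)\<^sup>2"]) (use Bessel in auto)
  define U where "U x = Abs_ell2 (\<lambda>i. cinner (?e i) x)" for x
  have seq: "seq_of (U x) = (\<lambda>i. cinner (?e i) x)" for x
    unfolding U_def using summ by (simp add: Abs_ell2_inverse)
  have add: "U (x + y) = U x + U y" for x y
    by (rule ell2_eqI) (simp add: seq cinner_add_right)
  have scale: "U (a *\<^sub>C x) = a *\<^sub>C U x" for a x
    by (rule ell2_eqI) (simp add: seq cinner_scaleC_right)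
  have norm: "norm (U x) = norm x" for x
  proof -
    have "(\<lambda>n. \<Sum>i<n. (cmod (cinner (?e i) x))\<^sup>2) \<longlonglongrightarrow> (norm x)\<^sup>2"
    proof (rule LIMSEQ_I)
      fix r :: real assume "0 < r"
      then have "ball x (sqrt r) \<noteq> {}" by simp
      then obtain j where j: "v j \<in> ball x (sqrt r)" using Q(2)[of "ball x (sqrt r)"] v by fastforce
      have "norm ((\<Sum>i<n. (cmod (cinner (?e i) x))\<^sup>2) - (norm x)\<^sup>2) < r" if n: "n \<ge> Suc j" for n
      proof -
        have "norm (x - partial_proj v n x) \<le> norm (x - v j)"
          by (rule norm_diff_partial_proj_le) (use n in \<open>auto intro: complex_vector.span_base\<close>)
        also have "\<dots> < sqrt r" using j by (simp add: dist_norm)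
        finally have "(norm (x - partial_proj v n x))\<^sup>2 < r"
          using \<open>0 < r\<close> by (metis norm_ge_zero power_strict_mono real_sqrt_pow2 less_imp_le zero_less_numeral pos2)
        then show ?thesis
          using norm_partial_proj_split[of x v n] norm_partial_proj[of v n x] by simp
      qed
      then show "\<exists>N. \<forall>n\<ge>N. norm ((\<Sum>i<n. (cmod (cinner (?e i) x))\<^sup>2) - (norm x)\<^sup>2) < r" by blast
    qed
    then have "(\<Sum>i. (cmod (cinner (?e i) x))\<^sup>2) = (norm x)\<^sup>2"
      using summable_LIMSEQ[OF summ] LIMSEQ_unique by blast
    then have "(norm (U x))\<^sup>2 = (norm x)\<^sup>2" by (simp add: norm_ell2_power2 seq)
    then show ?thesis by (simp add: power2_eq_iff_nonneg)
  qed
  have Re: "Re (cinner (U x) (U y)) = Re (cinner x y)" for x y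
    using norm_add_square[of x y] norm_add_square[of "U x" "U y"] norm[of "x + y"] norm[of x] norm[of y]
    by (simp add: add)
  have cinner: "cinner (U x) (U y) = cinner x y" for x y
  proof (rule complex_eqI)
    show "Im (cinner (U x) (U y)) = Im (cinner x y)"
      using Re[of x "\<i> *\<^sub>C y"] by (simp add: scale cinner_scaleC_right)
  qed (rule Re)
  show thesis using that add scale cinner by blast
qed

text \<open>The two requirements of \<^const>\<open>approx_guarantee\<close> on a given algorithm: its accuracy for one function
  and the bound on its cost.\<close>

abbreviation accurate_recovery ::
    "family \<Rightarrow> nat \<Rightarrow> (nat \<Rightarrow> real poly) \<Rightarrow> 'v set \<Rightarrow>
     (nat \<Rightarrow> 'v::{complex_hilbert,second_countable_topology}) \<Rightarrow> nat \<Rightarrow> real \<Rightarrow> nat \<Rightarrow> real \<Rightarrow> nat \<Rightarrow>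
     (nat \<Rightarrow> nat \<Rightarrow> nat) \<Rightarrow> real \<Rightarrow> real \<Rightarrow> real \<Rightarrow> real \<Rightarrow> (nat \<Rightarrow> real \<Rightarrow> (nat \<Rightarrow> real) \<Rightarrow> real) \<Rightarrow>
     algorithm \<Rightarrow> (nat \<Rightarrow> real) \<Rightarrow> ((nat \<Rightarrow> real) \<Rightarrow> 'v) \<Rightarrow> bool" where
  "accurate_recovery b d \<Psi> Vh \<phi> m \<epsilon> K L N \<nu> t c0 c1 c2 C A \<rho> f \<equiv>
     \<exists>E \<in> sets (sample_measure b d m). measure (sample_measure b d m) E \<ge> 1 - \<epsilon> \<and>
       (\<forall>y\<in>E. \<forall>noise D. is_data m K \<phi> f y noise D \<longrightarrow> (\<forall>p. 0 < p \<and> p \<le> 1 \<longrightarrow>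
          L2_norm (cube_measure b d) (\<lambda>x. f x - approximant d K N \<phi> \<Psi> \<nu> (algorithm_output d m K \<phi> A y D) x) \<le>
            ereal c1 * (error_term b d m L c0 p (C d p \<rho>) Vh f noise + ereal (1 / t)) \<and>
          Linf_norm (cube_measure b d) (\<lambda>x. f x - approximant d K N \<phi> \<Psi> \<nu> (algorithm_output d m K \<phi> A y D) x) \<le>
            ereal (c2 * sqrt (m / L)) * (error_term b d m L c0 p (C d p \<rho>) Vh f noise + ereal (1 / t))))"

abbreviation cost_bound ::
    "family \<Rightarrow> real \<Rightarrow> nat \<Rightarrow> nat \<Rightarrow> nat \<Rightarrow> nat \<Rightarrow> nat \<Rightarrow> real \<Rightarrow> real" where
  "cost_bound b c3 d m N K F t \<equiv>
     c3 * (real (m * N * d) + t * real (m * N * K + (N + m) * (F + K)) * real N powr cost_exponent b)"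

locale hilbert_isometry =
  fixes U :: "'v::{complex_hilbert,second_countable_topology} \<Rightarrow> 'w::{complex_hilbert,second_countable_topology}"
  assumes add: "U (x + y) = U x + U y"
    and scaleC: "U (a *\<^sub>C x) = a *\<^sub>C U x"
    and cinner: "cinner (U x) (U y) = cinner x y"
begin

lemma norm: "norm (U x) = norm x"
proof -
  have "(norm (U x))\<^sup>2 = (norm x)\<^sup>2" by (simp add: norm_square_cinner cinner)
  then show ?thesis by (simp add: power2_eq_iff_nonneg)
qed

lemma scaleR: "U (r *\<^sub>R x) = r *\<^sub>R U x"
  using scaleC[of "of_real r" x] by (simp add: scaleC_of_real)

lemma zero: "U 0 = 0"
  using scaleC[of 0 0] by simp

lemma diff: "U (x - y) = U x - U y"
  using add[of "x - y" y] by simp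

lemma sum: "U (\<Sum>i\<in>I. f i) = (\<Sum>i\<in>I. U (f i))"
  by (induction I rule: infinite_finite_induct) (auto simp: add zero)

lemma dist: "dist (U x) (U y) = dist x y"
  by (simp add: dist_norm norm flip: diff)

lemma injective: "U x = U y \<longleftrightarrow> x = y"
  using dist[of x y] by (metis dist_eq_0_iff)

lemma bounded_linear: "bounded_linear U"
  by (rule bounded_linear_intro[where K = 1]) (auto simp: add scaleR norm)

lemma linear: "Vector_Spaces.linear ((*\<^sub>C) :: complex \<Rightarrow> 'v \<Rightarrow> 'v) ((*\<^sub>C) :: complex \<Rightarrow> 'w \<Rightarrow> 'w) U"
  by unfold_locales (auto simp: add scaleC scaleC_add_left scaleC_add_right scaleC_scaleC)

text \<open>An isometry is a homeomorphism onto its range: \<open>S\<close> is the preimage of the union of the balls around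
  \<open>U x\<close> with the radii of balls around \<open>x \<in> S\<close> inside \<open>S\<close>.\<close>

lemma measurable_iff: "(\<lambda>x. U (h x)) \<in> borel_measurable M \<longleftrightarrow> h \<in> borel_measurable M"
proof
  assume h: "h \<in> borel_measurable M"
  have "continuous_on UNIV U" by (rule linear_continuous_on[OF bounded_linear])
  then show "(\<lambda>x. U (h x)) \<in> borel_measurable M"
    using h by (rule borel_measurable_continuous_on)
next
  assume Uh: "(\<lambda>x. U (h x)) \<in> borel_measurable M"
  show "h \<in> borel_measurable M"
  proof (rule borel_measurableI)
    fix S :: "'v set" assume "open S"
    then obtain r where r: "\<And>x. x \<in> S \<Longrightarrow> r x > 0 \<and> ball x (r x) \<subseteq> S"
      unfolding open_contains_ball by metis
    define O' where "O' = (\<Union>x\<in>S. ball (U x) (r x))"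
    have "U z \<in> O' \<longleftrightarrow> z \<in> S" for z
      using r unfolding O'_def by (fastforce simp: dist)
    then have "h -` S \<inter> space M = (\<lambda>x. U (h x)) -` O' \<inter> space M" by auto
    moreover have "open O'" unfolding O'_def by auto
    ultimately show "h -` S \<inter> space M \<in> sets M" using Uh by (metis borel_open measurable_sets)
  qed
qed

lemma L2_norm: "L2_norm M (\<lambda>x. U (h x)) = L2_norm M h"
  by (simp add: L2_norm_def measurable_iff norm)

lemma Linf_norm: "Linf_norm M (\<lambda>x. U (h x)) = Linf_norm M h"
  by (simp add: Linf_norm_def measurable_iff norm)

lemma basis_of: 
  assumes "basis_of K \<phi> Vh"
  shows "basis_of K (\<lambda>k. U (\<phi> k)) (U ` Vh)"
proof -
  interpret L: Vector_Spaces.linear "(*\<^sub>C) :: complex \<Rightarrow> 'v \<Rightarrow> 'v" "(*\<^sub>C) :: complex \<Rightarrow> 'w \<Rightarrow> 'w" U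
    by (rule linear)
  have img: "(\<lambda>k. U (\<phi> k)) ` {..<K} = U ` \<phi> ` {..<K}" by auto
  have inj: "inj_on U X" for X by (simp add: inj_on_def injective)
  show ?thesis
    using assms L.independent_injective_image[OF _ inj, of "\<phi> ` {..<K}"] unfolding basis_of_def img
    by (auto simp: inj_on_def injective L.span_image)
qed

lemma orth_proj:
  assumes "basis_of K \<phi> Vh"
  shows "orth_proj (U ` Vh) (U x) = U (orth_proj Vh x)"
proof (rule orth_proj_eqI)
  show "complex_vector.subspace (U ` Vh)"
    by (rule orth_proj_props(1)[OF basis_of[OF assms]])
qed (use orth_proj_props[OF assms] in \<open>auto simp: cinner simp flip: diff\<close>)

lemma gram_map: "gram_map K (\<lambda>k. U (\<phi> k)) = gram_map K \<phi>"
  by (rule ext) (simp add: gram_map_def cinner)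

lemma holomorphic_ball:
  assumes "f \<in> holomorphic_ball d \<rho>"
  shows "(\<lambda>y. U (f y)) \<in> holomorphic_ball d \<rho>"
proof -
  obtain W g where W: "openin (product_topology (\<lambda>_. euclidean) {..<d}) W" "polyellipse d \<rho> \<subseteq> W"
    and g: "separately_holomorphic_on d g W"
      "\<forall>y\<in>cube d. g (\<lambda>k\<in>{..<d}. complex_of_real (y k)) = f y"
      "(SUP z\<in>polyellipse d \<rho>. ereal (norm (g z))) \<le> 1"
    using assms unfolding holomorphic_ball_def by blast
  have "separately_holomorphic_on d (\<lambda>z. U (g z)) W"
    unfolding separately_holomorphic_on_def
  proof (intro ballI allI impI)
    fix z k assume "z \<in> W" "k < d"
    then obtain D where "((\<lambda>w. g (z(k := w))) has_derivative (\<lambda>h. h *\<^sub>C D)) (at (z k))"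
      using g(1) unfolding separately_holomorphic_on_def by blast
    from bounded_linear.has_derivative[OF bounded_linear this]
    show "\<exists>D. ((\<lambda>w. U (g (z(k := w)))) has_derivative (\<lambda>h. h *\<^sub>C D)) (at (z k))"
      by (auto simp: scaleC)
  qed
  then show ?thesis unfolding holomorphic_ball_def using W g
    by (intro CollectI exI[of _ W] exI[of _ "\<lambda>z. U (g z)"]) (auto simp: norm)
qed

text \<open>The Gram matrix is the same for \<open>\<phi>\<close> and \<open>U \<circ> \<phi>\<close>.  Hence an algorithm has the same cost and output for
  both bases, and its error for \<open>f\<close> is the error for \<open>U \<circ> f\<close>.\<close>

lemma approx_guarantee_pullback:
  assumes "approx_guarantee TYPE('w) c0 c1 c2 c3 C"
  shows "approx_guarantee TYPE('v) c0 c1 c2 c3 C"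
  unfolding approx_guarantee_def Let_def
proof (intro allI impI)
  fix b d \<Psi> m K n N \<nu> and \<epsilon> L t :: real and Vh :: "'v set" and \<phi> :: "nat \<Rightarrow> 'v"
  assume H: "1 \<le> d \<and> orthonormal_polys (measure_1d b) \<Psi> \<and> basis_of K \<phi> Vh \<and> 3 \<le> m \<and> 0 < \<epsilon> \<and> \<epsilon> < 1 \<and>
     1 \<le> K \<and> L = log_factor m d \<epsilon> \<and> n = nat \<lceil>real m / L\<rceil> \<and> N = Theta n d \<and>
     bij_betw \<nu> {..<N} (hyp_cross n d) \<and> 1 \<le> t"
  then have basis: "basis_of K \<phi> Vh" by simp
  have H': "1 \<le> d \<and> orthonormal_polys (measure_1d b) \<Psi> \<and> basis_of K (\<lambda>k. U (\<phi> k)) (U ` Vh) \<and>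
     3 \<le> m \<and> 0 < \<epsilon> \<and> \<epsilon> < 1 \<and>
     1 \<le> K \<and> L = log_factor m d \<epsilon> \<and> n = nat \<lceil>real m / L\<rceil> \<and> N = Theta n d \<and>
     bij_betw \<nu> {..<N} (hyp_cross n d) \<and> 1 \<le> t"
    using H basis_of by blast
  obtain A where A: "approx_algorithm d m K N A"
    and err: "\<forall>\<rho> \<in> {..<d} \<rightarrow>\<^sub>E {1<..}. \<forall>f \<in> holomorphic_ball d \<rho>.
      accurate_recovery b d \<Psi> (U ` Vh) (\<lambda>k. U (\<phi> k)) m \<epsilon> K L N \<nu> t c0 c1 c2 C A \<rho> f"
    and cost: "real (algorithm_cost d m K (\<lambda>k. U (\<phi> k)) A) \<le>
      cost_bound b c3 d m N K (gram_cost K (\<lambda>k. U (\<phi> k))) t"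
    using assms[unfolded approx_guarantee_def Let_def, rule_format, OF H'] by blast
  have gc: "gram_cost K (\<lambda>k. U (\<phi> k)) = gram_cost K \<phi>"
    unfolding gram_cost_def gram_map ..
  have cost': "algorithm_cost d m K (\<lambda>k. U (\<phi> k)) A = algorithm_cost d m K \<phi> A"
    unfolding algorithm_cost_def gram_map gc ..
  have out: "algorithm_output d m K (\<lambda>k. U (\<phi> k)) A = algorithm_output d m K \<phi> A"
    unfolding algorithm_output_def gram_map ..
  have appr: "approximant d K N (\<lambda>k. U (\<phi> k)) \<Psi> \<nu> c y = U (approximant d K N \<phi> \<Psi> \<nu> c y)" for c y
    by (simp add: approximant_def sum scaleR scaleC)
  have et: "error_term b d m L c0 p Cp (U ` Vh) (\<lambda>y. U (f y)) (\<lambda>i. U (noise i)) =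
      error_term b d m L c0 p Cp Vh f noise" for p Cp f noise
    unfolding error_term_def
    by (simp add: norm orth_proj[OF basis] Linf_norm flip: diff)
  show "\<exists>A. approx_algorithm d m K N A \<and>
      (\<forall>\<rho> \<in> {..<d} \<rightarrow>\<^sub>E {1<..}. \<forall>f \<in> holomorphic_ball d \<rho>.
         accurate_recovery b d \<Psi> Vh \<phi> m \<epsilon> K L N \<nu> t c0 c1 c2 C A \<rho> f) \<and>
      real (algorithm_cost d m K \<phi> A) \<le> cost_bound b c3 d m N K (gram_cost K \<phi>) t"
  proof (intro exI[of _ A] conjI ballI A)
    show "real (algorithm_cost d m K \<phi> A) \<le> cost_bound b c3 d m N K (gram_cost K \<phi>) t"
      using cost unfolding gc cost' .
    fix \<rho> and f :: "(nat \<Rightarrow> real) \<Rightarrow> 'v"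
    assume \<rho>: "\<rho> \<in> {..<d} \<rightarrow>\<^sub>E {1<..}" and f: "f \<in> holomorphic_ball d \<rho>"
    obtain E where E: "E \<in> sets (sample_measure b d m)" "measure (sample_measure b d m) E \<ge> 1 - \<epsilon>"
      and *: "\<And>y noise D p. y \<in> E \<Longrightarrow> is_data m K (\<lambda>k. U (\<phi> k)) (\<lambda>y. U (f y)) y noise D \<Longrightarrow> 0 < p \<and> p \<le> 1 \<Longrightarrow>
          L2_norm (cube_measure b d) (\<lambda>x. U (f x) - approximant d K N (\<lambda>k. U (\<phi> k)) \<Psi> \<nu>
                        (algorithm_output d m K (\<lambda>k. U (\<phi> k)) A y D) x) \<le>
             ereal c1 * (error_term b d m L c0 p (C d p \<rho>) (U ` Vh) (\<lambda>y. U (f y)) noise + ereal (1 / t)) \<and>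
          Linf_norm (cube_measure b d) (\<lambda>x. U (f x) - approximant d K N (\<lambda>k. U (\<phi> k)) \<Psi> \<nu>
                        (algorithm_output d m K (\<lambda>k. U (\<phi> k)) A y D) x) \<le>
             ereal (c2 * sqrt (m / L)) * (error_term b d m L c0 p (C d p \<rho>) (U ` Vh) (\<lambda>y. U (f y)) noise + ereal (1 / t))"
      using err[rule_format, OF \<rho> holomorphic_ball[OF f]] by blast
    show "accurate_recovery b d \<Psi> Vh \<phi> m \<epsilon> K L N \<nu> t c0 c1 c2 C A \<rho> f"
    proof (intro bexI[OF _ E(1)] conjI[OF E(2)] ballI allI impI)
      fix y noise D and p :: real
      assume y: "y \<in> E" and data: "is_data m K \<phi> f y noise D" and p: "0 < p \<and> p \<le> 1"
      have data': "is_data m K (\<lambda>k. U (\<phi> k)) (\<lambda>y. U (f y)) y (\<lambda>i. U (noise i)) D"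
        using data unfolding is_data_def by (simp add: sum scaleC flip: add)
      show "L2_norm (cube_measure b d) (\<lambda>x. f x - approximant d K N \<phi> \<Psi> \<nu> (algorithm_output d m K \<phi> A y D) x) \<le>
                         ereal c1 * (error_term b d m L c0 p (C d p \<rho>) Vh f noise + ereal (1 / t)) \<and>
            Linf_norm (cube_measure b d) (\<lambda>x. f x - approximant d K N \<phi> \<Psi> \<nu> (algorithm_output d m K \<phi> A y D) x) \<le>
                         ereal (c2 * sqrt (m / L)) * (error_term b d m L c0 p (C d p \<rho>) Vh f noise + ereal (1 / t))"
        using *[OF y data' p] unfolding out appr et diff[symmetric] L2_norm Linf_norm .
    qed
  qed
qed

end

lemma approx_guarantee_transfer:
  assumes "approx_guarantee TYPE(ell2) c0 c1 c2 c3 C"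
  shows "approx_guarantee TYPE('v::{complex_hilbert,second_countable_topology}) c0 c1 c2 c3 C"
proof -
  obtain U :: "'v \<Rightarrow> ell2" where "\<And>x y. U (x + y) = U x + U y" "\<And>a x. U (a *\<^sub>C x) = a *\<^sub>C U x"
      "\<And>x y. cinner (U x) (U y) = cinner x y"
    using separable_isometry by blast
  then have "hilbert_isometry U" by unfold_locales
  then show ?thesis using assms by (rule hilbert_isometry.approx_guarantee_pullback)
qed

section \<open>Straight-line programs and their cost\<close>

text \<open>Lists of arithmetic instructions, embedded into computation trees by \<open>code_algorithm\<close> below.\<close>

type_synonym instruction = "arith \<times> operand \<times> operand"

fun instruction_value :: "complex list \<Rightarrow> instruction \<Rightarrow> complex" where
  "instruction_value s (c, a, b) = arith_value c (operand_value s a) (operand_value s b)"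

primrec exec :: "instruction list \<Rightarrow> complex list \<Rightarrow> complex list" where
  "exec [] s = s"
| "exec (i # is) s = exec is (s @ [instruction_value s i])"

fun wf_instruction :: "nat \<Rightarrow> instruction \<Rightarrow> bool" where
  "wf_instruction r (c, a, b) \<longleftrightarrow> wf_operand r a \<and> wf_operand r b"

primrec wf_code :: "nat \<Rightarrow> instruction list \<Rightarrow> bool" where
  "wf_code r [] \<longleftrightarrow> True"
| "wf_code r (i # is) \<longleftrightarrow> wf_instruction r i \<and> wf_code (Suc r) is"

fun arith_step :: "instruction \<Rightarrow> algorithm \<Rightarrow> algorithm" where
  "arith_step (c, a, b) A = Arith c a b A"

definition code_algorithm :: "instruction list \<Rightarrow> operand list \<Rightarrow> algorithm" where
  "code_algorithm is xs = foldr arith_step is (Output xs)"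

lemma length_exec: "length (exec is s) = length s + length is"
  by (induction "is" arbitrary: s) auto

lemma exec_append: "exec (is @ js) s = exec js (exec is s)"
  by (induction "is" arbitrary: s) auto

lemma wf_code_append: "wf_code r (is @ js) \<longleftrightarrow> wf_code r is \<and> wf_code (r + length is) js"
  by (induction "is" arbitrary: r) auto

lemma operand_value_append: "wf_operand (length s) x \<Longrightarrow> operand_value (s @ s') x = operand_value s x"
  by (cases x) (auto simp: nth_append)

lemma wf_operand_mono: "wf_operand r x \<Longrightarrow> r \<le> r' \<Longrightarrow> wf_operand r' x"
  by (cases x) auto

lemma run_code_algorithm: "run T (code_algorithm is xs) s = map (operand_value (exec is s)) xs"
proof (induction "is" arbitrary: s)
  case (Cons i "is")
  then show ?case by (cases i) (simp add: code_algorithm_def)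
qed (simp add: code_algorithm_def)

lemma ops_code_algorithm: "ops T F (code_algorithm is xs) s = length is"
proof (induction "is" arbitrary: s)
  case (Cons i "is")
  then show ?case by (cases i) (simp add: code_algorithm_def)
qed (simp add: code_algorithm_def)

lemma wf_code_algorithm:
  assumes "wf_code r is" "\<forall>x\<in>set xs. wf_operand (r + length is) x"
  shows "wf_algorithm K (length xs) r (code_algorithm is xs)"
  using assms
proof (induction "is" arbitrary: r)
  case (Cons i "is")
  then show ?case by (cases i) (simp add: code_algorithm_def)
qed (simp add: code_algorithm_def)

text \<open>Programs are specified by the functions of the input whose values they make available.  This hides the
  register numbers, which change with every instruction added.\<close>

definition computes :: "nat \<Rightarrow> nat \<Rightarrow> (complex list \<Rightarrow> complex) set \<Rightarrow> bool" where
  "computes r c V \<longleftrightarrow>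
     (\<exists>is. length is \<le> c \<and> wf_code r is \<and>
        (\<forall>g\<in>V. \<exists>x. wf_operand (r + length is) x \<and>
           (\<forall>s. length s = r \<longrightarrow> operand_value (exec is s) x = g s)))"

text \<open>Quantifying over all supersets \<open>V'\<close> of \<open>V\<close> and all prior costs makes the relation composable:
  costs of successive and of repeated computations simply add up.\<close>

definition extends_by ::
    "nat \<Rightarrow> (complex list \<Rightarrow> complex) set \<Rightarrow> nat \<Rightarrow> (complex list \<Rightarrow> complex) set \<Rightarrow> bool" where
  "extends_by r V c W \<longleftrightarrow>
     (\<forall>V' c'. V \<subseteq> V' \<and> computes r c' V' \<longrightarrow> computes r (c' + c) (V' \<union> W))"

lemma computes_inputs: "computes r 0 {\<lambda>s. s ! i | i. i < r}"
  unfolding computes_def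
proof (intro exI[of _ "[]"] conjI ballI)
  fix g :: "complex list \<Rightarrow> complex"
  assume "g \<in> {\<lambda>s. s ! i | i. i < r}"
  then obtain i where "g = (\<lambda>s. s ! i)" "i < r" by blast
  then show "\<exists>x. wf_operand (r + length []) x \<and>
      (\<forall>s. length s = r \<longrightarrow> operand_value (exec [] s) x = g s)"
    by (intro exI[of _ "Reg i"]) simp
qed simp_all

lemma computes_algorithm:
  assumes "computes r c V" "set gs \<subseteq> V"
  obtains A where "wf_algorithm K (length gs) r A"
    "\<And>T s. length s = r \<Longrightarrow> run T A s = map (\<lambda>g. g s) gs"
    "\<And>T F s. ops T F A s \<le> c"
proof -
  obtain "is" where "is": "length is \<le> c" "wf_code r is"
    and ex: "\<forall>g\<in>V. \<exists>x. wf_operand (r + length is) x \<and>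
           (\<forall>s. length s = r \<longrightarrow> operand_value (exec is s) x = g s)"
    using assms(1) unfolding computes_def by blast
  from ex obtain x where x: "\<And>g. g \<in> V \<Longrightarrow> wf_operand (r + length is) (x g)"
    "\<And>g s. g \<in> V \<Longrightarrow> length s = r \<Longrightarrow> operand_value (exec is s) (x g) = g s"
    by metis
  show thesis
  proof
    show "wf_algorithm K (length gs) r (code_algorithm is (map x gs))"
      using wf_code_algorithm[OF "is"(2), of "map x gs" K] x(1) assms(2) by auto
    show "run T (code_algorithm is (map x gs)) s = map (\<lambda>g. g s) gs" if "length s = r" for T s
      using x(2) that assms(2) by (auto simp: run_code_algorithm)
    show "ops T F (code_algorithm is (map x gs)) s \<le> c" for T F s
      using "is"(1) by (simp add: ops_code_algorithm)
  qed
qed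

lemma extends_by_mono:
  assumes "extends_by r V c W" "V \<subseteq> V'" "c \<le> c'" "W' \<subseteq> W"
  shows "extends_by r V' c' W'"
proof -
  have *: "computes r c V \<Longrightarrow> c \<le> c' \<Longrightarrow> V' \<subseteq> V \<Longrightarrow> computes r c' V'" for c c' V V'
    unfolding computes_def by (meson order_trans subsetD)
  show ?thesis unfolding extends_by_def
  proof (intro allI impI, elim conjE)
    fix U c0 assume U: "V' \<subseteq> U" "computes r c0 U"
    have "computes r (c0 + c) (U \<union> W)"
      using assms(1) U assms(2) unfolding extends_by_def by blast
    then show "computes r (c0 + c') (U \<union> W')"
      by (rule *) (use assms in auto)
  qed
qed

lemma extends_by_refl: "extends_by r V 0 V"
  unfolding extends_by_def by (metis add_0_right sup.absorb1)

lemma extends_by_trans: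
  assumes "extends_by r V c W" "extends_by r (V \<union> W) c' W'"
  shows "extends_by r V (c + c') (W \<union> W')"
  unfolding extends_by_def
proof (intro allI impI, elim conjE)
  fix U c0 assume U: "V \<subseteq> U" "computes r c0 U"
  then have "computes r (c0 + c) (U \<union> W)" using assms(1) unfolding extends_by_def by blast
  moreover have "V \<union> W \<subseteq> U \<union> W" using U by blast
  ultimately have "computes r (c0 + c + c') (U \<union> W \<union> W')"
    using assms(2) unfolding extends_by_def by blast
  then show "computes r (c0 + (c + c')) (U \<union> (W \<union> W'))" by (simp add: ac_simps)
qed

lemma extends_by_const: "extends_by r V 0 {\<lambda>_. z}"
  unfolding extends_by_def computes_def
  by (fastforce intro: exI[of _ "Lit z"])

text \<open>The basic step: append one instruction and address its result by the next free register.\<close>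

lemma extends_by_arith:
  assumes "a \<in> V" "b \<in> V"
  shows "extends_by r V 1 {\<lambda>s. arith_value c (a s) (b s)}"
  unfolding extends_by_def
proof (intro allI impI, elim conjE)
  fix U c0 assume U: "V \<subseteq> U" "computes r c0 U"
  then obtain "is" where "is": "length is \<le> c0" "wf_code r is"
    and ex: "\<And>g. g \<in> U \<Longrightarrow> \<exists>x. wf_operand (r + length is) x \<and>
           (\<forall>s. length s = r \<longrightarrow> operand_value (exec is s) x = g s)"
    unfolding computes_def by blast
  obtain x where x: "wf_operand (r + length is) x"
      "\<And>s. length s = r \<Longrightarrow> operand_value (exec is s) x = a s"
    using ex[of a] assms U(1) by blast
  obtain y where y: "wf_operand (r + length is) y"
      "\<And>s. length s = r \<Longrightarrow> operand_value (exec is s) y = b s"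
    using ex[of b] assms U(1) by blast
  let ?js = "is @ [(c, x, y)]"
  have exec: "exec ?js s = exec is s @ [arith_value c (a s) (b s)]" if "length s = r" for s
    using x y that by (simp add: exec_append)
  show "computes r (c0 + 1) (U \<union> {\<lambda>s. arith_value c (a s) (b s)})"
    unfolding computes_def
  proof (intro exI[of _ ?js] conjI ballI)
    show "length ?js \<le> c0 + 1" using "is" by simp
    show "wf_code r ?js" using "is" x y by (simp add: wf_code_append)
    fix g assume "g \<in> U \<union> {\<lambda>s. arith_value c (a s) (b s)}"
    then consider "g \<in> U" | "g = (\<lambda>s. arith_value c (a s) (b s))" by blast
    then show "\<exists>x. wf_operand (r + length ?js) x \<and>
           (\<forall>s. length s = r \<longrightarrow> operand_value (exec ?js s) x = g s)"
    proof cases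
      case 1
      from ex[OF this] obtain z where z: "wf_operand (r + length is) z"
          "\<And>s. length s = r \<Longrightarrow> operand_value (exec is s) z = g s" by blast
      have "operand_value (exec ?js s) z = g s" if "length s = r" for s
        using z that by (simp add: exec operand_value_append length_exec)
      then show ?thesis using z(1) wf_operand_mono[of _ z] by (intro exI[of _ z]) auto
    next
      case 2
      have "operand_value (exec ?js s) (Reg (r + length is)) = g s" if "length s = r" for s
        unfolding exec[OF that] using 2 length_exec[of "is" s] that by (simp add: nth_append)
      then show ?thesis by (intro exI[of _ "Reg (r + length is)"]) auto
    qed
  qed
qed

lemma extends_by_add: "a \<in> V \<Longrightarrow> b \<in> V \<Longrightarrow> extends_by r V 1 {\<lambda>s. a s + b s}"
  using extends_by_arith[of a V b r Plus] by simp

lemma extends_by_diff: "a \<in> V \<Longrightarrow> b \<in> V \<Longrightarrow> extends_by r V 1 {\<lambda>s. a s - b s}"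
  using extends_by_arith[of a V b r Minus] by simp

lemma extends_by_mult: "a \<in> V \<Longrightarrow> b \<in> V \<Longrightarrow> extends_by r V 1 {\<lambda>s. a s * b s}"
  using extends_by_arith[of a V b r Times] by simp

lemma extends_by_UN:
  assumes "finite J" "\<And>j. j \<in> J \<Longrightarrow> extends_by r V c (W j)"
  shows "extends_by r V (card J * c) (\<Union>j\<in>J. W j)"
  using assms
proof (induction J rule: finite_induct)
  case empty
  then show ?case using extends_by_mono[OF extends_by_refl, of "{}" V 0 "{}" r] by simp
next
  case (insert x J)
  have "extends_by r V (card J * c + c) ((\<Union>j\<in>J. W j) \<union> W x)"
    by (rule extends_by_trans)
       (use insert in \<open>auto intro: extends_by_mono[where V = V]\<close>)
  then show ?case by (rule extends_by_mono) (use insert(1,2) in auto)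
qed

text \<open>Intermediate results may be dropped.\<close>

lemma extends_by_via:
  assumes "extends_by r V c W" "extends_by r (V \<union> W) c' W'"
  shows "extends_by r V (c + c') W'"
  using extends_by_trans[OF assms] by (rule extends_by_mono) auto

lemma extends_by_sum_prod:
  assumes "finite I" "\<And>i. i \<in> I \<Longrightarrow> a i \<in> V" "\<And>i. i \<in> I \<Longrightarrow> b i \<in> V"
  shows "extends_by r V (2 * card I) {\<lambda>s. \<Sum>i\<in>I. a i s * b i s}"
  using assms
proof (induction I rule: finite_induct)
  case empty
  then show ?case using extends_by_const[of r V 0] by simp
next
  case (insert x I)
  let ?g = "\<lambda>s. \<Sum>i\<in>I. a i s * b i s" and ?h = "\<lambda>s. a x s * b x s"
  have 1: "extends_by r V (2 * card I) {?g}" using insert by simp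
  have 2: "extends_by r (V \<union> {?g}) 1 {?h}"
    by (rule extends_by_mult) (use insert in auto)
  have 3: "extends_by r (V \<union> ({?g} \<union> {?h})) 1 {\<lambda>s. ?h s + ?g s}"
    by (rule extends_by_add) auto
  show ?case
    using extends_by_via[OF extends_by_trans[OF 1 2] 3] insert(1,2) by simp
qed

lemma extends_by_prod:
  assumes "finite I" "\<And>i. i \<in> I \<Longrightarrow> a i \<in> V"
  shows "extends_by r V (card I) {\<lambda>s. \<Prod>i\<in>I. a i s}"
  using assms
proof (induction I rule: finite_induct)
  case empty
  then show ?case using extends_by_const[of r V 1] by simp
next
  case (insert x I)
  let ?g = "\<lambda>s. \<Prod>i\<in>I. a i s"
  have 1: "extends_by r V (card I) {?g}" using insert by simp
  have 2: "extends_by r (V \<union> {?g}) 1 {\<lambda>s. a x s * ?g s}"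
    by (rule extends_by_mult) (use insert in auto)
  show ?case using extends_by_via[OF 1 2] insert(1,2) by simp
qed

text \<open>Horner's scheme.\<close>

lemma extends_by_poly:
  assumes "a \<in> V"
  shows "extends_by r V (2 * length (coeffs p)) {\<lambda>s. poly p (a s)}"
proof (induction p rule: pCons_induct)
  case 0
  then show ?case using extends_by_const[of r V 0] by simp
next
  case (pCons c p)
  let ?g = "\<lambda>s. poly p (a s)" and ?h = "\<lambda>s. a s * poly p (a s)"
  have 2: "extends_by r (V \<union> {?g}) 1 {?h}" by (rule extends_by_mult) (use assms in auto)
  have 3: "extends_by r (V \<union> ({?g} \<union> {?h})) 0 {\<lambda>_. c}" by (rule extends_by_const)
  have 4: "extends_by r (V \<union> ({?g} \<union> {?h} \<union> {\<lambda>_. c})) 1 {\<lambda>s. c + ?h s}"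
    by (rule extends_by_add) auto
  have "extends_by r V (2 * length (coeffs p) + 1 + 0 + 1) {\<lambda>s. c + ?h s}"
    by (rule extends_by_via[OF extends_by_trans[OF extends_by_trans[OF pCons.IH 2] 3] 4])
  moreover have "length (coeffs (pCons c p)) = Suc (length (coeffs p))"
    using pCons.hyps by (auto simp: cCons_def)
  ultimately show ?case by simp
qed

section \<open>Landweber iteration\<close>

text \<open>Gradient descent for the least squares problem \<open>A x \<approx> D\<close>, scaled by \<open>1 / m\<close> and started at zero.  The
  index \<open>k\<close> runs over the coefficients of the data with respect to the basis \<open>\<phi>\<close>, which do not interact.\<close>

primrec landweber ::
    "'i set \<Rightarrow> nat \<Rightarrow> (nat \<Rightarrow> 'i \<Rightarrow> complex) \<Rightarrow> (nat \<Rightarrow> nat \<Rightarrow> complex) \<Rightarrow> nat \<Rightarrow> 'i \<Rightarrow> nat \<Rightarrow> complex"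
where
  "landweber S m A D 0 \<nu> k = 0"
| "landweber S m A D (Suc l) \<nu> k =
     landweber S m A D l \<nu> k +
     1 / of_nat m * (\<Sum>i<m. A i \<nu> * (D i k - (\<Sum>\<mu>\<in>S. A i \<mu> * landweber S m A D l \<mu> k)))"

text \<open>One step forms \<open>m K\<close> residuals with \<open>2 |S| + 1\<close> operations each and updates \<open>|S| K\<close> unknowns with
  \<open>2 m + 2\<close> operations each.\<close>

lemma landweber_cost:
  fixes A :: "nat \<Rightarrow> 'i \<Rightarrow> complex list \<Rightarrow> complex" and D :: "nat \<Rightarrow> nat \<Rightarrow> complex list \<Rightarrow> complex"
  assumes S: "finite S" "S \<noteq> {}" and m: "m \<ge> 1"
    and A: "\<And>i \<nu>. i < m \<Longrightarrow> \<nu> \<in> S \<Longrightarrow> A i \<nu> \<in> V"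
    and D: "\<And>i k. i < m \<Longrightarrow> k < K \<Longrightarrow> D i k \<in> V"
  shows "extends_by r V (l * (7 * m * card S * K))
    (\<Union>(\<nu>, k)\<in>S \<times> {..<K}. {\<lambda>s. landweber S m (\<lambda>i \<nu>. A i \<nu> s) (\<lambda>i k. D i k s) l \<nu> k})"
proof (induction l)
  case 0
  have "extends_by r V 0 {\<lambda>_. 0}" by (rule extends_by_const)
  then show ?case by (rule extends_by_mono) auto
next
  case (Suc l)
  define x where "x l \<nu> k = (\<lambda>s. landweber S m (\<lambda>i \<nu>. A i \<nu> s) (\<lambda>i k. D i k s) l \<nu> k)" for l \<nu> k
  define X where "X l = (\<Union>(\<nu>, k)\<in>S \<times> {..<K}. {x l \<nu> k})" for l
  define res where "res = (\<lambda>(i, k) s. D i k s - (\<Sum>\<mu>\<in>S. A i \<mu> s * x l \<mu> k s))"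
  define R where "R = (\<Union>j\<in>{..<m} \<times> {..<K}. {res j})"
  let ?c1 = "card ({..<m} \<times> {..<K}) * (2 * card S + 1)"
  let ?c2 = "card (S \<times> {..<K}) * (2 * m + 2)"
  have IH: "extends_by r V (l * (7 * m * card S * K)) (X l)"
    using Suc unfolding X_def x_def by simp
  have step1: "extends_by r (V \<union> X l) ?c1 R"
    unfolding R_def
  proof (rule extends_by_UN)
    fix j assume "j \<in> {..<m} \<times> {..<K}"
    then obtain i k where j: "j = (i, k)" "i < m" "k < K" by auto
    let ?g = "\<lambda>s. \<Sum>\<mu>\<in>S. A i \<mu> s * x l \<mu> k s"
    have 1: "extends_by r (V \<union> X l) (2 * card S) {?g}"
      by (rule extends_by_sum_prod) (use S A j in \<open>auto simp: X_def\<close>)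
    have 2: "extends_by r (V \<union> X l \<union> {?g}) 1 {\<lambda>s. D i k s - ?g s}"
      by (rule extends_by_diff) (use D j in auto)
    show "extends_by r (V \<union> X l) (2 * card S + 1) {res j}"
      using extends_by_via[OF 1 2] by (simp add: res_def j)
  qed simp
  have step2: "extends_by r (V \<union> (X l \<union> R)) ?c2 (X (Suc l))"
    unfolding X_def[of "Suc l"]
  proof (rule extends_by_UN)
    fix j assume "j \<in> S \<times> {..<K}"
    then obtain \<nu> k where j: "j = (\<nu>, k)" "\<nu> \<in> S" "k < K" by auto
    let ?V = "V \<union> (X l \<union> R)"
    let ?c = "\<lambda>_::complex list. 1 / of_nat m :: complex"
    let ?g = "\<lambda>s. \<Sum>i<m. A i \<nu> s * res (i, k) s"
    have 0: "extends_by r ?V 0 {?c}" by (rule extends_by_const)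
    have 1: "extends_by r (?V \<union> {?c}) (2 * card {..<m}) {?g}"
      by (rule extends_by_sum_prod) (use A j in \<open>auto simp: R_def\<close>)
    have 2: "extends_by r (?V \<union> ({?c} \<union> {?g})) 1 {\<lambda>s. ?c s * ?g s}"
      by (rule extends_by_mult) auto
    have 3: "extends_by r (?V \<union> ({?c} \<union> {?g} \<union> {\<lambda>s. ?c s * ?g s})) 1 {\<lambda>s. x l \<nu> k s + ?c s * ?g s}"
      by (rule extends_by_add) (use j in \<open>auto simp: X_def\<close>)
    have eq: "x (Suc l) \<nu> k = (\<lambda>s. x l \<nu> k s + ?c s * ?g s)"
      by (rule ext) (simp add: x_def res_def)
    show "extends_by r ?V (2 * m + 2) (case j of (\<nu>, k) \<Rightarrow> {x (Suc l) \<nu> k})"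
      using extends_by_via[OF extends_by_trans[OF extends_by_trans[OF 0 1] 2] 3]
      by (simp add: eq j)
  qed (use S in simp)
  have "extends_by r V (l * (7 * m * card S * K) + (?c1 + ?c2)) (X (Suc l))"
    by (rule extends_by_via[OF IH]) (rule extends_by_via[OF step1 step2[unfolded Un_assoc[symmetric]]])
  moreover have "?c1 + ?c2 \<le> 7 * m * card S * K"
  proof -
    have "card S \<ge> 1" using S by (simp add: Suc_leI card_gt_0_iff)
    define P where "P = m * K * card S"
    have "m * K \<le> P" "card S * K \<le> P"
      using m \<open>card S \<ge> 1\<close> mult_le_mono2[of 1 "card S" "m * K"] mult_le_mono2[of 1 m "card S * K"]
      by (simp_all add: P_def ac_simps)
    moreover have "?c1 + ?c2 = 4 * P + m * K + 2 * (card S * K)"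
      by (simp add: P_def card_cartesian_product algebra_simps)
    moreover have "7 * m * card S * K = 7 * P" by (simp add: P_def ac_simps)
    ultimately show ?thesis by linarith
  qed
  ultimately show ?case
    by (elim extends_by_mono) (auto simp: X_def x_def)
qed

lemma length_concat_rows: "length (concat (map (\<lambda>i. map (f i) [0..<d]) [0..<m])) = m * d"
  by (induction m) auto

lemma nth_concat_rows:
  assumes "i < m" "k < d"
  shows "concat (map (\<lambda>i. map (f i) [0..<d]) [0..<m]) ! (i * d + k) = f i k"
  using assms
proof (induction m)
  case (Suc m)
  show ?case
  proof (cases "i < m")
    case True
    then have "Suc i * d \<le> m * d" by (intro mult_le_mono1) simp
    then have "i * d + k < m * d" using Suc.prems by simp
    then show ?thesis using True Suc by (simp add: nth_append length_concat_rows)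
  next
    case False
    then have "i = m" using Suc.prems by simp
    then show ?thesis using Suc.prems by (simp add: nth_append length_concat_rows)
  qed
qed simp

lemma length_encode_input: "length (encode_input d m K y D) = m * d + m * K"
  by (simp add: encode_input_def length_concat_rows)

lemma encode_input_point:
  assumes "i < m" "k < d"
  shows "encode_input d m K y D ! (i * d + k) = complex_of_real (y i k)"
proof -
  have "Suc i * d \<le> m * d" using assms by (intro mult_le_mono1) simp
  then have "i * d + k < m * d" using assms by simp
  then show ?thesis
    using assms nth_concat_rows[of i m k d "\<lambda>i k. complex_of_real (y i k)"]
    by (simp add: encode_input_def nth_append length_concat_rows)
qed

lemma encode_input_data:
  assumes "i < m" "k < K"
  shows "encode_input d m K y D ! (m * d + (i * K + k)) = D i k"
  using assms nth_concat_rows[of i m k K D]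
  by (simp add: encode_input_def nth_append length_concat_rows)

lemma row_index_less: "i < m \<Longrightarrow> k < d \<Longrightarrow> i * d + k < m * (d::nat)"
proof -
  assume "i < m" "k < d"
  then have "Suc i * d \<le> m * d" by (intro mult_le_mono1) simp
  then show ?thesis using \<open>k < d\<close> by simp
qed

lemma landweber_cong:
  assumes "\<And>i \<mu>. i < m \<Longrightarrow> \<mu> \<in> S \<Longrightarrow> A i \<mu> = A' i \<mu>" "\<And>i. i < m \<Longrightarrow> D i k = D' i k" "\<nu> \<in> S"
  shows "landweber S m A D l \<nu> k = landweber S m A' D' l \<nu> k"
  using assms(3)
proof (induction l arbitrary: \<nu>)
  case (Suc l)
  have "(\<Sum>\<mu>\<in>S. A i \<mu> * landweber S m A D l \<mu> k) = (\<Sum>\<mu>\<in>S. A' i \<mu> * landweber S m A' D' l \<mu> k)"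
    if "i < m" for i
    using Suc.IH assms(1) that by (intro sum.cong) auto
  then have "(\<Sum>i<m. A i \<nu> * (D i k - (\<Sum>\<mu>\<in>S. A i \<mu> * landweber S m A D l \<mu> k))) =
      (\<Sum>i<m. A' i \<nu> * (D' i k - (\<Sum>\<mu>\<in>S. A' i \<mu> * landweber S m A' D' l \<mu> k)))"
    using assms(1,2) Suc.prems by (intro sum.cong) auto
  then show ?case using Suc by (simp only: landweber.simps)
qed simp

lemma inputs_nonempty: "inputs d m K \<noteq> {}"
proof -
  have "encode_input d m K (\<lambda>_. \<lambda>_\<in>{..<d}. 0) (\<lambda>_ _. 0) \<in> inputs d m K"
    unfolding inputs_def cube_def
    by (intro CollectI exI[of _ "\<lambda>_. \<lambda>_\<in>{..<d}. 0"] exI[of _ "\<lambda>_ _. 0"]) auto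
  then show ?thesis by blast
qed

lemma poly_of_real_complex: "poly (map_poly complex_of_real p) (complex_of_real x) = complex_of_real (poly p x)"
  by (induction p) (auto simp: map_poly_pCons)

text \<open>The three stages are the values of the univariate polynomials at all sample coordinates (by Horner's
  scheme), their tensor products, and \<open>l\<close> Landweber steps.  Coefficients with index outside \<open>S\<close> are output
  as the literal zero.\<close>

lemma landweber_algorithm:
  fixes \<Psi> :: "nat \<Rightarrow> real poly"
  assumes m: "m \<ge> 1" and S: "finite S" "S \<noteq> {}" "S \<subseteq> {..<d} \<rightarrow>\<^sub>E {..<w}"
    and deg: "\<And>j. degree (\<Psi> j) = j"
  obtains A where "approx_algorithm d m K N A"
    "\<And>(\<phi> :: nat \<Rightarrow> 'v::complex_inner) y D j k. j < N \<Longrightarrow> k < K \<Longrightarrow>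
       algorithm_output d m K \<phi> A y D j k =
       (if \<nu> j \<in> S
        then landweber S m (\<lambda>i \<mu>. complex_of_real (tensor_poly \<Psi> d \<mu> (y i))) D l (\<nu> j) k else 0)"
    "\<And>\<phi> :: nat \<Rightarrow> 'v.
       algorithm_cost d m K \<phi> A \<le> 2 * m * d * w\<^sup>2 + m * card S * d + l * (7 * m * card S * K)"
proof -
  define r where "r = m * d + m * K"
  define V where "V = {\<lambda>s :: complex list. s ! i | i. i < r}"
  define P :: "(nat \<times> nat) \<times> nat \<Rightarrow> complex list \<Rightarrow> complex" where
    "P = (\<lambda>((i, k), j) s. poly (map_poly complex_of_real (\<Psi> j)) (s ! (i * d + k)))"
  define A where "A i \<mu> s = (\<Prod>k<d. P ((i, k), \<mu> k) s)" for i \<mu> s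
  define D where "D i k s = (s :: complex list) ! (m * d + (i * K + k))" for i k s
  let ?P = "\<Union>j\<in>({..<m} \<times> {..<d}) \<times> {..<w}. {P j}"
  let ?A = "\<Union>(i, \<mu>)\<in>{..<m} \<times> S. {A i \<mu>}"
  let ?X = "\<Union>(\<mu>, k)\<in>S \<times> {..<K}.
     {\<lambda>s. landweber S m (\<lambda>i \<nu>. A i \<nu> s) (\<lambda>i k. D i k s) l \<mu> k}"
  let ?c1 = "card (({..<m} \<times> {..<d}) \<times> {..<w}) * (2 * w)"
  let ?c2 = "card ({..<m} \<times> S) * card {..<d}"
  let ?c3 = "l * (7 * m * card S * K)"
  have 1: "extends_by r V ?c1 ?P"
  proof (rule extends_by_UN)
    fix j assume "j \<in> ({..<m} \<times> {..<d}) \<times> {..<w}"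
    then obtain i k e where j: "j = ((i, k), e)" "i < m" "k < d" "e < w" by auto
    let ?p = "map_poly complex_of_real (\<Psi> e)"
    have "i * d + k < r" using row_index_less[OF j(2,3)] by (simp add: r_def)
    then have "extends_by r V (2 * length (coeffs ?p)) {\<lambda>s. poly ?p (s ! (i * d + k))}"
      by (intro extends_by_poly) (auto simp: V_def)
    moreover have "length (coeffs ?p) \<le> w"
      using deg[of e] j(4) degree_map_poly[of complex_of_real "\<Psi> e"]
      by (cases "?p = 0") (auto simp: length_coeffs_degree)
    ultimately show "extends_by r V (2 * w) {P j}"
      by (elim extends_by_mono) (auto simp: P_def j)
  qed simp
  have 2: "extends_by r (V \<union> ?P) ?c2 ?A"
  proof (rule extends_by_UN)
    fix j assume "j \<in> {..<m} \<times> S"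
    then obtain i \<mu> where j: "j = (i, \<mu>)" "i < m" "\<mu> \<in> S" by auto
    have "extends_by r (V \<union> ?P) (card {..<d}) {\<lambda>s. \<Prod>k\<in>{..<d}. P ((i, k), \<mu> k) s}"
    proof (rule extends_by_prod)
      fix k assume k: "k \<in> {..<d}"
      then have "\<mu> k < w" using j S PiE_mem[of \<mu> "{..<d}" "\<lambda>_. {..<w}" k] by auto
      then show "P ((i, k), \<mu> k) \<in> V \<union> ?P" using j k by blast
    qed simp
    then show "extends_by r (V \<union> ?P) (card {..<d}) (case j of (i, \<mu>) \<Rightarrow> {A i \<mu>})"
      by (simp add: A_def[abs_def] j)
  qed (use S in simp)
  have 3: "extends_by r (V \<union> (?P \<union> ?A)) ?c3 ?X"
  proof (rule landweber_cost)
    fix i k assume "i < m" "k < K"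
    then have "m * d + (i * K + k) < r" using row_index_less[of i m k K] by (simp add: r_def)
    then show "D i k \<in> V \<union> (?P \<union> ?A)" by (auto simp: V_def D_def[abs_def])
  qed (use S m in auto)
  have 4: "extends_by r (V \<union> (?P \<union> ?A \<union> ?X)) 0 {\<lambda>_. 0}" by (rule extends_by_const)
  define h where "h j k = (if \<nu> j \<in> S
    then (\<lambda>s. landweber S m (\<lambda>i \<nu>. A i \<nu> s) (\<lambda>i k. D i k s) l (\<nu> j) k) else (\<lambda>_. 0))" for j k
  define gs where "gs = concat (map (\<lambda>j. map (h j) [0..<K]) [0..<N])"
  define c where "c = ?c1 + ?c2 + ?c3 + 0"
  have "computes r (0 + c) (V \<union> (?P \<union> ?A \<union> ?X \<union> {\<lambda>_. 0}))"
    using extends_by_trans[OF extends_by_trans[OF extends_by_trans[OF 1 2] 3] 4]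
      computes_inputs[of r] unfolding extends_by_def V_def c_def by blast
  moreover have "set gs \<subseteq> V \<union> (?P \<union> ?A \<union> ?X \<union> {\<lambda>_. 0})"
  proof
    fix g assume "g \<in> set gs"
    then obtain j k where jk: "j < N" "k < K" "g = h j k" unfolding gs_def by auto
    show "g \<in> V \<union> (?P \<union> ?A \<union> ?X \<union> {\<lambda>_. 0})"
    proof (cases "\<nu> j \<in> S")
      case True
      then have "g \<in> ?X" unfolding jk(3) h_def using jk(2) by (intro UN_I[of "(\<nu> j, k)"]) auto
      then show ?thesis by blast
    qed (simp add: jk(3) h_def)
  qed
  ultimately obtain B where B: "wf_algorithm K (length gs) r B"
    "\<And>T s. length s = r \<Longrightarrow> run T B s = map (\<lambda>g. g s) gs"
    "\<And>T F s. ops T F B s \<le> 0 + c"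
    by (rule computes_algorithm) blast
  have len: "length gs = N * K" unfolding gs_def by (rule length_concat_rows)
  show thesis
  proof
    show "approx_algorithm d m K N B" using B(1) by (simp add: approx_algorithm_def len r_def)
    fix \<phi> :: "nat \<Rightarrow> 'v"
    have "algorithm_cost d m K \<phi> B \<le> c"
      unfolding algorithm_cost_def using B(3)
      by (subst comp_cost_le_iff) (simp_all add: inputs_nonempty)
    then show "algorithm_cost d m K \<phi> B \<le> 2 * m * d * w\<^sup>2 + m * card S * d + l * (7 * m * card S * K)"
      by (simp add: c_def card_cartesian_product power2_eq_square algebra_simps)
    fix y D' j k assume jk: "j < N" "k < K"
    let ?s = "encode_input d m K y D'"
    have A: "A i \<mu> ?s = complex_of_real (tensor_poly \<Psi> d \<mu> (y i))" if "i < m" "\<mu> \<in> S" for i \<mu>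
      using that by (simp add: A_def P_def encode_input_point poly_of_real_complex tensor_poly_def)
    have D: "D i k ?s = D' i k" if "i < m" for i
      using that jk by (simp add: D_def encode_input_data)
    have "gs ! (j * K + k) = h j k"
      unfolding gs_def by (rule nth_concat_rows[OF jk])
    moreover have "j * K + k < length gs" using row_index_less[OF jk] len by simp
    ultimately have "algorithm_output d m K \<phi> B y D' j k = (if \<nu> j \<in> S
      then landweber S m (\<lambda>i \<nu>. A i \<nu> ?s) (\<lambda>i k. D i k ?s) l (\<nu> j) k else 0)"
      unfolding algorithm_output_def by (simp add: B(2) length_encode_input r_def h_def)
    also have "\<dots> = (if \<nu> j \<in> S
        then landweber S m (\<lambda>i \<mu>. complex_of_real (tensor_poly \<Psi> d \<mu> (y i))) D' l (\<nu> j) k else 0)"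
      using landweber_cong[of m S "\<lambda>i \<nu>. A i \<nu> ?s" "\<lambda>i \<mu>. complex_of_real (tensor_poly \<Psi> d \<mu> (y i))"
          "\<lambda>i k. D i k ?s" k D' "\<nu> j" l] A D by auto
    finally show "algorithm_output d m K \<phi> B y D' j k = (if \<nu> j \<in> S
        then landweber S m (\<lambda>i \<mu>. complex_of_real (tensor_poly \<Psi> d \<mu> (y i))) D' l (\<nu> j) k else 0)" .
  qed
qed

lemma zero_algorithm:
  obtains A where "approx_algorithm d m K N A"
    "\<And>(\<phi> :: nat \<Rightarrow> 'v::complex_inner) y D j k. j < N \<Longrightarrow> k < K \<Longrightarrow>
       algorithm_output d m K \<phi> A y D j k = 0"
    "\<And>\<phi> :: nat \<Rightarrow> 'v. algorithm_cost d m K \<phi> A = 0"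
proof
  let ?A = "Output (replicate (N * K) (Lit 0))"
  show "approx_algorithm d m K N ?A" by (simp add: approx_algorithm_def)
  show "algorithm_output d m K \<phi> ?A y D j k = 0" if "j < N" "k < K" for \<phi> :: "nat \<Rightarrow> 'v" and y D j k
    using row_index_less[OF that] by (simp add: algorithm_output_def)
  show "algorithm_cost d m K \<phi> ?A = 0" for \<phi> :: "nat \<Rightarrow> 'v"
  proof -
    have "algorithm_cost d m K \<phi> ?A \<le> 0" unfolding algorithm_cost_def
      by (subst comp_cost_le_iff) (simp_all add: inputs_nonempty)
    then show ?thesis by simp
  qed
qed

section \<open>Convergence of the Landweber iteration\<close>

lemma sum_cinner_le:
  fixes x y :: "'j \<Rightarrow> 'v::complex_inner"
  shows "(\<Sum>i\<in>I. Re (cinner (x i) (y i))) \<le> L2_set (\<lambda>i. norm (x i)) I * L2_set (\<lambda>i. norm (y i)) I"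
proof -
  have "(\<Sum>i\<in>I. Re (cinner (x i) (y i))) \<le> (\<Sum>i\<in>I. \<bar>norm (x i)\<bar> * \<bar>norm (y i)\<bar>)"
    by (intro sum_mono) (simp add: Re_cinner_le)
  from this L2_set_mult_ineq show ?thesis by (rule order_trans)
qed

lemma L2_set_square: "finite I \<Longrightarrow> (L2_set f I)\<^sup>2 = (\<Sum>i\<in>I. (f i)\<^sup>2)"
  by (simp add: L2_set_def sum_nonneg)

text \<open>The tolerance \<open>1 / (2 |S|)\<close> for the entries makes the Gram matrix differ from the identity by at most
  \<open>1 / 2\<close> in operator norm.\<close>

locale near_isometry =
  fixes S :: "'i set" and m :: nat and A :: "nat \<Rightarrow> 'i \<Rightarrow> real"
  assumes finite_S: "finite S" and m_pos: "m > 0"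
    and gram_close: "\<And>\<nu> \<mu>. \<nu> \<in> S \<Longrightarrow> \<mu> \<in> S \<Longrightarrow>
      \<bar>(\<Sum>i<m. A i \<nu> * A i \<mu>) / real m - (if \<nu> = \<mu> then 1 else 0)\<bar> \<le> 1 / (2 * real (card S))"
begin

definition apply_design :: "('i \<Rightarrow> 'v::complex_inner) \<Rightarrow> nat \<Rightarrow> 'v" where
  "apply_design e i = (\<Sum>\<mu>\<in>S. A i \<mu> *\<^sub>R e \<mu>)"

definition apply_adjoint :: "(nat \<Rightarrow> 'v::complex_inner) \<Rightarrow> 'i \<Rightarrow> 'v" where
  "apply_adjoint r \<nu> = (1 / real m) *\<^sub>R (\<Sum>i<m. A i \<nu> *\<^sub>R r i)"

abbreviation nrm :: "('i \<Rightarrow> 'v::real_normed_vector) \<Rightarrow> real" where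
  "nrm e \<equiv> L2_set (\<lambda>\<nu>. norm (e \<nu>)) S"

lemma nrm_add: "nrm (\<lambda>\<nu>. e \<nu> + e' \<nu>) \<le> nrm e + nrm e'"
  by (rule order_trans[OF L2_set_mono L2_set_triangle_ineq]) (auto intro: norm_triangle_ineq)

text \<open>By Cauchy--Schwarz in every row, a matrix with \<open>|S|\<close> rows and entries of size at most \<open>1 / (2 |S|)\<close> has
  norm at most \<open>1 / 2\<close>, on vectors with entries in an inner product space just as on scalar ones.\<close>

lemma contraction:
  fixes e :: "'i \<Rightarrow> 'v::complex_inner"
  shows "nrm (\<lambda>\<nu>. e \<nu> - apply_adjoint (apply_design e) \<nu>) \<le> nrm e / 2"
proof (cases "S = {}")
  case False
  define h where "h \<nu> \<mu> = (if \<nu> = \<mu> then 1 else 0) - (\<Sum>i<m. A i \<nu> * A i \<mu>) / real m" for \<nu> \<mu>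
  have h: "\<bar>h \<nu> \<mu>\<bar> \<le> 1 / (2 * real (card S))" if "\<nu> \<in> S" "\<mu> \<in> S" for \<nu> \<mu>
    using gram_close[OF that] by (simp add: h_def abs_minus_commute)
  have card: "real (card S) > 0" using False finite_S by (simp add: card_gt_0_iff)
  have eq: "e \<nu> - apply_adjoint (apply_design e) \<nu> = (\<Sum>\<mu>\<in>S. h \<nu> \<mu> *\<^sub>R e \<mu>)" if "\<nu> \<in> S" for \<nu>
  proof -
    have "apply_adjoint (apply_design e) \<nu> = (1 / real m) *\<^sub>R (\<Sum>\<mu>\<in>S. \<Sum>i<m. (A i \<nu> * A i \<mu>) *\<^sub>R e \<mu>)"
      unfolding apply_adjoint_def apply_design_def by (simp add: scaleR_sum_right sum.swap[of _ "{..<m}"])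
    also have "\<dots> = (\<Sum>\<mu>\<in>S. ((\<Sum>i<m. A i \<nu> * A i \<mu>) / real m) *\<^sub>R e \<mu>)"
      by (simp add: scaleR_sum_right scaleR_sum_left[symmetric])
    finally have "apply_adjoint (apply_design e) \<nu> = (\<Sum>\<mu>\<in>S. ((\<Sum>i<m. A i \<nu> * A i \<mu>) / real m) *\<^sub>R e \<mu>)" .
    moreover have "e \<nu> = (\<Sum>\<mu>\<in>S. (if \<nu> = \<mu> then 1 else 0) *\<^sub>R e \<mu>)"
      using that finite_S by (simp add: if_distrib[of "\<lambda>c. c *\<^sub>R _"] sum.delta cong: if_cong)
    ultimately show ?thesis unfolding h_def by (simp add: scaleR_left_diff_distrib sum_subtractf)
  qed
  have pt: "norm (e \<nu> - apply_adjoint (apply_design e) \<nu>) \<le> nrm e / (2 * sqrt (real (card S)))" if "\<nu> \<in> S" for \<nu>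
  proof -
    have "norm (e \<nu> - apply_adjoint (apply_design e) \<nu>) \<le> (\<Sum>\<mu>\<in>S. 1 / (2 * real (card S)) * norm (e \<mu>))"
      unfolding eq[OF that]
    proof (intro sum_norm_le)
      show "norm (h \<nu> \<mu> *\<^sub>R e \<mu>) \<le> 1 / (2 * real (card S)) * norm (e \<mu>)" if "\<mu> \<in> S" for \<mu>
        unfolding norm_scaleR by (intro mult_right_mono h \<open>\<nu> \<in> S\<close> that norm_ge_zero)
    qed
    also have "\<dots> \<le> L2_set (\<lambda>_. 1 / (2 * real (card S))) S * nrm e"
      by (rule order_trans[OF _ L2_set_mult_ineq]) auto
    also have "L2_set (\<lambda>_. 1 / (2 * real (card S))) S = 1 / (2 * sqrt (real (card S)))"
      using card by (simp add: L2_set_constant real_div_sqrt field_simps)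
    finally show ?thesis by simp
  qed
  have "nrm (\<lambda>\<nu>. e \<nu> - apply_adjoint (apply_design e) \<nu>) \<le> L2_set (\<lambda>_. nrm e / (2 * sqrt (real (card S)))) S"
    by (rule L2_set_mono) (auto intro: pt)
  also have "\<dots> = sqrt (real (card S)) * (nrm e / (2 * sqrt (real (card S))))"
    by (simp add: L2_set_constant)
  also have "\<dots> = nrm e / 2" using card by simp
  finally show ?thesis .
qed simp

lemma adjoint_identity:
  fixes z :: "'i \<Rightarrow> 'v::complex_inner"
  shows "(\<Sum>\<nu>\<in>S. Re (cinner (z \<nu>) (apply_adjoint r \<nu>))) = (\<Sum>i<m. Re (cinner (apply_design z i) (r i))) / real m"
proof -
  have L: "Re (cinner (z \<nu>) (apply_adjoint r \<nu>)) = (\<Sum>i<m. A i \<nu> * Re (cinner (z \<nu>) (r i))) / real m" for \<nu>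
    by (simp add: apply_adjoint_def cinner_scaleR_right cinner_sum_right)
  have R: "Re (cinner (apply_design z i) (r i)) = (\<Sum>\<nu>\<in>S. A i \<nu> * Re (cinner (z \<nu>) (r i)))" for i
    by (simp add: apply_design_def cinner_scaleR_left cinner_sum_left)
  show ?thesis unfolding L R sum_divide_distrib[symmetric] by (subst sum.swap) (rule refl)
qed

text \<open>The Gram matrix has norm at most \<open>1 + 1 / 2\<close>.\<close>

lemma design_bound:
  fixes z :: "'i \<Rightarrow> 'v::complex_inner"
  shows "(L2_set (\<lambda>i. norm (apply_design z i)) {..<m})\<^sup>2 / real m \<le> 3 / 2 * (nrm z)\<^sup>2"
proof -
  let ?d = "\<lambda>\<nu>. z \<nu> - apply_adjoint (apply_design z) \<nu>"
  have "(L2_set (\<lambda>i. norm (apply_design z i)) {..<m})\<^sup>2 / real m =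
      (\<Sum>\<nu>\<in>S. Re (cinner (z \<nu>) (apply_adjoint (apply_design z) \<nu>)))"
    unfolding adjoint_identity by (simp add: L2_set_square norm_square_cinner)
  also have "\<dots> = (\<Sum>\<nu>\<in>S. Re (cinner (z \<nu>) (z \<nu>))) + (\<Sum>\<nu>\<in>S. Re (cinner (- z \<nu>) (?d \<nu>)))"
    by (simp add: cinner_diff_right cinner_minus_left flip: sum.distrib)
  also have "\<dots> \<le> (nrm z)\<^sup>2 + nrm (\<lambda>\<nu>. - z \<nu>) * nrm ?d"
    by (intro add_mono sum_cinner_le) (simp add: L2_set_square finite_S norm_square_cinner)
  also have "\<dots> \<le> (nrm z)\<^sup>2 + nrm z * (nrm z / 2)"
    using contraction by (intro add_left_mono mult_mono) auto
  finally show ?thesis by (simp add: power2_eq_square)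
qed

text \<open>By duality from \<open>design_bound\<close>; the factor \<open>5 / 4\<close> is a rational upper bound for \<open>sqrt (3 / 2)\<close>.\<close>

lemma adjoint_bound:
  fixes r :: "nat \<Rightarrow> 'v::complex_inner"
  shows "nrm (apply_adjoint r) \<le> 5 / 4 * (L2_set (\<lambda>i. norm (r i)) {..<m} / sqrt (real m))"
proof -
  let ?z = "apply_adjoint r" and ?R = "L2_set (\<lambda>i. norm (r i)) {..<m} / sqrt (real m)"
  let ?D = "L2_set (\<lambda>i. norm (apply_design ?z i)) {..<m} / sqrt (real m)"
  have "?D\<^sup>2 \<le> (5 / 4 * nrm ?z)\<^sup>2"
  proof -
    have "?D\<^sup>2 \<le> 3 / 2 * (nrm ?z)\<^sup>2" using design_bound[of ?z] by (simp add: power_divide)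
    also have "\<dots> \<le> 25 / 16 * (nrm ?z)\<^sup>2" by (intro mult_right_mono) auto
    finally show ?thesis by (simp add: power_mult_distrib power_divide)
  qed
  then have D: "?D \<le> 5 / 4 * nrm ?z" by (rule power2_le_imp_le) simp
  have "(nrm ?z)\<^sup>2 = (\<Sum>\<nu>\<in>S. Re (cinner (?z \<nu>) (apply_adjoint r \<nu>)))"
    by (simp add: L2_set_square finite_S norm_square_cinner)
  also have "\<dots> \<le> L2_set (\<lambda>i. norm (apply_design ?z i)) {..<m} * L2_set (\<lambda>i. norm (r i)) {..<m} / real m"
    unfolding adjoint_identity by (intro divide_right_mono sum_cinner_le) simp
  also have "\<dots> = ?D * ?R" using m_pos real_sqrt_mult_self[of "real m"] by (simp add: field_simps)
  also have "\<dots> \<le> (5 / 4 * nrm ?z) * ?R" using D by (intro mult_right_mono) auto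
  finally have "nrm ?z * nrm ?z \<le> nrm ?z * (5 / 4 * ?R)" by (simp add: power2_eq_square mult_ac)
  moreover have "0 \<le> 5 / 4 * ?R" by simp
  ultimately show ?thesis
    using mult_left_le_imp_le[of "nrm ?z"] by (metis L2_set_nonneg order_less_le)
qed

text \<open>The errors \<open>e\<^sub>l\<close> relative to any reference \<open>q\<close> satisfy \<open>e\<^sub>l\<^sub>+\<^sub>1 = (I - G) e\<^sub>l + A\<^sup>* r / m\<close>, where \<open>G\<close> is the Gram
  matrix and \<open>r\<close> the residual of \<open>q\<close>.  The first term is halved in each step and the second one is at most
  \<open>5 / 4\<close> of the residual, so that the geometric series contributes twice this amount.\<close>

lemma landweber_error:
  fixes K :: nat and \<phi> :: "nat \<Rightarrow> 'v::complex_inner" and q :: "'i \<Rightarrow> 'v" and D :: "nat \<Rightarrow> nat \<Rightarrow> complex"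
  defines "u \<equiv> \<lambda>l \<nu>. \<Sum>k<K. landweber S m (\<lambda>i \<mu>. complex_of_real (A i \<mu>)) D l \<nu> k *\<^sub>C \<phi> k"
  shows "nrm (\<lambda>\<nu>. u l \<nu> - q \<nu>) \<le> nrm q / 2 ^ l +
    5 / 2 * (L2_set (\<lambda>i. norm ((\<Sum>k<K. D i k *\<^sub>C \<phi> k) - apply_design q i)) {..<m} / sqrt (real m))"
proof -
  define r where "r i = (\<Sum>k<K. D i k *\<^sub>C \<phi> k) - apply_design q i" for i
  define R where "R = L2_set (\<lambda>i. norm (r i)) {..<m} / sqrt (real m)"
  have R0: "R \<ge> 0" by (simp add: R_def)
  have u0: "u 0 \<nu> = 0" for \<nu> by (simp add: u_def)
  have rec: "u (Suc l) \<nu> = u l \<nu> + apply_adjoint (\<lambda>i. (\<Sum>k<K. D i k *\<^sub>C \<phi> k) - apply_design (u l) i) \<nu>" for l \<nu>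
  proof -
    let ?x = "landweber S m (\<lambda>i \<mu>. complex_of_real (A i \<mu>)) D l"
    have des: "apply_design (u l) i = (\<Sum>k<K. (\<Sum>\<mu>\<in>S. complex_of_real (A i \<mu>) * ?x \<mu> k) *\<^sub>C \<phi> k)" for i
      unfolding apply_design_def u_def
      by (simp add: scaleC_of_real[symmetric] scaleC_sum_right scaleC_sum_left scaleC_scaleC sum.swap[of _ S])
    have "(\<Sum>k<K. D i k *\<^sub>C \<phi> k) - apply_design (u l) i =
        (\<Sum>k<K. (D i k - (\<Sum>\<mu>\<in>S. complex_of_real (A i \<mu>) * ?x \<mu> k)) *\<^sub>C \<phi> k)" for i
      unfolding des by (simp add: scaleC_diff_left sum_subtractf)
    then have "apply_adjoint (\<lambda>i. (\<Sum>k<K. D i k *\<^sub>C \<phi> k) - apply_design (u l) i) \<nu> =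
        (\<Sum>k<K. (1 / of_nat m * (\<Sum>i<m. complex_of_real (A i \<nu>) * (D i k - (\<Sum>\<mu>\<in>S. complex_of_real (A i \<mu>) * ?x \<mu> k)))) *\<^sub>C \<phi> k)"
      unfolding apply_adjoint_def
      by (simp add: scaleC_of_real[symmetric] scaleC_sum_right scaleC_sum_left scaleC_scaleC sum_distrib_left
          sum.swap[of _ "{..<m}"])
    then show ?thesis by (simp add: u_def scaleC_add_left sum.distrib)
  qed
  have adj_diff: "apply_adjoint (\<lambda>i. a i - b i) \<nu> = apply_adjoint a \<nu> - apply_adjoint b \<nu>" for a b :: "nat \<Rightarrow> 'v" and \<nu>
    by (simp add: apply_adjoint_def scaleR_right_diff_distrib sum_subtractf)
  have des_diff: "apply_design (\<lambda>\<nu>. a \<nu> - b \<nu>) i = apply_design a i - apply_design b i" for a b :: "'i \<Rightarrow> 'v" and i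
    by (simp add: apply_design_def scaleR_right_diff_distrib sum_subtractf)
  have "nrm (\<lambda>\<nu>. u l \<nu> - q \<nu>) \<le> nrm q / 2 ^ l + 5 / 2 * R"
  proof (induction l)
    case (Suc l)
    let ?e = "\<lambda>\<nu>. u l \<nu> - q \<nu>"
    have "(\<lambda>i. (\<Sum>k<K. D i k *\<^sub>C \<phi> k) - apply_design (u l) i) = (\<lambda>i. r i - apply_design ?e i)"
      by (simp add: fun_eq_iff r_def des_diff)
    then have step: "u (Suc l) \<nu> - q \<nu> = (?e \<nu> - apply_adjoint (apply_design ?e) \<nu>) + apply_adjoint r \<nu>" for \<nu>
      by (simp add: rec adj_diff)
    have "nrm (\<lambda>\<nu>. u (Suc l) \<nu> - q \<nu>) \<le>
        nrm (\<lambda>\<nu>. ?e \<nu> - apply_adjoint (apply_design ?e) \<nu>) + nrm (apply_adjoint r)"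
      unfolding step by (rule nrm_add)
    also have "\<dots> \<le> nrm ?e / 2 + 5 / 4 * R"
      unfolding R_def by (intro add_mono contraction adjoint_bound)
    also have "\<dots> \<le> (nrm q / 2 ^ l + 5 / 2 * R) / 2 + 5 / 4 * R" using Suc by simp
    also have "\<dots> = nrm q / 2 ^ Suc l + 5 / 2 * R" by (simp add: field_simps)
    finally show ?case .
  qed (simp add: u0 R0)
  then show ?thesis by (simp add: R_def r_def)
qed

end

section \<open>Polynomial approximation on Bernstein ellipses\<close>

text \<open>The Chebyshev polynomials, characterized by \<open>poly_cheb\<close> through the Joukowski map
  \<open>z \<mapsto> (z + 1 / z) / 2\<close>, which sends the unit circle to \<open>[-1, 1]\<close> and annuli to Bernstein ellipses.\<close>

fun cheb :: "nat \<Rightarrow> complex poly" where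
  "cheb 0 = 1"
| "cheb (Suc 0) = [:0, 1:]"
| "cheb (Suc (Suc n)) = [:0, 2:] * cheb (Suc n) - cheb n"

lemma degree_cheb: "degree (cheb n) \<le> n"
proof (induction n rule: cheb.induct)
  case (3 n)
  have "degree ([:0, 2:] * cheb (Suc n)) \<le> 1 + Suc n"
    by (rule order_trans[OF degree_mult_le]) (use 3 in \<open>simp add: add_mono\<close>)
  then show ?case using 3 by (simp add: degree_diff_le)
qed simp_all

lemma poly_cheb:
  assumes "z \<noteq> 0"
  shows "poly (cheb n) ((z + inverse z) / 2) = (z ^ n + inverse z ^ n) / 2"
proof (induction n rule: cheb.induct)
  case (3 n)
  have inv: "z * inverse z = 1" using assms by simp
  have "(z + inverse z) * (z ^ Suc n + inverse z ^ Suc n) =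
      z ^ Suc (Suc n) + inverse z ^ Suc (Suc n) + (z * inverse z) * (z ^ n + inverse z ^ n)"
    by (simp add: algebra_simps)
  then show ?case using 3 unfolding inv by (simp add: field_simps)
qed (use assms in simp_all)

abbreviation circle_integral :: "real \<Rightarrow> (complex \<Rightarrow> complex) \<Rightarrow> complex" where
  "circle_integral e \<equiv> contour_integral (circlepath 0 e)"

text \<open>The difference quotient \<open>F w = (h w - h z) / (w - z)\<close> is holomorphic on the whole annulus, so its
  integrals over the two homotopic circles agree.  The remaining kernel \<open>1 / (w - z)\<close> integrates to
  \<open>2 \<pi> \<i>\<close> over the outer circle and to \<open>0\<close> over the inner one.\<close>

lemma annulus_Cauchy_formula:
  fixes h :: "complex \<Rightarrow> complex"
  assumes "1 < r" "r < R" "h holomorphic_on {w. 1 / R < cmod w \<and> cmod w < R}" "cmod z = 1"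
  shows "2 * of_real pi * \<i> * h z =
    circle_integral r (\<lambda>w. h w / (w - z)) -
    circle_integral (1 / r) (\<lambda>w. h w / (w - z))"
proof -
  define A where "A = {w. 1 / R < cmod w \<and> cmod w < R}"
  have openA: "open A" unfolding A_def by (intro open_Collect_conj open_Collect_less continuous_intros)
  have zA: "z \<in> A" using assms by (simp add: A_def)
  have inA: "w \<in> A" if "cmod w = r \<or> cmod w = 1 / r" for w
  proof -
    have "1 / R < 1 / r" "1 / r < 1" using assms by (auto intro: divide_strict_left_mono)
    then show ?thesis using that assms(1,2) unfolding A_def mem_Collect_eq by linarith
  qed
  define F where "F w = (if w = z then deriv h z else (h w - h z) / (w - z))" for w
  have F: "F holomorphic_on A"
    unfolding F_def using pole_lemma_open[OF assms(3)[folded A_def] openA, of z] .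
  have r: "r > 0" "1 / r < r" "1 / r < 1" using assms by (auto simp: field_simps intro: less_trans mult_strict_mono)
  have hom: "homotopic_loops A (circlepath 0 r) (circlepath 0 (1 / r))"
  proof (rule homotopic_loops_linear)
    fix t :: real assume "t \<in> {0..1}"
    show "closed_segment (circlepath 0 r t) (circlepath 0 (1 / r) t) \<subseteq> A"
    proof
      fix w assume "w \<in> closed_segment (circlepath 0 r t) (circlepath 0 (1 / r) t)"
      then obtain u where u: "0 \<le> u" "u \<le> 1"
        "w = (1 - u) *\<^sub>R circlepath 0 r t + u *\<^sub>R circlepath 0 (1 / r) t"
        by (auto simp: in_segment)
      have w: "w = of_real ((1 - u) * r + u * (1 / r)) * exp (2 * of_real pi * \<i> * of_real t)"
        unfolding u(3) by (simp add: circlepath scaleR_conv_of_real algebra_simps)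
      have pos: "(1 - u) * r + u * (1 / r) \<ge> 0" using u r by simp
      have "cmod (exp (2 * of_real pi * \<i> * of_real t)) = 1" by simp
      then have "cmod w = (1 - u) * r + u * (1 / r)"
        unfolding w norm_mult norm_of_real using pos by simp
      moreover have "(1 - u) * r + u * (1 / r) \<le> (1 - u) * r + u * r"
        using u r by (intro add_left_mono mult_left_mono) auto
      moreover have "(1 - u) * (1 / r) + u * (1 / r) \<le> (1 - u) * r + u * (1 / r)"
        using u r by (intro add_right_mono mult_left_mono) auto
      moreover have "1 / R < 1 / r" using assms by (intro divide_strict_left_mono) auto
      moreover have "(1 - u) * r + u * r = r" "(1 - u) * (1 / r) + u * (1 / r) = 1 / r"
        by (simp_all add: algebra_simps flip: add_divide_distrib)
      ultimately show "w \<in> A" using assms(2) unfolding A_def mem_Collect_eq by linarith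
    qed
  qed auto
  have eqF: "circle_integral r F = circle_integral (1 / r) F"
    by (rule Cauchy_theorem_homotopic_loops[OF hom openA F]) auto
  have split: "circle_integral e F =
      circle_integral e (\<lambda>w. h w / (w - z)) - h z * circle_integral e (\<lambda>w. 1 / (w - z))"
    "(\<lambda>w. h w / (w - z)) contour_integrable_on circlepath 0 e" if e: "e = r \<or> e = 1 / r" for e
  proof -
    have e0: "e > 0" "e \<noteq> 1" using e assms r by auto
    have sub: "path_image (circlepath 0 e) \<subseteq> A - {z}"
      using e0 e assms(4) inA by (auto simp: path_image_circlepath)
    have op: "open (A - {z})" using openA by (rule open_Diff) simp
    have i1: "(\<lambda>w. h w / (w - z)) contour_integrable_on circlepath 0 e"
      by (rule contour_integrable_holomorphic_simple[OF _ op _ sub])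
        (use assms(3)[folded A_def] in \<open>auto intro!: holomorphic_intros intro: holomorphic_on_subset\<close>)
    have i2: "(\<lambda>w. 1 / (w - z)) contour_integrable_on circlepath 0 e"
      by (rule contour_integrable_holomorphic_simple[OF _ op _ sub]) (auto intro!: holomorphic_intros)
    have "circle_integral e F =
        circle_integral e (\<lambda>w. h w / (w - z) - h z * (1 / (w - z)))"
      by (rule contour_integral_cong) (use sub in \<open>auto simp: F_def diff_divide_distrib\<close>)
    also have "\<dots> = circle_integral e (\<lambda>w. h w / (w - z)) -
        circle_integral e (\<lambda>w. h z * (1 / (w - z)))"
      by (rule contour_integral_diff[OF i1 contour_integrable_lmul[OF i2]])
    also have "circle_integral e (\<lambda>w. h z * (1 / (w - z))) =
        h z * circle_integral e (\<lambda>w. 1 / (w - z))"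
      by (rule contour_integral_lmul[OF i2])
    finally show "circle_integral e F =
      circle_integral e (\<lambda>w. h w / (w - z)) - h z * circle_integral e (\<lambda>w. 1 / (w - z))" .
    show "(\<lambda>w. h w / (w - z)) contour_integrable_on circlepath 0 e" by (rule i1)
  qed
  have "((\<lambda>w. 1 / (w - z)) has_contour_integral 2 * of_real pi * \<i> * 1) (circlepath 0 r)"
    by (rule Cauchy_integral_circlepath_simple) (use assms in auto)
  then have out: "circle_integral r (\<lambda>w. 1 / (w - z)) = 2 * of_real pi * \<i>"
    by (simp add: contour_integral_unique)
  have "((\<lambda>w. 1 / (w - z)) has_contour_integral 0) (circlepath 0 (1 / r))"
    by (rule Cauchy_theorem_disc_simple[where a = 0 and e = 1])
      (use r assms(4) in \<open>auto intro!: holomorphic_intros simp: path_image_circlepath\<close>)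
  then have inn: "circle_integral (1 / r) (\<lambda>w. 1 / (w - z)) = 0"
    by (rule contour_integral_unique)
  show ?thesis
    using eqF split(1)[of r] split(1)[of "1 / r"] split(2) unfolding out inn by (auto simp: algebra_simps)
qed

lemma geometric_kernel_split:
  fixes w z :: complex
  assumes "w \<noteq> 0" "w \<noteq> z"
  shows "1 / (w - z) = (\<Sum>j<s. z ^ j / w ^ Suc j) + z ^ s / (w ^ s * (w - z))"
proof (induction s)
  case (Suc s)
  have "z ^ s / (w ^ s * (w - z)) = z ^ s / w ^ Suc s + z ^ Suc s / (w ^ Suc s * (w - z))"
    using assms by (simp add: field_simps)
  then show ?case using Suc by simp
qed simp

text \<open>Truncation of a Laurent series: if the kernel \<open>k\<close> is a finite sum of products plus a remainder of
  size \<open>D\<close>, then so is the integral against \<open>k\<close>.\<close>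

lemma circle_integral_expansion:
  fixes h :: "complex \<Rightarrow> complex" and K :: "nat \<Rightarrow> complex \<Rightarrow> complex" and Q :: "nat \<Rightarrow> complex"
  assumes e: "e > 0" and h: "continuous_on (sphere 0 e) h" "\<And>w. cmod w = e \<Longrightarrow> cmod (h w) \<le> B"
    and K: "\<And>j. continuous_on (sphere 0 e) (K j)"
    and split: "\<And>w. cmod w = e \<Longrightarrow> k w = (\<Sum>j<s. Q j * K j w) + rest w"
    and rest: "\<And>w. cmod w = e \<Longrightarrow> cmod (rest w) \<le> D" "continuous_on (sphere 0 e) rest" "D \<ge> 0"
  shows "cmod (circle_integral e (\<lambda>w. h w * k w) -
     (\<Sum>j<s. Q j * circle_integral e (\<lambda>w. h w * K j w))) \<le> 2 * pi * e * (B * D)"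
proof -
  have int: "f contour_integrable_on circlepath 0 e" if "continuous_on (sphere 0 e) f" for f
    by (rule contour_integrable_continuous_circlepath) (use that e in simp)
  have iK: "(\<lambda>w. h w * K j w) contour_integrable_on circlepath 0 e" for j
    by (intro int continuous_intros h K)
  have ir: "(\<lambda>w. h w * rest w) contour_integrable_on circlepath 0 e"
    by (intro int continuous_intros h rest)
  have term_int: "(\<lambda>w. Q j * (h w * K j w)) contour_integrable_on circlepath 0 e" for j
    using contour_integrable_lmul[OF iK[of j], of "Q j"] .
  have sum_int: "(\<lambda>w. \<Sum>j<s. Q j * (h w * K j w)) contour_integrable_on circlepath 0 e"
    by (rule contour_integrable_sum) (simp_all add: term_int)
  have "circle_integral e (\<lambda>w. h w * k w) =
      circle_integral e (\<lambda>w. (\<Sum>j<s. Q j * (h w * K j w)) + h w * rest w)"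
    by (rule contour_integral_cong)
      (use e in \<open>auto simp: path_image_circlepath split distrib_left sum_distrib_left mult_ac\<close>)
  also have "\<dots> = circle_integral e (\<lambda>w. \<Sum>j<s. Q j * (h w * K j w)) +
      circle_integral e (\<lambda>w. h w * rest w)"
    by (rule contour_integral_add[OF sum_int ir])
  also have "circle_integral e (\<lambda>w. \<Sum>j<s. Q j * (h w * K j w)) =
      (\<Sum>j<s. circle_integral e (\<lambda>w. Q j * (h w * K j w)))"
    by (rule contour_integral_sum) (simp_all add: term_int)
  also have "\<dots> = (\<Sum>j<s. Q j * circle_integral e (\<lambda>w. h w * K j w))"
    by (intro sum.cong refl contour_integral_lmul iK)
  finally have "circle_integral e (\<lambda>w. h w * k w) -
     (\<Sum>j<s. Q j * circle_integral e (\<lambda>w. h w * K j w)) =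
     circle_integral e (\<lambda>w. h w * rest w)" by simp
  moreover have "cmod (circle_integral e (\<lambda>w. h w * rest w)) \<le> (B * D) * (2 * pi * e)"
  proof (rule has_contour_integral_bound_circlepath[OF has_contour_integral_integral[OF ir]])
    have "cmod (of_real e) = e" using e by simp
    from h(2)[OF this] have "0 \<le> B" using norm_ge_zero order_trans by blast
    then show "0 \<le> B * D" using rest(3) by simp
    show "cmod (h w * rest w) \<le> B * D" if "cmod (w - 0) = e" for w
      unfolding norm_mult using that h(2) rest(1) \<open>0 \<le> B\<close> by (intro mult_mono) auto
  qed (use e in simp)
  ultimately show ?thesis by (simp add: mult.commute)
qed

lemma joukowski_unit:
  assumes "x \<in> {-1..1}"
  obtains z where "cmod z = 1" "(z + inverse z) / 2 = complex_of_real x"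
proof
  let ?z = "cis (arccos x)"
  have "?z + inverse ?z = of_real (2 * cos (arccos x))"
    by (simp add: complex_eq_iff)
  then show "(?z + inverse ?z) / 2 = complex_of_real x" using assms by simp
qed simp

lemma joukowski_mem_ellipse:
  assumes "1 / \<rho> < cmod w" "cmod w < \<rho>" "\<rho> > 1"
  shows "(w + inverse w) / 2 \<in> bernstein_ellipse \<rho>"
proof (cases "cmod w \<ge> 1")
  case True
  then show ?thesis using assms unfolding bernstein_ellipse_def by (intro CollectI exI[of _ w]) auto
next
  case False
  have pos: "cmod w > 0" using assms by (auto intro: less_trans[of 0 "1 / \<rho>"])
  then have "1 \<le> 1 / cmod w" "1 / cmod w \<le> \<rho>" using False assms by (simp_all add: field_simps)
  then have "1 \<le> cmod (inverse w)" "cmod (inverse w) \<le> \<rho>"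
    by (simp_all add: norm_divide inverse_eq_divide)
  then show ?thesis unfolding bernstein_ellipse_def
    by (intro CollectI exI[of _ "inverse w"]) (auto simp: add.commute)
qed

text \<open>Pull \<open>g\<close> back to \<open>h w = g ((w + 1 / w) / 2)\<close> on the annulus and expand the Cauchy kernels on both
  circles into finite geometric sums with remainders of order \<open>r ^ (-s)\<close>.  Since \<open>h z = h (1 / z)\<close>, averaging
  the expansions at \<open>z\<close> and \<open>1 / z\<close> replaces every power \<open>z ^ j\<close> by \<open>(z ^ j + z ^ (-j)) / 2\<close>, which is the
  \<open>j\<close>-th Chebyshev polynomial at \<open>(z + 1 / z) / 2\<close>.\<close>

lemma ellipse_polynomial_approximation:
  fixes g :: "complex \<Rightarrow> complex"
  assumes r: "1 < r" "r < \<rho>" and W: "open W" "bernstein_ellipse \<rho> \<subseteq> W" "g holomorphic_on W"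
    and B: "\<And>z. z \<in> bernstein_ellipse \<rho> \<Longrightarrow> cmod (g z) \<le> B"
  obtains q where "degree q \<le> s"
    "\<And>x. x \<in> {-1..1} \<Longrightarrow> cmod (g (of_real x) - poly q (of_real x)) \<le> (r + 1) / (r - 1) * B / r ^ s"
proof -
  define h where "h w = g ((w + inverse w) / 2)" for w
  define A where "A = {w. 1 / \<rho> < cmod w \<and> cmod w < \<rho>}"
  have J: "(w + inverse w) / 2 \<in> bernstein_ellipse \<rho>" if "w \<in> A" for w
    using that joukowski_mem_ellipse r by (auto simp: A_def)
  have \<rho>: "1 / \<rho> < 1 / r" "1 / r < 1" "1 / \<rho> < 1" using r by (auto intro: divide_strict_left_mono)
  have A0: "w \<noteq> 0" if "w \<in> A" for w using that r by (auto simp: A_def)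
  have hol: "h holomorphic_on A"
  proof -
    have "(\<lambda>w. (w + inverse w) / 2) holomorphic_on A" using A0 by (intro holomorphic_intros) auto
    moreover have "(\<lambda>w. (w + inverse w) / 2) ` A \<subseteq> W" using J W(2) by auto
    ultimately have "(g \<circ> (\<lambda>w. (w + inverse w) / 2)) holomorphic_on A"
      using W(3) holomorphic_on_compose_gen by blast
    then show ?thesis unfolding h_def comp_def .
  qed
  have sph: "sphere 0 r \<subseteq> A" "sphere 0 (1 / r) \<subseteq> A"
    using r(1,2) \<rho> unfolding A_def by (intro subsetI; simp only: mem_sphere_0 mem_Collect_eq; linarith)+
  have hB: "cmod (h w) \<le> B" if "w \<in> A" for w using B J that by (simp add: h_def)
  define a where "a j = circle_integral r (\<lambda>w. h w * (1 / w ^ Suc j)) / (2 * of_real pi * \<i>)" for j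
  define b where "b j = circle_integral (1 / r) (\<lambda>w. h w * w ^ j) / (2 * of_real pi * \<i>)" for j
  define C where "C = (r + 1) / (r - 1) * B / r ^ s"
  have "1 \<in> A" using r \<rho> by (simp add: A_def)
  from hB[OF this] have B0: "B \<ge> 0" using norm_ge_zero order_trans by blast
  have main: "cmod (h z - ((\<Sum>j<s. a j * z ^ j) + (\<Sum>j<s. b j * inverse z ^ Suc j))) \<le> C" if z: "cmod z = 1" for z
  proof -
    let ?I1 = "circle_integral r (\<lambda>w. h w / (w - z))"
    let ?I2 = "circle_integral (1 / r) (\<lambda>w. h w / (w - z))"
    have Cf: "2 * of_real pi * \<i> * h z = ?I1 - ?I2"
      by (rule annulus_Cauchy_formula[OF r hol[unfolded A_def] z])
    have z0: "z \<noteq> 0" using z by auto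
    have wz1: "w \<noteq> 0 \<and> w \<noteq> z \<and> r - 1 \<le> cmod (w - z)" if "cmod w = r" for w
      using that z r norm_triangle_ineq2[of w z] by auto
    have wz2: "w \<noteq> 0 \<and> w \<noteq> z \<and> 1 - 1 / r \<le> cmod (w - z)" if "cmod w = 1 / r" for w
      using that z r \<rho> norm_triangle_ineq3[of w z] by (auto simp: abs_if split: if_splits)
    have "cmod (circle_integral r (\<lambda>w. h w * (1 / (w - z))) -
        (\<Sum>j<s. z ^ j * circle_integral r (\<lambda>w. h w * (1 / w ^ Suc j))))
        \<le> 2 * pi * r * (B * (1 / (r ^ s * (r - 1))))"
    proof (rule circle_integral_expansion[where rest = "\<lambda>w. z ^ s / (w ^ s * (w - z))"])
      show "continuous_on (sphere (0::complex) r) h" using hol sph holomorphic_on_imp_continuous_on holomorphic_on_subset by blast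
      show "cmod (h w) \<le> B" if "cmod w = r" for w using hB sph(1) that by auto
      show "continuous_on (sphere (0::complex) r) (\<lambda>w. 1 / w ^ Suc j)" for j
        by (intro continuous_on_divide continuous_on_const continuous_on_power continuous_on_id) (use r in auto)
      show "1 / (w - z) = (\<Sum>j<s. z ^ j * (1 / w ^ Suc j)) + z ^ s / (w ^ s * (w - z))" if "cmod w = r" for w
        using geometric_kernel_split[of w z s] wz1[OF that] by simp
      show "cmod (z ^ s / (w ^ s * (w - z))) \<le> 1 / (r ^ s * (r - 1))" if "cmod w = r" for w
        unfolding norm_divide norm_mult norm_power that z power_one using wz1[OF that] r
        by (intro divide_left_mono mult_left_mono mult_pos_pos) auto
      show "continuous_on (sphere (0::complex) r) (\<lambda>w. z ^ s / (w ^ s * (w - z)))"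
        by (intro continuous_on_divide continuous_on_const continuous_on_power continuous_on_id
            continuous_on_mult continuous_on_diff) (use wz1 in auto)
    qed (use r in auto)
    also have "(\<lambda>w. h w * (1 / (w - z))) = (\<lambda>w. h w / (w - z))" by auto
    also have "(\<Sum>j<s. z ^ j * circle_integral r (\<lambda>w. h w * (1 / w ^ Suc j))) =
        2 * of_real pi * \<i> * (\<Sum>j<s. a j * z ^ j)"
      by (simp add: a_def sum_distrib_left mult.commute)
    finally have 1: "cmod (?I1 - 2 * of_real pi * \<i> * (\<Sum>j<s. a j * z ^ j)) \<le> 2 * pi * r * (B * (1 / (r ^ s * (r - 1))))" .
    have "cmod (circle_integral (1 / r) (\<lambda>w. h w * (1 / (w - z))) -
        (\<Sum>j<s. (- (inverse z ^ Suc j)) * circle_integral (1 / r) (\<lambda>w. h w * w ^ j)))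
        \<le> 2 * pi * (1 / r) * (B * ((1 / r) ^ s / (1 - 1 / r)))"
    proof (rule circle_integral_expansion[where rest = "\<lambda>w. - (w ^ s / (z ^ s * (z - w)))"])
      show "continuous_on (sphere (0::complex) (1 / r)) h" using hol sph holomorphic_on_imp_continuous_on holomorphic_on_subset by blast
      show "cmod (h w) \<le> B" if "cmod w = 1 / r" for w using hB sph(2) that by auto
      show "continuous_on (sphere (0::complex) (1 / r)) (\<lambda>w. w ^ j)" for j
        by (intro continuous_intros)
      show "1 / (w - z) = (\<Sum>j<s. - (inverse z ^ Suc j) * w ^ j) + - (w ^ s / (z ^ s * (z - w)))" if "cmod w = 1 / r" for w
      proof -
        have "1 / (w - z) = - (1 / (z - w))" using minus_divide_right[of 1 "z - w"] by simp
        also have "1 / (z - w) = (\<Sum>j<s. w ^ j / z ^ Suc j) + w ^ s / (z ^ s * (z - w))"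
          using geometric_kernel_split[of z w s] wz2[OF that] z0 by auto
        finally show ?thesis
          by (simp add: sum_negf[symmetric] divide_inverse power_inverse mult.commute)
      qed
      show "cmod (- (w ^ s / (z ^ s * (z - w)))) \<le> (1 / r) ^ s / (1 - 1 / r)" if "cmod w = 1 / r" for w
        unfolding norm_minus_cancel norm_divide norm_mult norm_power that z power_one mult_1_left
        using wz2[OF that] r \<rho> by (intro divide_left_mono mult_pos_pos) (auto simp: norm_minus_commute)
      show "continuous_on (sphere (0::complex) (1 / r)) (\<lambda>w. - (w ^ s / (z ^ s * (z - w))))"
        by (intro continuous_on_divide continuous_on_const continuous_on_power continuous_on_id
            continuous_on_mult continuous_on_diff continuous_on_minus) (use z0 z r in auto)
    qed (use r \<rho> in auto)
    also have "(\<lambda>w. h w * (1 / (w - z))) = (\<lambda>w. h w / (w - z))" by auto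
    also have "(\<Sum>j<s. (- (inverse z ^ Suc j)) * circle_integral (1 / r) (\<lambda>w. h w * w ^ j)) =
        - 2 * of_real pi * \<i> * (\<Sum>j<s. b j * inverse z ^ Suc j)"
      by (simp add: b_def sum_distrib_left mult_ac sum_negf)
    finally have 2: "cmod (?I2 - - 2 * of_real pi * \<i> * (\<Sum>j<s. b j * inverse z ^ Suc j)) \<le>
        2 * pi * (1 / r) * (B * ((1 / r) ^ s / (1 - 1 / r)))" .
    have "2 * of_real pi * \<i> * (h z - ((\<Sum>j<s. a j * z ^ j) + (\<Sum>j<s. b j * inverse z ^ Suc j))) =
      (?I1 - 2 * of_real pi * \<i> * (\<Sum>j<s. a j * z ^ j)) - (?I2 - - 2 * of_real pi * \<i> * (\<Sum>j<s. b j * inverse z ^ Suc j))"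
      using Cf by (simp add: algebra_simps)
    then have "cmod (2 * of_real pi * \<i> * (h z - ((\<Sum>j<s. a j * z ^ j) + (\<Sum>j<s. b j * inverse z ^ Suc j)))) \<le>
      2 * pi * r * (B * (1 / (r ^ s * (r - 1)))) + 2 * pi * (1 / r) * (B * ((1 / r) ^ s / (1 - 1 / r)))"
      by (simp only:) (rule order_trans[OF norm_triangle_ineq4 add_mono[OF 1 2]])
    then have "2 * pi * cmod (h z - ((\<Sum>j<s. a j * z ^ j) + (\<Sum>j<s. b j * inverse z ^ Suc j))) \<le>
      2 * pi * r * (B * (1 / (r ^ s * (r - 1)))) + 2 * pi * (1 / r) * (B * ((1 / r) ^ s / (1 - 1 / r)))"
      by (simp only: norm_mult norm_of_real norm_ii norm_numeral) simp
    also have "\<dots> = 2 * pi * C"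
    proof -
      define D where "D = 1 / (r ^ s * (r - 1))"
      have "1 - 1 / r = (r - 1) / r" using r by (simp add: field_simps)
      then have D1: "(1 / r) ^ s / (1 - 1 / r) = r * D"
        by (simp add: D_def power_one_over)
      have D2: "C = (r + 1) * B * D" by (simp add: C_def D_def)
      have "2 * pi * (1 / r) * (B * (r * D)) = 2 * pi * (B * D)" using r by simp
      then show ?thesis unfolding D1 D2 D_def[symmetric] by (simp add: algebra_simps)
    qed
    finally show ?thesis by simp
  qed
  define q where "q = (\<Sum>j<s. smult (a j) (cheb j)) + (\<Sum>j<s. smult (b j) (cheb (Suc j)))"
  show thesis
  proof
    have "degree (cheb j) \<le> s" "degree (cheb (Suc j)) \<le> s" if "j < s" for j
      using degree_cheb[of j] degree_cheb[of "Suc j"] that by auto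
    then show "degree q \<le> s" unfolding q_def
      by (intro degree_add_le degree_sum_le) (auto intro: order_trans[OF degree_smult_le])
    fix x :: real assume "x \<in> {-1..1}"
    then obtain z where z: "cmod z = 1" "(z + inverse z) / 2 = complex_of_real x" by (rule joukowski_unit)
    have z0: "z \<noteq> 0" using z by auto
    let ?S = "\<lambda>z. (\<Sum>j<s. a j * z ^ j) + (\<Sum>j<s. b j * inverse z ^ Suc j)"
    have hz: "h z = g (of_real x)" "h (inverse z) = g (of_real x)"
      using z by (auto simp: h_def add.commute)
    have "poly q (of_real x) = (\<Sum>j<s. a j * ((z ^ j + inverse z ^ j) / 2)) +
        (\<Sum>j<s. b j * ((z ^ Suc j + inverse z ^ Suc j) / 2))"
      unfolding z(2)[symmetric] q_def by (simp add: poly_sum poly_cheb[OF z0] del: cheb.simps power_Suc)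
    also have "\<dots> = (?S z + ?S (inverse z)) / 2"
      by (simp add: distrib_left sum.distrib add_divide_distrib sum_divide_distrib del: power_Suc)
    finally have poly_q: "poly q (of_real x) = (?S z + ?S (inverse z)) / 2" .
    have average: "u - (v + w) / 2 = ((u - v) + (u - w)) / 2" for u v w :: complex
      by (simp add: field_simps)
    have "g (of_real x) - poly q (of_real x) = ((h z - ?S z) + (h (inverse z) - ?S (inverse z))) / 2"
      unfolding poly_q hz by (rule average)
    moreover have "cmod (((h z - ?S z) + (h (inverse z) - ?S (inverse z))) / 2) \<le> (C + C) / 2"
      unfolding norm_divide using main[OF z(1)] main[of "inverse z"] z(1)
      by (intro divide_mono order_trans[OF norm_triangle_ineq] add_mono) (auto simp: norm_inverse)
    ultimately have "cmod (g (of_real x) - poly q (of_real x)) \<le> (C + C) / 2" by (simp only:)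
    then show "cmod (g (of_real x) - poly q (of_real x)) \<le> (r + 1) / (r - 1) * B / r ^ s"
      by (simp add: C_def mult.commute)
  qed
qed

section \<open>Fekete points\<close>

definition lagrange_basis :: "nat \<Rightarrow> (nat \<Rightarrow> real) \<Rightarrow> nat \<Rightarrow> real poly" where
  "lagrange_basis s x i = smult (1 / (\<Prod>j\<in>{..<s} - {i}. x i - x j)) (\<Prod>j\<in>{..<s} - {i}. [:- x j, 1:])"

lemma poly_lagrange_basis:
  "poly (lagrange_basis s x i) u = (\<Prod>j\<in>{..<s} - {i}. u - x j) / (\<Prod>j\<in>{..<s} - {i}. x i - x j)"
  by (simp add: lagrange_basis_def poly_prod algebra_simps)

lemma poly_lagrange_basis_node:
  assumes "inj_on x {..<s}" "i < s" "k < s"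
  shows "poly (lagrange_basis s x i) (x k) = (if k = i then 1 else 0)"
proof (cases "k = i")
  case True
  have "(\<Prod>j\<in>{..<s} - {i}. x i - x j) \<noteq> 0"
    using assms by (auto simp: inj_on_def)
  then show ?thesis using True by (simp add: poly_lagrange_basis)
next
  case False
  then have "(\<Prod>j\<in>{..<s} - {i}. x k - x j) = 0" using assms by (intro prod_zero) auto
  then show ?thesis using False by (simp add: poly_lagrange_basis)
qed

lemma degree_lagrange_basis:
  assumes "i < s"
  shows "degree (lagrange_basis s x i) < s"
proof -
  have "degree (\<Prod>j\<in>{..<s} - {i}. [:- x j, 1:]) \<le> (\<Sum>j\<in>{..<s} - {i}. degree [:- x j, 1:])"
    using degree_prod_sum_le[of "{..<s} - {i}" "\<lambda>j. [:- x j, 1:]"] by (simp add: comp_def)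
  also have "\<dots> = s - 1" using assms by simp
  finally have "degree (lagrange_basis s x i) \<le> s - 1"
    unfolding lagrange_basis_def using degree_smult_le order_trans by blast
  then show ?thesis using assms by simp
qed

lemma lagrange_interpolation:
  fixes q :: "complex poly"
  assumes "inj_on x {..<s}" "degree q < s"
  shows "poly q (of_real u) = (\<Sum>i<s. of_real (poly (lagrange_basis s x i) u) * poly q (of_real (x i)))"
proof -
  define L where "L = (\<Sum>i<s. smult (poly q (of_real (x i))) (map_poly of_real (lagrange_basis s x i)))"
  have L: "poly L (of_real v) = (\<Sum>i<s. of_real (poly (lagrange_basis s x i) v) * poly q (of_real (x i)))" for v
    by (simp add: L_def poly_sum poly_of_real_complex mult.commute)
  have "degree (smult (poly q (of_real (x i))) (map_poly complex_of_real (lagrange_basis s x i))) \<le> s - 1" if "i < s" for i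
    using degree_lagrange_basis[OF that, of x] degree_smult_le[of "poly q (of_real (x i))" "map_poly complex_of_real (lagrange_basis s x i)"]
    by (simp add: degree_map_poly)
  then have "degree L \<le> s - 1" unfolding L_def by (intro degree_sum_le) auto
  then have deg: "degree L < s" using assms(2) by simp
  have "L = q"
  proof (rule poly_eqI_degree)
    show "poly L z = poly q z" if z: "z \<in> complex_of_real ` x ` {..<s}" for z
    proof -
      obtain k where k: "z = of_real (x k)" "k < s" using z by auto
      have "poly L z = (\<Sum>i<s. if i = k then poly q (of_real (x i)) else 0)"
        unfolding k(1) L using assms(1) k(2) by (intro sum.cong) (auto simp: poly_lagrange_basis_node)
      then show ?thesis using k by simp
    qed
    have "card (complex_of_real ` x ` {..<s}) = s"
      using assms(1) by (simp add: card_image inj_on_def)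
    then show "degree L < card (complex_of_real ` x ` {..<s})" "degree q < card (complex_of_real ` x ` {..<s})"
      using deg assms(2) by simp_all
  qed
  then show ?thesis using L[of u] by simp
qed

text \<open>Nodes that maximize the product \<open>V\<close> of all distances.  Moving the \<open>i\<close>-th node to \<open>u\<close> multiplies \<open>V\<close> by
  the square of the \<open>i\<close>-th Lagrange basis polynomial at \<open>u\<close> (each distance occurs twice in \<open>V\<close>), which is
  therefore at most \<open>1\<close>.\<close>

lemma Fekete_points:
  obtains x :: "nat \<Rightarrow> real" where "\<And>i. i < s \<Longrightarrow> x i \<in> {-1..1}" "inj_on x {..<s}"
    "\<And>i u. i < s \<Longrightarrow> u \<in> {-1..1} \<Longrightarrow> \<bar>poly (lagrange_basis s x i) u\<bar> \<le> 1"
proof -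
  define V :: "(nat \<Rightarrow> real) \<Rightarrow> real" where "V y = (\<Prod>i<s. \<Prod>j\<in>{..<s} - {i}. \<bar>y i - y j\<bar>)" for y
  define S where "S = (\<Pi>\<^sub>E i\<in>UNIV. if i < s then {-1..1::real} else {0})"
  have "compactin (product_topology (\<lambda>_. euclidean) UNIV) S"
    unfolding S_def compactin_PiE by auto
  then have comp: "compact S" by (simp add: euclidean_product_topology)
  have "continuous_on S V" unfolding V_def
    by (intro continuous_intros continuous_on_subset[OF continuous_on_product_coordinates]) auto
  \<comment> \<open>Equispaced nodes show that the maximum is positive.\<close>
  moreover define y0 where "y0 i = (if i < s then real i / real s else 0)" for i
  moreover have "- 1 \<le> real i / real s" for i by (rule order_trans[of _ 0]) simp_all
  then have y0: "y0 \<in> S" by (auto simp: S_def y0_def)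
  ultimately obtain x where x: "x \<in> S" "\<And>y. y \<in> S \<Longrightarrow> V y \<le> V x"
    using continuous_attains_sup[OF comp, of V] by blast
  have "V y0 > 0"
    unfolding V_def by (intro prod_pos ballI) (auto simp: y0_def)
  then have Vx: "V x > 0" using x(2)[OF y0] by simp
  have xS: "x i \<in> (if i < s then {-1..1} else {0})" for i
    using x(1) unfolding S_def by (rule PiE_mem) simp
  have mem: "x i \<in> {-1..1}" if "i < s" for i using xS[of i] that by simp
  have split: "V y = (\<Prod>j\<in>J. \<bar>y i - y j\<bar>)\<^sup>2 * (\<Prod>k\<in>J. \<Prod>j\<in>J - {k}. \<bar>y k - y j\<bar>)"
    if i: "i < s" and J: "J = {..<s} - {i}" for y i J
  proof -
    have "(\<Prod>j\<in>{..<s} - {k}. \<bar>y k - y j\<bar>) = \<bar>y i - y k\<bar> * (\<Prod>j\<in>J - {k}. \<bar>y k - y j\<bar>)"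
      if k: "k \<in> J" for k
    proof -
      have "{..<s} - {k} = insert i (J - {k})" using i k by (auto simp: J)
      then show ?thesis by (simp add: J abs_minus_commute)
    qed
    then have "V y = (\<Prod>j\<in>J. \<bar>y i - y j\<bar>) *
        (\<Prod>k\<in>J. \<bar>y i - y k\<bar> * (\<Prod>j\<in>J - {k}. \<bar>y k - y j\<bar>))"
      unfolding V_def using i by (subst prod.remove[of _ i]) (auto simp: J)
    then show ?thesis by (simp add: prod.distrib power2_eq_square)
  qed
  show thesis
  proof
    show "x i \<in> {-1..1}" if "i < s" for i by (rule mem[OF that])
    show "inj_on x {..<s}"
    proof (rule inj_onI, rule ccontr)
      fix i j assume ij: "i \<in> {..<s}" "j \<in> {..<s}" "x i = x j" "i \<noteq> j"
      then have "(\<Prod>j\<in>{..<s} - {i}. \<bar>x i - x j\<bar>) = 0" by (intro prod_zero) auto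
      then have "V x = 0" unfolding V_def using ij by (intro prod_zero) auto
      then show False using Vx by simp
    qed
    fix i u assume i: "i < s" and u: "u \<in> {-1..1::real}"
    define J where "J = {..<s} - {i}"
    define R where "R = (\<Prod>k\<in>J. \<Prod>j\<in>J - {k}. \<bar>x k - x j\<bar>)"
    let ?y = "x(i := u)"
    have "?y \<in> S" unfolding S_def
    proof (rule PiE_I)
      show "?y j \<in> (if j < s then {-1..1} else {0})" for j using xS[of j] i u by (cases "j = i") auto
    qed simp
    then have "V ?y \<le> V x" by (rule x(2))
    moreover have "V ?y = (\<Prod>j\<in>J. \<bar>u - x j\<bar>)\<^sup>2 * R"
      unfolding split[OF i J_def] R_def
      by (intro arg_cong2[of _ _ _ _ "(*)"] arg_cong[of _ _ "\<lambda>z. z\<^sup>2"] prod.cong) (auto simp: J_def)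
    moreover have Vx_eq: "V x = (\<Prod>j\<in>J. \<bar>x i - x j\<bar>)\<^sup>2 * R"
      unfolding split[OF i J_def] R_def ..
    moreover have "R \<ge> 0" unfolding R_def by (intro prod_nonneg ballI) auto
    then have "R > 0" using Vx Vx_eq by (cases "R = 0") auto
    ultimately have "(\<Prod>j\<in>J. \<bar>u - x j\<bar>)\<^sup>2 \<le> (\<Prod>j\<in>J. \<bar>x i - x j\<bar>)\<^sup>2" by simp
    then have "(\<Prod>j\<in>J. \<bar>u - x j\<bar>) \<le> (\<Prod>j\<in>J. \<bar>x i - x j\<bar>)"
      by (rule power2_le_imp_le) (simp add: prod_nonneg)
    moreover have "(\<Prod>j\<in>J. \<bar>x i - x j\<bar>) \<noteq> 0" using Vx Vx_eq by auto
    moreover have "(\<Prod>j\<in>J. \<bar>x i - x j\<bar>) \<ge> 0" by (simp add: prod_nonneg)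
    ultimately show "\<bar>poly (lagrange_basis s x i) u\<bar> \<le> 1"
      unfolding poly_lagrange_basis J_def[symmetric] by (simp add: abs_prod divide_le_eq_1)
  qed
qed

section \<open>Interpolation of vector-valued holomorphic functions\<close>

lemma bounded_linear_cinner: "bounded_linear (cinner (d :: 'v::complex_inner))"
  by (rule bounded_linear_intro[where K = "norm d"])
    (simp_all add: cinner_add_right cinner_scaleR_right scaleR_conv_of_real cmod_cinner_le
      mult.commute[of "norm _" "norm d"])

text \<open>The error vector \<open>d\<close> is tested against itself: \<open>g = \<langle>d, G\<rangle>\<close> is a scalar holomorphic function bounded by
  the norm of \<open>d\<close>, and interpolation commutes with the inner product.  Thus contour integrals are needed for scalar
  functions only.  The factor \<open>1 + s\<close> comes from the Lebesgue constant \<open>s\<close> of Fekete points.\<close>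

lemma interpolation_error:
  fixes G :: "complex \<Rightarrow> 'v::complex_inner"
  assumes r: "1 < r" "r < \<rho>" and W: "open W" "bernstein_ellipse \<rho> \<subseteq> W"
    and der: "\<And>z. z \<in> W \<Longrightarrow> \<exists>D. (G has_derivative (\<lambda>h. h *\<^sub>C D)) (at z)"
    and bound: "\<And>z. z \<in> bernstein_ellipse \<rho> \<Longrightarrow> norm (G z) \<le> 1"
    and x: "\<And>i. i < s \<Longrightarrow> x i \<in> {-1..1}" "inj_on x {..<s}"
      "\<And>i u. i < s \<Longrightarrow> u \<in> {-1..1} \<Longrightarrow> \<bar>poly (lagrange_basis s x i) u\<bar> \<le> 1"
    and s: "s > 0" and u: "u \<in> {-1..1}"
  shows "norm (G (of_real u) - (\<Sum>i<s. poly (lagrange_basis s x i) u *\<^sub>R G (of_real (x i))))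
    \<le> (1 + real s) * ((r + 1) / (r - 1) / r ^ (s - 1))"
proof -
  define d where "d = G (of_real u) - (\<Sum>i<s. poly (lagrange_basis s x i) u *\<^sub>R G (of_real (x i)))"
  define g where "g z = cinner d (G z)" for z
  define \<delta> where "\<delta> = (r + 1) / (r - 1) * norm d / r ^ (s - 1)"
  have "g holomorphic_on W" unfolding holomorphic_on_def
  proof
    fix z assume "z \<in> W"
    then obtain D where "(G has_derivative (\<lambda>h. h *\<^sub>C D)) (at z)" using der by blast
    from bounded_linear.has_derivative[OF bounded_linear_cinner this]
    have "(g has_derivative (\<lambda>h. cinner d D * h)) (at z)"
      unfolding g_def by (simp add: cinner_scaleC_right mult.commute)
    then have "(g has_field_derivative cinner d D) (at z)" by (simp add: has_field_derivative_def)
    then show "g field_differentiable at z within W"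
      using field_differentiable_at_within field_differentiable_def by blast
  qed
  moreover have "cmod (g z) \<le> norm d" if "z \<in> bernstein_ellipse \<rho>" for z
  proof -
    have "cmod (g z) \<le> norm d * norm (G z)" unfolding g_def by (rule cmod_cinner_le)
    also have "\<dots> \<le> norm d * 1" using bound[OF that] by (rule mult_left_mono) simp
    finally show ?thesis by simp
  qed
  ultimately obtain q where q: "degree q \<le> s - 1"
    "\<And>v. v \<in> {-1..1} \<Longrightarrow> cmod (g (of_real v) - poly q (of_real v)) \<le> \<delta>"
    using ellipse_polynomial_approximation[OF r W, of g "norm d" "s - 1"] unfolding \<delta>_def by blast
  have "cinner d d = g (of_real u) - (\<Sum>i<s. of_real (poly (lagrange_basis s x i) u) * g (of_real (x i)))"
    by (subst (2) d_def) (simp add: g_def cinner_diff_right cinner_sum_right cinner_scaleR_right)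
  also have "\<dots> = (g (of_real u) - poly q (of_real u)) -
      (\<Sum>i<s. of_real (poly (lagrange_basis s x i) u) * (g (of_real (x i)) - poly q (of_real (x i))))"
    using lagrange_interpolation[OF x(2), of q u] q(1) s
    by (simp add: right_diff_distrib sum_subtractf)
  finally have "cmod (cinner d d) \<le> cmod (g (of_real u) - poly q (of_real u)) +
      cmod (\<Sum>i<s. of_real (poly (lagrange_basis s x i) u) * (g (of_real (x i)) - poly q (of_real (x i))))"
    by (simp only: norm_triangle_ineq4)
  also have "\<dots> \<le> \<delta> + (\<Sum>i<s. 1 * \<delta>)"
  proof (intro add_mono q(2) u order_trans[OF norm_sum] sum_mono)
    fix i assume "i \<in> {..<s}"
    then show "cmod (of_real (poly (lagrange_basis s x i) u) * (g (of_real (x i)) - poly q (of_real (x i)))) \<le> 1 * \<delta>"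
      unfolding norm_mult norm_of_real using x(1,3) u q(2) by (intro mult_mono) auto
  qed
  also have "\<dots> = norm d * ((1 + real s) * ((r + 1) / (r - 1) / r ^ (s - 1)))"
  proof -
    have "\<delta> + (\<Sum>i<s. 1 * \<delta>) = (1 + real s) * \<delta>" by (simp add: distrib_right)
    then show ?thesis by (simp add: \<delta>_def)
  qed
  finally have "norm d * norm d \<le> norm d * ((1 + real s) * ((r + 1) / (r - 1) / r ^ (s - 1)))"
    by (simp add: cinner_self norm_mult power2_eq_square)
  moreover have "0 \<le> (1 + real s) * ((r + 1) / (r - 1) / r ^ (s - 1))" using r by simp
  ultimately have "norm d \<le> (1 + real s) * ((r + 1) / (r - 1) / r ^ (s - 1))"
    using mult_left_le_imp_le[of "norm d"] by (metis norm_ge_zero order_less_le)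
  then show ?thesis by (simp add: d_def)
qed

section \<open>Tensor product interpolation\<close>

abbreviation index_box :: "nat \<Rightarrow> nat \<Rightarrow> (nat \<Rightarrow> nat) set" where
  "index_box d s \<equiv> {..<d} \<rightarrow>\<^sub>E {..<s}"

abbreviation tensor_sum where
  "tensor_sum \<Psi> d S q y \<equiv> \<Sum>\<mu>\<in>S. tensor_poly \<Psi> d \<mu> y *\<^sub>R q \<mu>"

lemma sum_PiE_insert:
  fixes h :: "('a \<Rightarrow> 'b) \<Rightarrow> 'c::comm_monoid_add"
  assumes "k \<notin> I"
  shows "(\<Sum>\<nu>\<in>PiE (insert k I) B. h \<nu>) = (\<Sum>i\<in>B k. \<Sum>\<nu>\<in>PiE I B. h (\<nu>(k := i)))"
proof -
  have "(\<Sum>\<nu>\<in>PiE (insert k I) B. h \<nu>) = (\<Sum>(i, \<nu>)\<in>B k \<times> PiE I B. h (\<nu>(k := i)))"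
    unfolding PiE_insert_eq by (subst sum.reindex[OF inj_combinator[OF assms]]) (simp add: case_prod_unfold)
  then show ?thesis by (simp add: sum.cartesian_product)
qed

lemma real_mem_bernstein_ellipse:
  assumes "v \<in> {-1..1}" "\<rho> \<ge> 1"
  shows "complex_of_real v \<in> bernstein_ellipse \<rho>"
proof -
  obtain z where "cmod z = 1" "(z + inverse z) / 2 = complex_of_real v" using assms(1) by (rule joukowski_unit)
  then show ?thesis using assms(2) unfolding bernstein_ellipse_def by (intro CollectI exI[of _ z]) auto
qed

lemma cube_mem: "y \<in> cube d \<Longrightarrow> k < d \<Longrightarrow> y k \<in> {-1..1}"
  using PiE_mem[of y "{..<d}" "\<lambda>_. {-1..1}" k] by (simp add: cube_def)

lemma cube_update:
  assumes "y \<in> cube d" "k < d" "v \<in> {-1..1}"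
  shows "y(k := v) \<in> cube d"
  unfolding cube_def
proof (rule PiE_I)
  show "(y(k := v)) j \<in> {-1..1}" if "j \<in> {..<d}" for j
    using cube_mem[OF assms(1), of j] assms(3) that by simp
  show "(y(k := v)) j = undefined" if "j \<notin> {..<d}" for j
    using PiE_arb[OF assms(1)[unfolded cube_def] that] assms(2) that by auto
qed

text \<open>Only the \<open>k\<close>-th coordinate leaves the real cube, so the function of it is holomorphic near an ellipse.\<close>

lemma coordinate_interpolation_error:
  fixes f :: "(nat \<Rightarrow> real) \<Rightarrow> 'v::complex_inner"
  assumes f: "f \<in> holomorphic_ball d \<rho>" and \<rho>: "\<And>k. k < d \<Longrightarrow> r < \<rho> k" and r: "1 < r"
    and x: "\<And>i. i < s \<Longrightarrow> x i \<in> {-1..1}" "inj_on x {..<s}"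
      "\<And>i u. i < s \<Longrightarrow> u \<in> {-1..1} \<Longrightarrow> \<bar>poly (lagrange_basis s x i) u\<bar> \<le> 1"
    and s: "s > 0" and y: "y \<in> cube d" and k: "k < d"
  shows "norm (f y - (\<Sum>i<s. poly (lagrange_basis s x i) (y k) *\<^sub>R f (y(k := x i))))
    \<le> (1 + real s) * ((r + 1) / (r - 1) / r ^ (s - 1))"
proof -
  obtain W g where W: "openin (product_topology (\<lambda>_. euclidean) {..<d}) W" "polyellipse d \<rho> \<subseteq> W"
    and hol: "separately_holomorphic_on d g W"
    and gf: "\<And>y. y \<in> cube d \<Longrightarrow> g (\<lambda>k\<in>{..<d}. complex_of_real (y k)) = f y"
    and bd: "(SUP z\<in>polyellipse d \<rho>. ereal (norm (g z))) \<le> 1"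
    using f unfolding holomorphic_ball_def by blast
  define Y where "Y = (\<lambda>k\<in>{..<d}. complex_of_real (y k))"
  have yk: "y j \<in> {-1..1}" if "j < d" for j by (rule cube_mem[OF y that])
  define W' where "W' = {w. Y(k := w) \<in> W}"
  have "continuous_map euclidean (product_topology (\<lambda>_. euclidean) {..<d}) (\<lambda>w::complex. Y(k := w))"
    unfolding continuous_map_componentwise
  proof (intro conjI ballI)
    show "(\<lambda>w. Y(k := w)) ` topspace euclidean \<subseteq> extensional {..<d}"
      using k by (auto simp: Y_def extensional_def)
    show "continuous_map euclidean euclidean (\<lambda>w. (Y(k := w)) j)" for j
      by (cases "j = k") auto
  qed
  from openin_continuous_map_preimage[OF this W(1)]
  have openW: "open W'" by (simp add: W'_def)
  have mem: "Y(k := w) \<in> polyellipse d \<rho>" if "w \<in> bernstein_ellipse (\<rho> k)" for w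
    unfolding polyellipse_def
  proof (rule PiE_I)
    fix j assume "j \<in> {..<d}"
    then have j: "j < d" by simp
    have "complex_of_real (y j) \<in> bernstein_ellipse (\<rho> j)"
      using \<rho>[OF j] r by (intro real_mem_bernstein_ellipse yk[OF j]) simp
    then show "(Y(k := w)) j \<in> bernstein_ellipse (\<rho> j)" using that j by (simp add: Y_def)
  next
    fix j assume "j \<notin> {..<d}"
    then show "(Y(k := w)) j = undefined" using k by (auto simp: Y_def)
  qed
  have real: "g (Y(k := complex_of_real v)) = f (y(k := v))" if "v \<in> {-1..1}" for v
  proof -
    have "Y(k := complex_of_real v) = (\<lambda>j\<in>{..<d}. complex_of_real ((y(k := v)) j))"
      using k by (auto simp: Y_def fun_eq_iff)
    then show ?thesis using gf[OF cube_update[OF y k that]] by simp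
  qed
  have "norm (g (Y(k := complex_of_real (y k))) -
      (\<Sum>i<s. poly (lagrange_basis s x i) (y k) *\<^sub>R g (Y(k := complex_of_real (x i)))))
    \<le> (1 + real s) * ((r + 1) / (r - 1) / r ^ (s - 1))"
  proof (rule interpolation_error[of r "\<rho> k" W' "\<lambda>w. g (Y(k := w))"])
    show "bernstein_ellipse (\<rho> k) \<subseteq> W'" using mem W(2) by (auto simp: W'_def)
    fix z
    {
      assume "z \<in> W'"
      then have "Y(k := z) \<in> W" by (simp add: W'_def)
      then obtain D where "((\<lambda>w. g ((Y(k := z))(k := w))) has_derivative (\<lambda>h. h *\<^sub>C D)) (at ((Y(k := z)) k))"
        using hol k unfolding separately_holomorphic_on_def by blast
      then show "\<exists>D. ((\<lambda>w. g (Y(k := w))) has_derivative (\<lambda>h. h *\<^sub>C D)) (at z)" by auto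
    }
    assume "z \<in> bernstein_ellipse (\<rho> k)"
    then have "ereal (norm (g (Y(k := z)))) \<le> 1"
      by (intro order_trans[OF SUP_upper bd] mem)
    then show "norm (g (Y(k := z))) \<le> 1" by simp
  qed (use \<rho>[OF k] r openW x s yk[OF k] in auto)
  moreover have "(\<Sum>i<s. poly (lagrange_basis s x i) (y k) *\<^sub>R g (Y(k := complex_of_real (x i)))) =
      (\<Sum>i<s. poly (lagrange_basis s x i) (y k) *\<^sub>R f (y(k := x i)))"
    by (intro sum.cong refl) (simp only: real x(1) lessThan_iff)
  moreover have "g (Y(k := complex_of_real (y k))) = f y"
    using real[OF yk[OF k]] by (simp only: fun_upd_triv)
  ultimately show ?thesis by (simp only:)
qed

lemma poly_in_span_of_degrees:
  fixes \<Psi> :: "nat \<Rightarrow> real poly"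
  assumes "\<And>j. degree (\<Psi> j) = j" "\<And>j. \<Psi> j \<noteq> 0" "\<And>i. i \<ge> s \<Longrightarrow> coeff p i = 0"
  shows "\<exists>\<beta>. p = (\<Sum>j<s. smult (\<beta> j) (\<Psi> j))"
  using assms(3)
proof (induction s arbitrary: p)
  case 0
  then have "p = 0" by (auto intro: poly_eqI)
  then show ?case by simp
next
  case (Suc s)
  define b where "b = coeff p s / coeff (\<Psi> s) s"
  have lead: "coeff (\<Psi> s) s \<noteq> 0" using assms(1)[of s] assms(2)[of s] by (metis leading_coeff_0_iff)
  have "coeff (p - smult b (\<Psi> s)) i = 0" if "i \<ge> s" for i
  proof (cases "i = s")
    case False
    then show ?thesis using that Suc.prems[of i] assms(1)[of s] by (simp add: coeff_eq_0)
  qed (use lead in \<open>simp add: b_def\<close>)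
  from Suc.IH[OF this] obtain \<beta> where \<beta>: "p - smult b (\<Psi> s) = (\<Sum>j<s. smult (\<beta> j) (\<Psi> j))" by blast
  have "p = (p - smult b (\<Psi> s)) + smult b (\<Psi> s)" by simp
  also have "\<dots> = (\<Sum>j<s. smult ((\<beta>(s := b)) j) (\<Psi> j)) + smult b (\<Psi> s)"
    unfolding \<beta> by simp
  finally have "p = (\<Sum>j<Suc s. smult ((\<beta>(s := b)) j) (\<Psi> j))" by simp
  then show ?case by blast
qed

text \<open>Interpolation in the first \<open>k\<close> coordinates, one after the other.\<close>

fun coordinate_interpolation ::
    "nat \<Rightarrow> (nat \<Rightarrow> real) \<Rightarrow> ((nat \<Rightarrow> real) \<Rightarrow> 'v::real_vector) \<Rightarrow> nat \<Rightarrow> (nat \<Rightarrow> real) \<Rightarrow> 'v" where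
  "coordinate_interpolation s x f 0 y = f y"
| "coordinate_interpolation s x f (Suc k) y =
     (\<Sum>i<s. poly (lagrange_basis s x i) (y k) *\<^sub>R coordinate_interpolation s x f k (y(k := x i)))"

lemma coordinate_interpolation_expand:
  "coordinate_interpolation s x f k y =
     (\<Sum>\<nu>\<in>index_box k s. (\<Prod>j<k. poly (lagrange_basis s x (\<nu> j)) (y j)) *\<^sub>R
        f (\<lambda>j. if j < k then x (\<nu> j) else y j))"
proof (induction k arbitrary: y)
  case (Suc k)
  have box: "index_box (Suc k) s = (\<Pi>\<^sub>E j\<in>insert k {..<k}. {..<s})" by (simp add: lessThan_Suc)
  let ?t = "\<lambda>\<nu>. (\<Prod>j<Suc k. poly (lagrange_basis s x (\<nu> j)) (y j)) *\<^sub>R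
        f (\<lambda>j. if j < Suc k then x (\<nu> j) else y j)"
  have "(\<Sum>\<nu>\<in>index_box (Suc k) s. ?t \<nu>) = (\<Sum>i<s. \<Sum>\<nu>\<in>index_box k s. ?t (\<nu>(k := i)))"
    unfolding box by (rule sum_PiE_insert) simp
  also have "\<dots> = coordinate_interpolation s x f (Suc k) y"
    unfolding coordinate_interpolation.simps Suc.IH scaleR_sum_right
  proof (intro sum.cong refl)
    fix i \<nu>
    have "(\<lambda>j. if j < Suc k then x ((\<nu>(k := i)) j) else y j) = (\<lambda>j. if j < k then x (\<nu> j) else (y(k := x i)) j)"
      by (auto simp: fun_eq_iff less_Suc_eq)
    then show "?t (\<nu>(k := i)) = poly (lagrange_basis s x i) (y k) *\<^sub>R
       (\<Prod>j<k. poly (lagrange_basis s x (\<nu> j)) ((y(k := x i)) j)) *\<^sub>R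
       f (\<lambda>j. if j < k then x (\<nu> j) else (y(k := x i)) j)"
      by (simp add: mult.commute)
  qed
  finally show ?case by simp
qed simp

text \<open>Interpolating in one more coordinate multiplies the error made so far by at most \<open>s\<close>, as the Lagrange
  polynomials are bounded by \<open>1\<close>, and adds the error in that coordinate.  The result is a combination of products
  of Lagrange polynomials, which are re-expanded in \<open>\<Psi>\<^sub>0, \<dots>, \<Psi>\<^sub>s\<^sub>-\<^sub>1\<close>.\<close>

lemma tensor_polynomial_approximation:
  fixes f :: "(nat \<Rightarrow> real) \<Rightarrow> 'v::complex_inner"
  assumes f: "f \<in> holomorphic_ball d \<rho>" and \<rho>: "\<And>k. k < d \<Longrightarrow> r < \<rho> k" and r: "1 < r"
    and \<Psi>: "\<And>j. degree (\<Psi> j) = j" "\<And>j. \<Psi> j \<noteq> 0" and s: "s > 0"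
  obtains q where "\<And>y. y \<in> cube d \<Longrightarrow>
    norm (f y - (tensor_sum \<Psi> d (index_box d s) q y)) \<le>
      real d * real s ^ d * ((1 + real s) * ((r + 1) / (r - 1) / r ^ (s - 1)))"
proof -
  obtain x :: "nat \<Rightarrow> real" where x: "\<And>i. i < s \<Longrightarrow> x i \<in> {-1..1}" "inj_on x {..<s}"
      "\<And>i u. i < s \<Longrightarrow> u \<in> {-1..1} \<Longrightarrow> \<bar>poly (lagrange_basis s x i) u\<bar> \<le> 1"
    by (rule Fekete_points) blast
  define e where "e = (1 + real s) * ((r + 1) / (r - 1) / r ^ (s - 1))"
  have e0: "e \<ge> 0" using r by (simp add: e_def)
  have err: "norm (f y - coordinate_interpolation s x f k y) \<le> real k * real s ^ k * e"
    if "y \<in> cube d" "k \<le> d" for y k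
    using that
  proof (induction k arbitrary: y)
    case (Suc k)
    have k: "k < d" using Suc.prems by simp
    have yk: "y k \<in> {-1..1}" by (rule cube_mem[OF Suc.prems(1) k])
    let ?l = "\<lambda>i. poly (lagrange_basis s x i) (y k)"
    have split: "f y - coordinate_interpolation s x f (Suc k) y =
        (f y - (\<Sum>i<s. ?l i *\<^sub>R f (y(k := x i)))) +
        (\<Sum>i<s. ?l i *\<^sub>R (f (y(k := x i)) - coordinate_interpolation s x f k (y(k := x i))))"
      by (simp add: scaleR_right_diff_distrib sum_subtractf)
    have "norm (f y - coordinate_interpolation s x f (Suc k) y) \<le> e + (\<Sum>i<s. 1 * (real k * real s ^ k * e))"
      unfolding split
    proof (intro norm_triangle_le add_mono sum_norm_le)
      show "norm (f y - (\<Sum>i<s. ?l i *\<^sub>R f (y(k := x i)))) \<le> e"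
        unfolding e_def by (rule coordinate_interpolation_error[OF f \<rho> r x s Suc.prems(1) k])
      fix i assume "i \<in> {..<s}"
      then have i: "i < s" by simp
      have "norm (f (y(k := x i)) - coordinate_interpolation s x f k (y(k := x i))) \<le> real k * real s ^ k * e"
        by (rule Suc.IH[OF cube_update[OF Suc.prems(1) k x(1)[OF i]]]) (use k in simp)
      then show "norm (?l i *\<^sub>R (f (y(k := x i)) - coordinate_interpolation s x f k (y(k := x i)))) \<le> 1 * (real k * real s ^ k * e)"
        unfolding norm_scaleR using x(3)[OF i yk] e0 by (intro mult_mono) auto
    qed
    also have "\<dots> = e * 1 + real k * real s ^ Suc k * e" by simp
    also have "\<dots> \<le> e * real s ^ Suc k + real k * real s ^ Suc k * e"
      using s e0 by (intro add_right_mono mult_left_mono one_le_power) auto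
    also have "\<dots> = real (Suc k) * real s ^ Suc k * e" by (simp add: algebra_simps)
    finally show ?case .
  qed simp
  have "\<exists>\<beta>. lagrange_basis s x i = (\<Sum>j<s. smult (\<beta> j) (\<Psi> j))" if "i < s" for i
    using degree_lagrange_basis[OF that, of x] by (intro poly_in_span_of_degrees \<Psi> coeff_eq_0) auto
  then obtain \<beta> where \<beta>: "\<And>i. i < s \<Longrightarrow> lagrange_basis s x i = (\<Sum>j<s. smult (\<beta> i j) (\<Psi> j))" by metis
  define a where "a \<nu> = f (\<lambda>j. if j < d then x (\<nu> j) else undefined)" for \<nu>
  define q where "q \<mu> = (\<Sum>\<nu>\<in>index_box d s. (\<Prod>j<d. \<beta> (\<nu> j) (\<mu> j)) *\<^sub>R a \<nu>)" for \<mu>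
  have "coordinate_interpolation s x f d y = (tensor_sum \<Psi> d (index_box d s) q y)" if "y \<in> cube d" for y
  proof -
    have "(\<lambda>j. if j < d then x (\<nu> j) else y j) = (\<lambda>j. if j < d then x (\<nu> j) else undefined)" for \<nu>
    proof
      fix j
      show "(if j < d then x (\<nu> j) else y j) = (if j < d then x (\<nu> j) else undefined)"
        using PiE_arb[OF that[unfolded cube_def], of j] by simp
    qed
    then have "coordinate_interpolation s x f d y =
        (\<Sum>\<nu>\<in>index_box d s. (\<Prod>j<d. poly (lagrange_basis s x (\<nu> j)) (y j)) *\<^sub>R a \<nu>)"
      by (simp add: coordinate_interpolation_expand a_def)
    also have "\<dots> = (\<Sum>\<nu>\<in>index_box d s. \<Sum>\<mu>\<in>index_box d s.
        (tensor_poly \<Psi> d \<mu> y * (\<Prod>j<d. \<beta> (\<nu> j) (\<mu> j))) *\<^sub>R a \<nu>)"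
    proof (intro sum.cong refl)
      fix \<nu> assume \<nu>: "\<nu> \<in> index_box d s"
      have "(\<Prod>j<d. poly (lagrange_basis s x (\<nu> j)) (y j)) = (\<Prod>j<d. \<Sum>i<s. \<beta> (\<nu> j) i * poly (\<Psi> i) (y j))"
        using \<nu> by (intro prod.cong) (auto simp: \<beta> poly_sum PiE_iff)
      also have "\<dots> = (\<Sum>\<mu>\<in>index_box d s. \<Prod>j<d. \<beta> (\<nu> j) (\<mu> j) * poly (\<Psi> (\<mu> j)) (y j))"
        by (rule prod_sum_PiE) auto
      also have "\<dots> = (\<Sum>\<mu>\<in>index_box d s. tensor_poly \<Psi> d \<mu> y * (\<Prod>j<d. \<beta> (\<nu> j) (\<mu> j)))"
        by (simp add: prod.distrib tensor_poly_def mult.commute)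
      finally show "(\<Prod>j<d. poly (lagrange_basis s x (\<nu> j)) (y j)) *\<^sub>R a \<nu> =
          (\<Sum>\<mu>\<in>index_box d s. (tensor_poly \<Psi> d \<mu> y * (\<Prod>j<d. \<beta> (\<nu> j) (\<mu> j))) *\<^sub>R a \<nu>)"
        by (simp add: scaleR_sum_left)
    qed
    also have "\<dots> = (tensor_sum \<Psi> d (index_box d s) q y)"
      unfolding q_def scaleR_sum_right by (subst sum.swap) simp
    finally show ?thesis .
  qed
  then show thesis using err[of _ d] that[of q] unfolding e_def by simp
qed

section \<open>A Nikolskii inequality\<close>

text \<open>Differences of order \<open>n\<close> annihilate polynomials of degree below \<open>n\<close>.  For the induction on the polynomial
  write \<open>p(c + k) = a + (c + k) q(c + k)\<close> and use \<open>k (n choose k) = n (n - 1 choose k - 1)\<close> for the summand \<open>k q\<close>.\<close>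

lemma alternating_binomial_poly_eq_0:
  fixes p :: "'a::{comm_ring_1} poly"
  assumes "degree p < n"
  shows "(\<Sum>k\<le>n. (-1) ^ k * of_nat (n choose k) * poly p (c + of_nat k)) = 0"
  using assms
proof (induction p arbitrary: n c rule: pCons_induct)
  case (pCons a p)
  then obtain n' where n: "n = Suc n'" by (cases n) auto
  have const: "(\<Sum>k\<le>n. (-1) ^ k * of_nat (n choose k) * a) = 0"
    using choose_alternating_sum[of n, where 'a = 'a] n by (simp flip: sum_distrib_right)
  show ?case
  proof (cases "p = 0")
    case False
    then have deg: "degree p < n'" using pCons.prems n by simp
    have IH1: "(\<Sum>k\<le>n. (-1) ^ k * of_nat (n choose k) * poly p (c + of_nat k)) = 0"
      by (rule pCons.IH) (use deg n in simp)
    have IH2: "(\<Sum>k\<le>n'. (-1) ^ k * of_nat (n' choose k) * poly p (c + 1 + of_nat k)) = 0"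
      by (rule pCons.IH) (rule deg)
    have "(\<Sum>k\<le>n. (-1) ^ k * of_nat (n choose k) * (of_nat k * poly p (c + of_nat k))) =
        (\<Sum>k\<le>n'. (-1) ^ Suc k * of_nat (n choose Suc k) * (of_nat (Suc k) * poly p (c + of_nat (Suc k))))"
      unfolding n by (subst sum.atMost_Suc_shift) simp
    also have "\<dots> = (\<Sum>k\<le>n'. - of_nat n * ((-1) ^ k * of_nat (n' choose k) * poly p (c + 1 + of_nat k)))"
    proof (rule sum.cong)
      fix k
      have "of_nat (Suc k) * of_nat (n choose Suc k) = (of_nat n * of_nat (n' choose k) :: 'a)"
        unfolding n of_nat_mult[symmetric] by (simp only: Suc_times_binomial_eq mult.commute)
      moreover have "- z * B * (C * P) = - N * (z * M * P)" if "C * B = N * M" for z B C P M N :: 'a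
      proof -
        have "- z * B * (C * P) = - (z * (C * B) * P)" by (simp add: mult_ac)
        also have "\<dots> = - N * (z * M * P)" unfolding that by (simp add: mult_ac)
        finally show ?thesis .
      qed
      moreover have "c + of_nat (Suc k) = c + 1 + of_nat k" by simp
      moreover have "(-1 :: 'a) ^ Suc k = - ((-1) ^ k)" by simp
      ultimately show "(-1) ^ Suc k * of_nat (n choose Suc k) * (of_nat (Suc k) * poly p (c + of_nat (Suc k))) =
          - of_nat n * ((-1) ^ k * of_nat (n' choose k) * poly p (c + 1 + of_nat k))"
        by metis
    qed simp
    also have "\<dots> = 0" by (simp only: sum_distrib_left[symmetric] IH2 mult_zero_right)
    finally have shifted:
      "(\<Sum>k\<le>n. (-1) ^ k * of_nat (n choose k) * (of_nat k * poly p (c + of_nat k))) = 0" .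
    have "(\<Sum>k\<le>n. (-1) ^ k * of_nat (n choose k) * poly (pCons a p) (c + of_nat k)) =
        (\<Sum>k\<le>n. (-1) ^ k * of_nat (n choose k) * a) +
        c * (\<Sum>k\<le>n. (-1) ^ k * of_nat (n choose k) * poly p (c + of_nat k)) +
        (\<Sum>k\<le>n. (-1) ^ k * of_nat (n choose k) * (of_nat k * poly p (c + of_nat k)))"
      by (simp add: sum.distrib sum_distrib_left algebra_simps)
    then show ?thesis by (simp only: const IH1 shifted add_0_left mult_zero_right)
  qed (use const in simp)
qed simp

text \<open>The polynomial \<open>u \<mapsto> p (x + h (u / s)\<^sup>2)\<close> has degree below \<open>2 s\<close>, so its central difference of order
  \<open>2 s\<close> at \<open>0\<close> vanishes.  The middle binomial coefficient, which belongs to \<open>p x\<close>, is the largest one.  The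
  nodes all lie on one side of \<open>x\<close>, as is necessary when \<open>x\<close> is an end point of the interval.\<close>

lemma poly_le_sum_quadratic_nodes:
  fixes p :: "real poly"
  assumes "degree p < s"
  shows "\<bar>poly p x\<bar> \<le> (\<Sum>k\<in>{..2 * s} - {s}. \<bar>poly p (x + h * ((real k - real s) / real s)\<^sup>2)\<bar>)"
proof -
  define q where "q = pcompose p [:x, 0, h / (real s)\<^sup>2:]"
  have q: "poly q u = poly p (x + h * (u / real s)\<^sup>2)" for u
    by (simp add: q_def poly_pcompose power2_eq_square algebra_simps)
  have "degree q \<le> degree p * 2"
    unfolding q_def by (rule order_trans[OF degree_pcompose_le mult_le_mono2]) (simp add: degree_pCons_le)
  then have "degree q < 2 * s" using assms by simp
  from alternating_binomial_poly_eq_0[OF this, of "- real s"]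
  have "0 = (\<Sum>k\<le>2 * s. (-1) ^ k * real (2 * s choose k) * poly q (real k - real s))" by simp
  also have "\<dots> = (-1) ^ s * real (2 * s choose s) * poly q 0 +
      (\<Sum>k\<in>{..2 * s} - {s}. (-1) ^ k * real (2 * s choose k) * poly q (real k - real s))"
    by (subst sum.remove[of _ s]) auto
  finally have "(-1) ^ s * real (2 * s choose s) * poly q 0 =
      - (\<Sum>k\<in>{..2 * s} - {s}. (-1) ^ k * real (2 * s choose k) * poly q (real k - real s))"
    by linarith
  from arg_cong[OF this, of abs]
  have "real (2 * s choose s) * \<bar>poly q 0\<bar> =
      \<bar>\<Sum>k\<in>{..2 * s} - {s}. (-1) ^ k * real (2 * s choose k) * poly q (real k - real s)\<bar>"
    by (simp add: abs_mult power_abs)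
  also have "\<dots> \<le> (\<Sum>k\<in>{..2 * s} - {s}. real (2 * s choose k) * \<bar>poly q (real k - real s)\<bar>)"
    by (rule order_trans[OF sum_abs]) (simp add: abs_mult power_abs)
  also have "\<dots> \<le> (\<Sum>k\<in>{..2 * s} - {s}. real (2 * s choose s) * \<bar>poly q (real k - real s)\<bar>)"
    using binomial_maximum[of "2 * s"] by (intro sum_mono mult_right_mono) auto
  also have "\<dots> = real (2 * s choose s) * (\<Sum>k\<in>{..2 * s} - {s}. \<bar>poly q (real k - real s)\<bar>)"
    by (simp add: sum_distrib_left)
  finally have "\<bar>poly q 0\<bar> \<le> (\<Sum>k\<in>{..2 * s} - {s}. \<bar>poly q (real k - real s)\<bar>)"
    by (rule mult_left_le_imp_le) (simp add: zero_less_binomial_iff)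
  then show ?thesis by (simp add: q)
qed

lemma integrable_poly_indicator:
  "integrable lborel (\<lambda>y. indicator {-1..1} y * (poly p y)\<^sup>2 :: real)"
  using borel_integrable_compact[of "{-1..1::real}" "\<lambda>y. (poly p y)\<^sup>2"]
  by (simp add: continuous_intros)

text \<open>Square the estimate at the quadratic nodes with step \<open>h = \<sigma> l\<close> and integrate over \<open>l \<in> [0, 1]\<close>: each node
  then sweeps a part of \<open>[-1, 1]\<close>, at a speed of at least \<open>1 / s\<^sup>2\<close>.  The sign \<open>\<sigma>\<close> points from \<open>x\<close> to the more
  distant end of the interval.\<close>

lemma Nikolskii_Lebesgue:
  fixes p :: "real poly"
  assumes deg: "degree p < s" and x: "x \<in> {-1..1}"
  shows "(poly p x)\<^sup>2 \<le> 4 * real s ^ 4 * (\<integral>y. indicator {-1..1} y * (poly p y)\<^sup>2 \<partial>lborel)"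
proof -
  define F where "F y = (indicator {-1..1} y * (poly p y)\<^sup>2 :: real)" for y
  have F: "integrable lborel F" unfolding F_def by (rule integrable_poly_indicator)
  have F0: "F y \<ge> 0" for y by (simp add: F_def)
  define \<sigma> :: real where "\<sigma> = (if x \<ge> 0 then -1 else 1)"
  define J where "J = {..2 * s} - {s}"
  define c where "c k = \<sigma> * ((real k - real s) / real s)\<^sup>2" for k
  have s: "s > 0" using deg by simp
  have J: "finite J" "card J = 2 * s" unfolding J_def by auto
  have c: "c k \<noteq> 0" "\<bar>c k\<bar> \<le> 1" "1 / \<bar>c k\<bar> \<le> (real s)\<^sup>2" if "k \<in> J" for k
  proof -
    have "k \<noteq> s" "k \<le> 2 * s" using that by (auto simp: J_def)
    then have a: "1 \<le> \<bar>real k - real s\<bar>" "\<bar>real k - real s\<bar> \<le> real s" by linarith+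
    have eq: "\<bar>c k\<bar> = (\<bar>real k - real s\<bar> / real s)\<^sup>2"
      by (simp add: c_def abs_mult \<sigma>_def power2_abs power_divide)
    show "\<bar>c k\<bar> \<le> 1" unfolding eq using a s by (simp add: power_le_one)
    show "c k \<noteq> 0" using a s by (auto simp: c_def \<sigma>_def)
    have "1 \<le> \<bar>real k - real s\<bar>\<^sup>2" using a by (intro one_le_power)
    then show "1 / \<bar>c k\<bar> \<le> (real s)\<^sup>2"
      unfolding eq using s a by (simp add: power_divide field_simps)
  qed
  have scaled: "integrable lborel (\<lambda>l. F (x + c k * l))"
    "(\<integral>l. F (x + c k * l) \<partial>lborel) \<le> (real s)\<^sup>2 * (\<integral>y. F y \<partial>lborel)" if "k \<in> J" for k
  proof -
    show "integrable lborel (\<lambda>l. F (x + c k * l))"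
      using lborel_integrable_real_affine[OF F c(1)[OF that]] .
    have "(\<integral>l. F (x + c k * l) \<partial>lborel) = 1 / \<bar>c k\<bar> * (\<integral>y. F y \<partial>lborel)"
      using lborel_integral_real_affine[OF c(1)[OF that], of F x] c(1)[OF that] by (simp add: field_simps)
    also have "\<dots> \<le> (real s)\<^sup>2 * (\<integral>y. F y \<partial>lborel)"
      using c(3)[OF that] F0 by (intro mult_right_mono integral_nonneg) auto
    finally show "(\<integral>l. F (x + c k * l) \<partial>lborel) \<le> (real s)\<^sup>2 * (\<integral>y. F y \<partial>lborel)" .
  qed
  have pointwise: "indicator {0..1} l * (poly p x)\<^sup>2 \<le> 2 * real s * (\<Sum>k\<in>J. F (x + c k * l))" for l :: real
  proof (cases "l \<in> {0..1}")
    case True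
    have mem: "x + c k * l \<in> {-1..1}" if "k \<in> J" for k
    proof -
      have "\<bar>c k\<bar> * l \<le> 1 * 1" using c(2)[OF that] True by (intro mult_mono) auto
      then have "\<bar>c k * l\<bar> \<le> 1" using True by (simp add: abs_mult)
      moreover have "c k * l = \<sigma> * (((real k - real s) / real s)\<^sup>2 * l)" by (simp add: c_def)
      moreover have "((real k - real s) / real s)\<^sup>2 * l \<ge> 0" using True by simp
      ultimately show ?thesis using x by (auto simp: \<sigma>_def split: if_splits)
    qed
    have "\<bar>poly p x\<bar> \<le> (\<Sum>k\<in>J. \<bar>poly p (x + c k * l)\<bar>)"
      using poly_le_sum_quadratic_nodes[OF deg, of x "\<sigma> * l"] by (simp add: J_def c_def ac_simps)
    then have "(poly p x)\<^sup>2 \<le> (\<Sum>k\<in>J. \<bar>poly p (x + c k * l)\<bar>)\<^sup>2"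
      by (metis abs_ge_zero power2_abs power_mono)
    also have "\<dots> \<le> real (card J) * (\<Sum>k\<in>J. \<bar>poly p (x + c k * l)\<bar>\<^sup>2)"
      using sum_squared_le_sum_of_squares[of "\<lambda>k. \<bar>poly p (x + c k * l)\<bar>" J] J by (simp add: mult.commute)
    also have "\<dots> = 2 * real s * (\<Sum>k\<in>J. F (x + c k * l))"
      using mem by (simp add: J F_def)
    finally show ?thesis using True by simp
  qed (simp add: F0 sum_nonneg)
  have "(poly p x)\<^sup>2 = (\<integral>l. indicator {0..1::real} l * (poly p x)\<^sup>2 \<partial>lborel)" by (simp add: content_real)
  also have "\<dots> \<le> (\<integral>l. 2 * real s * (\<Sum>k\<in>J. F (x + c k * l)) \<partial>lborel)"
    by (intro integral_mono pointwise) (auto intro!: scaled)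
  also have "\<dots> = 2 * real s * (\<Sum>k\<in>J. \<integral>l. F (x + c k * l) \<partial>lborel)"
    using scaled(1) by simp
  also have "\<dots> \<le> 2 * real s * (\<Sum>k\<in>J. (real s)\<^sup>2 * (\<integral>y. F y \<partial>lborel))"
    by (intro mult_left_mono sum_mono scaled) auto
  also have "\<dots> = 4 * real s ^ 4 * (\<integral>y. F y \<partial>lborel)"
    by (simp add: J power2_eq_square power4_eq_xxxx)
  finally show ?thesis by (simp add: F_def)
qed

section \<open>The one-dimensional measures and orthonormal polynomials\<close>

lemma weight_nonneg: "y \<in> {-1..1} \<Longrightarrow> weight b y \<ge> 0"
  by (cases b) (auto simp: abs_square_le_1 abs_le_iff)

text \<open>One lower bound for both weights transfers the inequality for Lebesgue measure to both families.\<close>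

lemma weight_ge: "\<bar>y\<bar> < 1 \<Longrightarrow> weight b y \<ge> 1 / 4"
proof (cases b)
  case Chebyshev
  assume y: "\<bar>y\<bar> < 1"
  then have "y\<^sup>2 < 1" by (simp add: abs_square_less_1)
  then have s: "0 < sqrt (1 - y\<^sup>2)" "sqrt (1 - y\<^sup>2) \<le> 1" by auto
  have "pi * sqrt (1 - y\<^sup>2) \<le> 4 * 1" using s pi_less_4 by (intro mult_mono) auto
  then show ?thesis using Chebyshev s by (simp add: field_simps)
qed simp

lemma borel_measurable_weight [measurable]: "weight b \<in> borel_measurable borel"
proof (cases b)
  case Legendre
  then have "weight b = (\<lambda>_. 1 / 2)" by auto
  then show ?thesis by simp
next
  case Chebyshev
  then have "weight b = (\<lambda>y. 1 / (pi * sqrt (1 - y\<^sup>2)))" by auto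
  then show ?thesis by simp
qed

lemma space_measure_1d [simp]: "space (measure_1d b) = {-1..1}"
  by (simp add: measure_1d_def space_restrict_space)

lemma sets_measure_1d [measurable_cong]: "sets (measure_1d b) = sets (restrict_space borel {-1..1})"
  by (simp add: measure_1d_def sets_restrict_space)

text \<open>The antiderivative \<open>arcsin\<close> of the Chebyshev weight is continuous up to the end points but
  differentiable in the interior only.\<close>

lemma weight_has_integral: "(weight b has_integral 1) {-1..1}"
proof (cases b)
  case Legendre
  then have "weight b = (\<lambda>_. 1 / 2)" by auto
  then show ?thesis using has_integral_const_real[of "1 / 2 :: real" "-1" 1] by simp
next
  case Chebyshev
  have "((\<lambda>y. weight b y) has_integral (arcsin 1 / pi - arcsin (-1) / pi)) {-1..1}"
  proof (rule fundamental_theorem_of_calculus_interior)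
    show "continuous_on {-1..1} (\<lambda>y. arcsin y / pi)"
      by (intro continuous_intros) auto
    fix y :: real assume "y \<in> {-1<..<1}"
    then show "((\<lambda>y. arcsin y / pi) has_vector_derivative weight b y) (at y)"
      using Chebyshev unfolding has_real_derivative_iff_has_vector_derivative[symmetric]
      by (auto intro!: derivative_eq_intros simp: field_simps)
  qed simp
  then show ?thesis by (simp add: arcsin_minus)
qed

lemma prob_space_measure_1d: "prob_space (measure_1d b)"
proof
  have "{-1..1} \<in> sets (restrict_space lborel {-1..1::real})"
    using sets.top[of "restrict_space lborel {-1..1::real}"] by (simp add: space_restrict_space)
  then have "emeasure (measure_1d b) (space (measure_1d b)) =
      (\<integral>\<^sup>+y. ennreal (weight b y) * indicator {-1..1} y \<partial>restrict_space lborel {-1..1})"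
    unfolding measure_1d_def by (subst emeasure_density)
      (auto simp: space_restrict_space intro!: measurable_restrict_space1)
  also have "\<dots> = (\<integral>\<^sup>+y. ennreal (weight b y) * indicator {-1..1} y \<partial>lborel)"
    by (subst nn_integral_restrict_space) (auto intro!: nn_integral_cong simp: indicator_def)
  also have "\<dots> = (\<integral>\<^sup>+y. ennreal (weight b y * indicator {-1..1} y) \<partial>lborel)"
    by (intro nn_integral_cong) (auto simp: indicator_def)
  also have "\<dots> = ennreal 1"
  proof (rule nn_integral_has_integral_lborel)
    show "((\<lambda>y. weight b y * indicator {-1..1} y) has_integral 1) UNIV"
    proof -
      have "(\<lambda>y. weight b y * indicator {-1..1} y) = (\<lambda>y. if y \<in> {-1..1} then weight b y else 0)"
        by (auto simp: indicator_def)
      then show ?thesis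
        using weight_has_integral[of b] has_integral_restrict_UNIV[of "{-1..1}" "weight b" 1] by simp
    qed
  qed (use weight_nonneg in \<open>auto simp: indicator_def\<close>)
  finally show "emeasure (measure_1d b) (space (measure_1d b)) = 1" by simp
qed

lemma borel_measurable_poly_1d [measurable]: "poly (p :: real poly) \<in> borel_measurable (measure_1d b)"
proof -
  have "poly p \<in> borel_measurable borel" by (intro borel_measurable_continuous_onI continuous_intros)
  then show ?thesis by (simp add: measure_1d_def measurable_restrict_space1)
qed

lemma integrable_bounded_1d:
  assumes "f \<in> borel_measurable (measure_1d b)" "\<And>y. y \<in> {-1..1} \<Longrightarrow> \<bar>f y\<bar> \<le> (B :: real)"
  shows "integrable (measure_1d b) f"
proof -
  interpret prob_space "measure_1d b" by (rule prob_space_measure_1d)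
  show ?thesis by (rule integrable_const_bound[where B = B]) (use assms in auto)
qed

lemma integrable_poly_1d: "integrable (measure_1d b) (\<lambda>y. poly (p :: real poly) y)"
proof -
  have "compact (poly p ` {-1..1})" by (intro compact_continuous_image continuous_intros) auto
  from compact_imp_bounded[OF this] obtain B where "\<forall>v\<in>poly p ` {-1..1}. norm v \<le> B"
    unfolding bounded_iff by blast
  then have "\<bar>poly p y\<bar> \<le> B" if "y \<in> {-1..1}" for y using that by auto
  then show ?thesis by (intro integrable_bounded_1d) auto
qed

lemma integral_1d_square_ge:
  "(\<integral>y. indicator {-1..1} y * (poly p y)\<^sup>2 \<partial>lborel) \<le> 4 * (\<integral>y. (poly p y)\<^sup>2 \<partial>measure_1d b)"
proof -
  let ?R = "restrict_space lborel {-1..1::real}"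
  have [measurable]: "poly p \<in> borel_measurable borel"
    by (intro borel_measurable_continuous_onI continuous_intros)
  have int: "integrable (measure_1d b) (\<lambda>y. (poly p y)\<^sup>2)"
    using integrable_poly_1d[of b "p * p"] by (simp add: power2_eq_square)
  have AE: "AE y in ?R. 0 \<le> weight b y"
    by (rule AE_I2) (use weight_nonneg in \<open>auto simp: space_restrict_space\<close>)
  have m1: "weight b \<in> borel_measurable ?R" "(\<lambda>y. (poly p y)\<^sup>2) \<in> borel_measurable ?R"
    by (auto intro!: measurable_restrict_space1)
  have "integrable ?R (\<lambda>y. weight b y *\<^sub>R (poly p y)\<^sup>2)"
    using int unfolding measure_1d_def by (subst (asm) integrable_density) (use m1 AE in auto)
  then have int': "integrable lborel (\<lambda>y. indicator {-1..1} y *\<^sub>R (weight b y *\<^sub>R (poly p y)\<^sup>2))"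
    by (subst (asm) integrable_restrict_space) auto
  have "(\<integral>y. (poly p y)\<^sup>2 \<partial>measure_1d b) = (\<integral>y. weight b y *\<^sub>R (poly p y)\<^sup>2 \<partial>?R)"
    unfolding measure_1d_def by (rule integral_density) (use m1 AE in auto)
  also have "\<dots> = (\<integral>y. indicator {-1..1} y *\<^sub>R (weight b y *\<^sub>R (poly p y)\<^sup>2) \<partial>lborel)"
    by (rule integral_restrict_space) auto
  also have "4 * \<dots> \<ge> (\<integral>y. indicator {-1..1} y * (poly p y)\<^sup>2 \<partial>lborel)"
  proof -
    \<comment> \<open>The Chebyshev weight takes the value \<open>0\<close> at the end points, by the convention for division by zero.\<close>
    have "AE y in lborel. y \<noteq> (-1::real)" "AE y in lborel. y \<noteq> (1::real)"
      by (rule AE_lborel_singleton)+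
    then have "AE y in lborel. indicator {-1..1} y * (poly p y)\<^sup>2 \<le>
        4 * (indicator {-1..1} y *\<^sub>R (weight b y *\<^sub>R (poly p y)\<^sup>2))"
    proof eventually_elim
      fix y :: real assume "y \<noteq> -1" "y \<noteq> 1"
      show "indicator {-1..1} y * (poly p y)\<^sup>2 \<le>
        4 * (indicator {-1..1} y *\<^sub>R (weight b y *\<^sub>R (poly p y)\<^sup>2))"
      proof (cases "y \<in> {-1..1}")
        case True
        then have "\<bar>y\<bar> < 1" using \<open>y \<noteq> -1\<close> \<open>y \<noteq> 1\<close> by auto
        then have "1 \<le> 4 * weight b y" using weight_ge[of y b] by simp
        from mult_right_mono[OF this, of "(poly p y)\<^sup>2"] show ?thesis using True by simp
      qed simp
    qed
    then show ?thesis
      by (subst integral_mult_right_zero[symmetric])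
         (rule integral_mono_AE[OF integrable_poly_indicator integrable_mult_right, OF int'])
  qed
  finally show ?thesis .
qed

text \<open>The bound is far from optimal, but polynomial in \<open>s\<close>, and this suffices.\<close>

lemma Nikolskii:
  fixes p :: "real poly"
  assumes "degree p < s" "x \<in> {-1..1}"
  shows "(poly p x)\<^sup>2 \<le> 16 * real s ^ 4 * (\<integral>y. (poly p y)\<^sup>2 \<partial>measure_1d b)"
proof -
  have "(poly p x)\<^sup>2 \<le> 4 * real s ^ 4 * (\<integral>y. indicator {-1..1} y * (poly p y)\<^sup>2 \<partial>lborel)"
    by (rule Nikolskii_Lebesgue[OF assms])
  also have "\<dots> \<le> 4 * real s ^ 4 * (4 * (\<integral>y. (poly p y)\<^sup>2 \<partial>measure_1d b))"
    by (intro mult_left_mono integral_1d_square_ge) auto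
  finally show ?thesis by simp
qed

lemma orthonormal_poly_bound:
  assumes "orthonormal_polys (measure_1d b) \<Psi>" "j < s" "x \<in> {-1..1}"
  shows "(poly (\<Psi> j) x)\<^sup>2 \<le> 16 * real s ^ 4"
proof -
  have "degree (\<Psi> j) < s" "(\<integral>y. (poly (\<Psi> j) y)\<^sup>2 \<partial>measure_1d b) = 1"
    using assms by (auto simp: orthonormal_polys_def power2_eq_square)
  then show ?thesis using Nikolskii[of "\<Psi> j" s x b] assms(3) by simp
qed

section \<open>Tensor polynomials under the product measure\<close>

lemma prob_space_cube_measure: "prob_space (cube_measure b d)"
  unfolding cube_measure_def by (rule prob_space_PiM) (rule prob_space_measure_1d)

lemma prob_space_sample_measure: "prob_space (sample_measure b d m)"
  unfolding sample_measure_def by (rule prob_space_PiM) (rule prob_space_cube_measure)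

lemma borel_measurable_tensor_poly: "tensor_poly \<Psi> d \<nu> \<in> borel_measurable (cube_measure b d)"
  unfolding tensor_poly_def cube_measure_def
proof (intro borel_measurable_prod)
  fix k assume k: "k \<in> {..<d}"
  have "(\<lambda>y. y k) \<in> measurable (Pi\<^sub>M {..<d} (\<lambda>_. measure_1d b)) (measure_1d b)"
    using measurable_component_singleton[OF k, of "\<lambda>_. measure_1d b"] .
  from measurable_compose[OF this borel_measurable_poly_1d]
  show "(\<lambda>y. poly (\<Psi> (\<nu> k)) (y k)) \<in> borel_measurable (Pi\<^sub>M {..<d} (\<lambda>_. measure_1d b))" .
qed

lemma index_box_less: "\<nu> \<in> index_box d s \<Longrightarrow> k < d \<Longrightarrow> \<nu> k < s"
  using PiE_mem[of \<nu> "{..<d}" "\<lambda>_. {..<s}" k] by simp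

lemma card_index_box: "card (index_box d s) = s ^ d"
  by (simp add: card_PiE)

lemma finite_index_box: "finite (index_box d s)"
  by (intro finite_PiE) auto

lemma tensor_poly_bound:
  assumes \<Psi>: "orthonormal_polys (measure_1d b) \<Psi>" and \<nu>: "\<nu> \<in> index_box d s" and y: "y \<in> cube d"
  shows "(tensor_poly \<Psi> d \<nu> y)\<^sup>2 \<le> (16 * real s ^ 4) ^ d"
proof -
  have "(tensor_poly \<Psi> d \<nu> y)\<^sup>2 = (\<Prod>k<d. (poly (\<Psi> (\<nu> k)) (y k))\<^sup>2)"
    unfolding tensor_poly_def by (rule prod_power_distrib)
  also have "\<dots> \<le> (\<Prod>k<d. 16 * real s ^ 4)"
    using orthonormal_poly_bound[OF \<Psi>] index_box_less[OF \<nu>] cube_mem[OF y]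
    by (intro prod_mono) auto
  finally show ?thesis by simp
qed

lemma tensor_poly_product_bound:
  assumes \<Psi>: "orthonormal_polys (measure_1d b) \<Psi>" and \<nu>: "\<nu> \<in> index_box d s" "\<mu> \<in> index_box d s" and y: "y \<in> cube d"
  shows "\<bar>tensor_poly \<Psi> d \<nu> y * tensor_poly \<Psi> d \<mu> y\<bar> \<le> (16 * real s ^ 4) ^ d"
proof -
  have "2 * \<bar>tensor_poly \<Psi> d \<nu> y * tensor_poly \<Psi> d \<mu> y\<bar> \<le> (tensor_poly \<Psi> d \<nu> y)\<^sup>2 + (tensor_poly \<Psi> d \<mu> y)\<^sup>2"
    using sum_squares_bound[of "\<bar>tensor_poly \<Psi> d \<nu> y\<bar>" "\<bar>tensor_poly \<Psi> d \<mu> y\<bar>"] by (simp add: abs_mult)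
  then show ?thesis using tensor_poly_bound[OF \<Psi> \<nu>(1) y] tensor_poly_bound[OF \<Psi> \<nu>(2) y] by linarith
qed

lemma tensor_poly_orthonormal:
  assumes \<Psi>: "orthonormal_polys (measure_1d b) \<Psi>" and \<nu>: "\<nu> \<in> index_box d s" "\<mu> \<in> index_box d s"
  shows "(\<integral>y. tensor_poly \<Psi> d \<nu> y * tensor_poly \<Psi> d \<mu> y \<partial>cube_measure b d) = (if \<nu> = \<mu> then 1 else 0)"
    and "integrable (cube_measure b d) (\<lambda>y. tensor_poly \<Psi> d \<nu> y * tensor_poly \<Psi> d \<mu> y)"
proof -
  interpret product_sigma_finite "\<lambda>_. measure_1d b"
    by (simp add: product_sigma_finite_def prob_space_imp_sigma_finite prob_space_measure_1d)
  have eq: "tensor_poly \<Psi> d \<nu> y * tensor_poly \<Psi> d \<mu> y = (\<Prod>k<d. poly (\<Psi> (\<nu> k) * \<Psi> (\<mu> k)) (y k))" for y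
    by (simp add: tensor_poly_def prod.distrib)
  have "(\<integral>y. tensor_poly \<Psi> d \<nu> y * tensor_poly \<Psi> d \<mu> y \<partial>cube_measure b d) =
      (\<Prod>k<d. \<integral>v. poly (\<Psi> (\<nu> k) * \<Psi> (\<mu> k)) v \<partial>measure_1d b)"
    unfolding eq cube_measure_def by (rule product_integral_prod[OF finite_lessThan integrable_poly_1d])
  also have "\<dots> = (\<Prod>k<d. if \<nu> k = \<mu> k then 1 else 0)"
    using \<Psi> by (intro prod.cong refl) (simp add: orthonormal_polys_def)
  also have "\<dots> = (if \<nu> = \<mu> then 1 else 0)"
  proof (cases "\<nu> = \<mu>")
    case False
    then obtain k where "k \<in> {..<d}" "\<nu> k \<noteq> \<mu> k" using PiE_ext[OF \<nu>] by blast
    then show ?thesis using False by (auto intro!: prod_zero)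
  qed simp
  finally show "(\<integral>y. tensor_poly \<Psi> d \<nu> y * tensor_poly \<Psi> d \<mu> y \<partial>cube_measure b d) = (if \<nu> = \<mu> then 1 else 0)" .
  show "integrable (cube_measure b d) (\<lambda>y. tensor_poly \<Psi> d \<nu> y * tensor_poly \<Psi> d \<mu> y)"
    unfolding eq cube_measure_def by (rule product_integrable_prod[OF finite_lessThan integrable_poly_1d])
qed

lemma norm_square_sum:
  fixes e :: "'i \<Rightarrow> 'v::complex_inner"
  shows "(norm (\<Sum>\<nu>\<in>S. a \<nu> *\<^sub>R e \<nu>))\<^sup>2 = (\<Sum>\<nu>\<in>S. \<Sum>\<mu>\<in>S. (a \<nu> * a \<mu>) * Re (cinner (e \<nu>) (e \<mu>)))"
  unfolding norm_square_cinner
  by (subst sum.swap) (simp add: cinner_sum_left cinner_sum_right cinner_scaleR_left cinner_scaleR_right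
      sum_distrib_left mult_ac)

lemma Parseval:
  fixes e :: "(nat \<Rightarrow> nat) \<Rightarrow> 'v::complex_inner"
  assumes \<Psi>: "orthonormal_polys (measure_1d b) \<Psi>"
  shows "(\<integral>y. (norm (tensor_sum \<Psi> d (index_box d s) e y))\<^sup>2 \<partial>cube_measure b d) =
      (L2_set (\<lambda>\<nu>. norm (e \<nu>)) (index_box d s))\<^sup>2"
    and "integrable (cube_measure b d) (\<lambda>y. (norm (tensor_sum \<Psi> d (index_box d s) e y))\<^sup>2)"
proof -
  let ?S = "index_box d s"
  have "(\<integral>y. (norm (tensor_sum \<Psi> d ?S e y))\<^sup>2 \<partial>cube_measure b d) =
      (\<Sum>\<nu>\<in>?S. \<Sum>\<mu>\<in>?S. (\<integral>y. tensor_poly \<Psi> d \<nu> y * tensor_poly \<Psi> d \<mu> y \<partial>cube_measure b d) * Re (cinner (e \<nu>) (e \<mu>)))"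
    unfolding norm_square_sum using tensor_poly_orthonormal(2)[OF \<Psi>] by (simp add: integral_sum)
  also have "\<dots> = (\<Sum>\<nu>\<in>?S. \<Sum>\<mu>\<in>?S. if \<nu> = \<mu> then Re (cinner (e \<nu>) (e \<mu>)) else 0)"
    by (intro sum.cong refl) (simp add: tensor_poly_orthonormal(1)[OF \<Psi>])
  also have "\<dots> = (\<Sum>\<nu>\<in>?S. (norm (e \<nu>))\<^sup>2)"
    by (simp add: finite_index_box norm_square_cinner)
  also have "\<dots> = (L2_set (\<lambda>\<nu>. norm (e \<nu>)) ?S)\<^sup>2"
    by (simp add: L2_set_def sum_nonneg)
  finally show "(\<integral>y. (norm (tensor_sum \<Psi> d ?S e y))\<^sup>2 \<partial>cube_measure b d) =
      (L2_set (\<lambda>\<nu>. norm (e \<nu>)) ?S)\<^sup>2" .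
  show "integrable (cube_measure b d) (\<lambda>y. (norm (tensor_sum \<Psi> d ?S e y))\<^sup>2)"
    unfolding norm_square_sum
    by (intro Bochner_Integration.integrable_sum Bochner_Integration.integrable_mult_left tensor_poly_orthonormal(2)[OF \<Psi>])
qed

lemma tensor_sum_sup_bound:
  fixes e :: "(nat \<Rightarrow> nat) \<Rightarrow> 'v::complex_inner"
  assumes \<Psi>: "orthonormal_polys (measure_1d b) \<Psi>" and y: "y \<in> cube d"
  shows "norm (tensor_sum \<Psi> d (index_box d s) e y) \<le>
    sqrt (real (s ^ d) * (16 * real s ^ 4) ^ d) * L2_set (\<lambda>\<nu>. norm (e \<nu>)) (index_box d s)"
proof -
  let ?S = "index_box d s"
  have "norm (tensor_sum \<Psi> d ?S e y) \<le> (\<Sum>\<nu>\<in>?S. \<bar>tensor_poly \<Psi> d \<nu> y\<bar> * \<bar>norm (e \<nu>)\<bar>)"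
    by (rule order_trans[OF norm_sum]) simp
  also have "\<dots> \<le> L2_set (\<lambda>\<nu>. tensor_poly \<Psi> d \<nu> y) ?S * L2_set (\<lambda>\<nu>. norm (e \<nu>)) ?S"
    by (rule L2_set_mult_ineq)
  also have "\<dots> \<le> sqrt (real (s ^ d) * (16 * real s ^ 4) ^ d) * L2_set (\<lambda>\<nu>. norm (e \<nu>)) ?S"
  proof (rule mult_right_mono)
    have "(\<Sum>\<nu>\<in>?S. (tensor_poly \<Psi> d \<nu> y)\<^sup>2) \<le> real (card ?S) * (16 * real s ^ 4) ^ d"
      by (rule sum_bounded_above) (rule tensor_poly_bound[OF \<Psi> _ y])
    then show "L2_set (\<lambda>\<nu>. tensor_poly \<Psi> d \<nu> y) ?S \<le> sqrt (real (s ^ d) * (16 * real s ^ 4) ^ d)"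
      unfolding L2_set_def card_index_box by (rule real_sqrt_le_mono)
  qed simp
  finally show ?thesis .
qed

section \<open>Concentration of the empirical Gram matrix\<close>

definition good_samples :: "(nat \<Rightarrow> real poly) \<Rightarrow> family \<Rightarrow> nat \<Rightarrow> nat \<Rightarrow> nat \<Rightarrow> (nat \<Rightarrow> nat \<Rightarrow> real) set" where
  "good_samples \<Psi> b d m s =
     {y \<in> space (sample_measure b d m). \<forall>\<nu>\<in>index_box d s. \<forall>\<mu>\<in>index_box d s.
        \<bar>(\<Sum>i<m. tensor_poly \<Psi> d \<nu> (y i) * tensor_poly \<Psi> d \<mu> (y i)) / real m - (if \<nu> = \<mu> then 1 else 0)\<bar>
          \<le> 1 / (2 * real (card (index_box d s)))}"

lemma indep_vars_sample:
  assumes "m > 0"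
  shows "prob_space.indep_vars (sample_measure b d m) (\<lambda>_. cube_measure b d) (\<lambda>i y. y i) {..<m}"
proof -
  interpret prob_space "sample_measure b d m" by (rule prob_space_sample_measure)
  have rv: "(\<lambda>y. y i) \<in> measurable (sample_measure b d m) (cube_measure b d)" if "i \<in> {..<m}" for i
    unfolding sample_measure_def using measurable_component_singleton[OF that, of "\<lambda>_. cube_measure b d"] .
  have distr_comp: "distr (sample_measure b d m) (cube_measure b d) (\<lambda>y. y i) = cube_measure b d" if "i \<in> {..<m}" for i
    unfolding sample_measure_def
    using distr_PiM_component[of "{..<m}" "\<lambda>_. cube_measure b d" i] that prob_space_cube_measure by simp
  have "distr (sample_measure b d m) (\<Pi>\<^sub>M i\<in>{..<m}. cube_measure b d) (\<lambda>y. \<lambda>i\<in>{..<m}. y i) =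
      distr (sample_measure b d m) (sample_measure b d m) (\<lambda>y. y)"
    unfolding sample_measure_def
    by (rule distr_cong) (auto simp: space_PiM PiE_def extensional_restrict)
  also have "\<dots> = (\<Pi>\<^sub>M i\<in>{..<m}. cube_measure b d)" by (simp add: distr_id sample_measure_def)
  also have "\<dots> = (\<Pi>\<^sub>M i\<in>{..<m}. distr (sample_measure b d m) (cube_measure b d) (\<lambda>y. y i))"
    by (rule PiM_cong) (simp_all add: distr_comp)
  finally show ?thesis
    using assms by (subst indep_vars_iff_distr_eq_PiM') (auto intro: rv)
qed

lemma sample_component_measurable:
  "i < m \<Longrightarrow> (\<lambda>y. y i) \<in> measurable (sample_measure b d m) (cube_measure b d)"
  unfolding sample_measure_def using measurable_component_singleton[of i "{..<m}" "\<lambda>_. cube_measure b d"] by simp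

lemma sample_point_in_cube: "y \<in> space (sample_measure b d m) \<Longrightarrow> i < m \<Longrightarrow> y i \<in> cube d"
  using measurable_space[OF sample_component_measurable[of i m b d], of y] by (simp add: space_cube_measure)

text \<open>Hoeffding's inequality for the values of \<open>T\<close> at the independent sample points.\<close>

lemma empirical_mean_concentration:
  assumes m: "m > 0" and T: "T \<in> borel_measurable (cube_measure b d)"
    and B: "\<And>y. y \<in> cube d \<Longrightarrow> \<bar>T y\<bar> \<le> B" "B > 0" and \<eta>: "\<eta> \<ge> 0"
  shows "measure (sample_measure b d m)
      {y \<in> space (sample_measure b d m). \<bar>(\<Sum>i<m. T (y i)) / real m - (\<integral>y. T y \<partial>cube_measure b d)\<bar> \<ge> \<eta>}
    \<le> 2 * exp (- real m * \<eta>\<^sup>2 / (2 * B\<^sup>2))"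
proof -
  interpret prob_space "sample_measure b d m" by (rule prob_space_sample_measure)
  let ?M = "sample_measure b d m" and ?I = "\<integral>y. T y \<partial>cube_measure b d"
  have ex: "expectation (\<lambda>y. T (y i)) = ?I" if "i \<in> {..<m}" for i
  proof -
    have "distr ?M (cube_measure b d) (\<lambda>y. y i) = cube_measure b d"
      unfolding sample_measure_def
      using distr_PiM_component[of "{..<m}" "\<lambda>_. cube_measure b d" i] that prob_space_cube_measure by simp
    then show ?thesis
      using integral_distr[of "\<lambda>y. y i" ?M "cube_measure b d" T] sample_component_measurable[of i m b d] T that by simp
  qed
  interpret H: Hoeffding_ineq ?M "{..<m}" "\<lambda>i y. T (y i)" "\<lambda>_. - B" "\<lambda>_. B" "\<Sum>i<m. expectation (\<lambda>y. T (y i))"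
  proof unfold_locales
    show "indep_vars (\<lambda>_. borel) (\<lambda>i y. T (y i)) {..<m}"
      by (rule indep_vars_compose2[OF indep_vars_sample[OF m]]) (rule T)
    show "AE y in ?M. T (y i) \<in> {- B..B}" if "i \<in> {..<m}" for i
    proof (rule AE_I2)
      fix y assume "y \<in> space ?M"
      then have "\<bar>T (y i)\<bar> \<le> B" using that by (intro B sample_point_in_cube) auto
      then show "T (y i) \<in> {- B..B}" by (simp add: abs_le_iff)
    qed
  qed simp_all
  have sumI: "(\<Sum>i<m. expectation (\<lambda>y. T (y i))) = real m * ?I" using ex by simp
  have scale: "\<bar>(\<Sum>i<m. T (y i)) / real m - ?I\<bar> \<ge> \<eta> \<longleftrightarrow> \<bar>(\<Sum>i<m. T (y i)) - (\<Sum>i<m. expectation (\<lambda>y. T (y i)))\<bar> \<ge> real m * \<eta>" for y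
  proof -
    have "(\<Sum>i<m. T (y i)) - real m * ?I = real m * ((\<Sum>i<m. T (y i)) / real m - ?I)"
      using m by (simp add: field_simps)
    then show ?thesis unfolding sumI using m by (simp add: abs_mult)
  qed
  have "measure ?M {y \<in> space ?M. \<bar>(\<Sum>i<m. T (y i)) - (\<Sum>i<m. expectation (\<lambda>y. T (y i)))\<bar> \<ge> real m * \<eta>}
      \<le> 2 * exp (- 2 * (real m * \<eta>)\<^sup>2 / (\<Sum>i<m. (B - - B)\<^sup>2))"
    using H.Hoeffding_ineq_abs_ge[of "real m * \<eta>"] m B(2) \<eta> by simp
  also have "- 2 * (real m * \<eta>)\<^sup>2 / (\<Sum>i<m. (B - - B)\<^sup>2) = - real m * \<eta>\<^sup>2 / (2 * B\<^sup>2)"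
    using m B(2) by (simp add: power2_eq_square field_simps)
  finally show ?thesis unfolding scale .
qed

text \<open>Union bound over the \<open>s ^ (2 d)\<close> entries of the empirical Gram matrix, each of which is a mean of terms
  of size at most \<open>(16 s ^ 4) ^ d\<close>.\<close>

lemma good_samples_probability:
  assumes \<Psi>: "orthonormal_polys (measure_1d b) \<Psi>" and m: "m > 0" and s: "s > 0"
  shows "good_samples \<Psi> b d m s \<in> sets (sample_measure b d m)"
    and "measure (sample_measure b d m) (good_samples \<Psi> b d m s) \<ge>
      1 - 2 * (real (s ^ d))\<^sup>2 * exp (- real m / (8 * (real (s ^ d))\<^sup>2 * ((16 * real s ^ 4) ^ d)\<^sup>2))"
proof -
  interpret prob_space "sample_measure b d m" by (rule prob_space_sample_measure)
  let ?M = "sample_measure b d m" and ?S = "index_box d s"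
  define \<eta> where "\<eta> = 1 / (2 * real (card ?S))"
  define B where "B = (16 * real s ^ 4) ^ d"
  define T where "T p y = tensor_poly \<Psi> d (fst p) y * tensor_poly \<Psi> d (snd p) y" for p y
  define Z where "Z p y = (\<Sum>i<m. T p (y i)) / real m - (if fst p = snd p then 1 else 0 :: real)" for p y
  define Bad where "Bad p = {y \<in> space ?M. \<bar>Z p y\<bar> \<ge> \<eta>}" for p
  have T[measurable]: "T p \<in> borel_measurable (cube_measure b d)" for p
    unfolding T_def by (intro borel_measurable_times borel_measurable_tensor_poly)
  have Z: "Z p \<in> borel_measurable ?M" for p
    unfolding Z_def
    by (intro borel_measurable_diff borel_measurable_divide borel_measurable_sum borel_measurable_const
        measurable_compose[OF sample_component_measurable T]) simp
  have Bad_sets: "Bad p \<in> sets ?M" for p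
    unfolding Bad_def using Z[of p] by measurable
  have good_eq: "good_samples \<Psi> b d m s = {y \<in> space ?M. \<forall>p\<in>?S \<times> ?S. \<bar>Z p y\<bar> \<le> \<eta>}"
    unfolding good_samples_def Z_def T_def \<eta>_def by auto
  have fin: "finite (?S \<times> ?S)" using finite_index_box by blast
  show sets: "good_samples \<Psi> b d m s \<in> sets ?M"
    unfolding good_eq using Z fin by (intro sets.sets_Collect_finite_All) (auto intro!: borel_measurable_le borel_measurable_abs)
  have Bad_prob: "prob (Bad p) \<le> 2 * exp (- real m * \<eta>\<^sup>2 / (2 * B\<^sup>2))" if p: "p \<in> ?S \<times> ?S" for p
  proof -
    have mem: "fst p \<in> ?S" "snd p \<in> ?S" using p by (simp_all only: mem_Times_iff)
    have I: "(\<integral>y. T p y \<partial>cube_measure b d) = (if fst p = snd p then 1 else 0)"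
      unfolding T_def by (rule tensor_poly_orthonormal(1)[OF \<Psi> mem])
    have Tb: "\<And>y. y \<in> cube d \<Longrightarrow> \<bar>T p y\<bar> \<le> B"
      unfolding T_def B_def by (rule tensor_poly_product_bound[OF \<Psi> mem])
    have "B > 0" "\<eta> \<ge> 0" using s by (auto simp: B_def \<eta>_def)
    then show ?thesis
      using empirical_mean_concentration[OF m T[of p] Tb] unfolding I Bad_def Z_def by blast
  qed
  have "space ?M - good_samples \<Psi> b d m s \<subseteq> (\<Union>p\<in>?S \<times> ?S. Bad p)"
    unfolding good_eq Bad_def by fastforce
  then have "prob (space ?M - good_samples \<Psi> b d m s) \<le> prob (\<Union>p\<in>?S \<times> ?S. Bad p)"
    using Bad_sets fin by (intro finite_measure_mono) auto
  also have "\<dots> \<le> (\<Sum>p\<in>?S \<times> ?S. prob (Bad p))"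
    using fin Bad_sets by (intro finite_measure_subadditive_finite) auto
  also have "\<dots> \<le> real (card (?S \<times> ?S)) * (2 * exp (- real m * \<eta>\<^sup>2 / (2 * B\<^sup>2)))"
    by (rule sum_bounded_above) (rule Bad_prob)
  also have "\<dots> = 2 * (real (s ^ d))\<^sup>2 * exp (- real m * \<eta>\<^sup>2 / (2 * B\<^sup>2))"
    by (simp add: card_cartesian_product card_index_box power2_eq_square)
  also have "- real m * \<eta>\<^sup>2 / (2 * B\<^sup>2) = - real m / (8 * (real (s ^ d))\<^sup>2 * B\<^sup>2)"
    by (simp add: \<eta>_def card_index_box power2_eq_square)
  finally show "prob (good_samples \<Psi> b d m s) \<ge>
      1 - 2 * (real (s ^ d))\<^sup>2 * exp (- real m / (8 * (real (s ^ d))\<^sup>2 * ((16 * real s ^ 4) ^ d)\<^sup>2))"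
    using prob_compl[OF sets] by (simp add: B_def)
qed

lemma Linf_norm_nonneg:
  assumes "prob_space M"
  shows "Linf_norm M g \<ge> 0"
proof (cases "g \<in> borel_measurable M")
  case True
  interpret prob_space M by fact
  show ?thesis
  proof (rule ccontr)
    assume "\<not> 0 \<le> Linf_norm M g"
    then have neg: "esssup M (\<lambda>y. ereal (norm (g y))) < 0" using True by (simp add: Linf_norm_def)
    have "{x \<in> space M. ereal (norm (g x)) > esssup M (\<lambda>y. ereal (norm (g y)))} = space M"
      using neg by (auto intro: less_le_trans)
    then show False using esssup_zero_measure[of M "\<lambda>y. ereal (norm (g y))"] emeasure_space_1 by simp
  qed
qed (simp add: Linf_norm_def)

lemma Linf_norm_le:
  assumes "g \<in> borel_measurable M" "\<And>y. y \<in> space M \<Longrightarrow> norm (g y) \<le> c"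
  shows "Linf_norm M g \<le> ereal c"
  using assms unfolding Linf_norm_def by (auto intro!: esssup_I AE_I2)

lemma L2_norm_le:
  assumes "prob_space M" "g \<in> borel_measurable M" "\<And>y. y \<in> space M \<Longrightarrow> norm (g y) \<le> B"
    "integrable M h" "\<And>y. y \<in> space M \<Longrightarrow> (norm (g y))\<^sup>2 \<le> h y" "(\<integral>y. h y \<partial>M) \<le> c\<^sup>2" "c \<ge> 0"
  shows "L2_norm M g \<le> ereal c"
proof -
  interpret prob_space M by fact
  have int: "integrable M (\<lambda>y. (norm (g y))\<^sup>2)"
    by (rule integrable_const_bound[where B = "B\<^sup>2"]) (use assms(2,3) in \<open>auto intro!: power_mono\<close>)
  have "(\<integral>y. (norm (g y))\<^sup>2 \<partial>M) \<le> (\<integral>y. h y \<partial>M)"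
    by (rule integral_mono[OF int assms(4,5)])
  also have "\<dots> \<le> c\<^sup>2" by fact
  finally have "sqrt (\<integral>y. (norm (g y))\<^sup>2 \<partial>M) \<le> sqrt (c\<^sup>2)" by (rule real_sqrt_le_mono)
  then have "sqrt (\<integral>y. (norm (g y))\<^sup>2 \<partial>M) \<le> c" using assms(7) by simp
  then show ?thesis using int assms(2) by (simp add: L2_norm_def)
qed

section \<open>Error analysis\<close>

text \<open>The error bound of \<open>tensor_polynomial_approximation\<close> for ellipses with parameters above \<open>r\<close>.\<close>

definition interpolation_bound :: "nat \<Rightarrow> real \<Rightarrow> nat \<Rightarrow> real" where
  "interpolation_bound d r s = real d * real s ^ d * ((1 + real s) * ((r + 1) / (r - 1) / r ^ (s - 1)))"

lemma interpolation_bound_nonneg: "r > 1 \<Longrightarrow> interpolation_bound d r s \<ge> 0"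
  by (simp add: interpolation_bound_def)

lemma holomorphic_ball_norm_le:
  fixes f :: "(nat \<Rightarrow> real) \<Rightarrow> 'v::complex_inner"
  assumes f: "f \<in> holomorphic_ball d \<rho>" and \<rho>: "\<And>k. k < d \<Longrightarrow> 1 \<le> \<rho> k" and y: "y \<in> cube d"
  shows "norm (f y) \<le> 1"
proof -
  obtain g where gf: "\<And>y. y \<in> cube d \<Longrightarrow> g (\<lambda>k\<in>{..<d}. complex_of_real (y k)) = f y"
    and bd: "(SUP z\<in>polyellipse d \<rho>. ereal (norm (g z))) \<le> 1"
    using f unfolding holomorphic_ball_def by blast
  have "(\<lambda>k\<in>{..<d}. complex_of_real (y k)) \<in> polyellipse d \<rho>"
    unfolding polyellipse_def
  proof (rule PiE_I)
    fix k assume k: "k \<in> {..<d}"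
    then show "(\<lambda>k\<in>{..<d}. complex_of_real (y k)) k \<in> bernstein_ellipse (\<rho> k)"
      using real_mem_bernstein_ellipse[OF cube_mem[OF y] \<rho>] by simp
  qed simp
  then have "ereal (norm (g (\<lambda>k\<in>{..<d}. complex_of_real (y k)))) \<le> 1"
    by (intro order_trans[OF SUP_upper bd])
  then show ?thesis by (simp only: gf[OF y]) simp
qed

lemma power_le_fact_exp:
  fixes x :: real
  assumes "x \<ge> 0"
  shows "x ^ n \<le> fact n * exp x"
proof -
  have "(\<Sum>k\<in>{n}. inverse (fact k) * x ^ k) \<le> (\<Sum>k. inverse (fact k) * x ^ k)"
    using summable_exp[of x] assms by (intro sum_le_suminf) auto
  then have "inverse (fact n) * x ^ n \<le> exp x" by (simp add: exp_def)
  then show ?thesis by (simp add: field_simps)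
qed

text \<open>Geometric decay beats every power: with \<open>x = (1 + s) ln r\<close> and \<open>M = d + 1 + J\<close>, the inequality
  \<open>x ^ M \<le> M! exp x\<close> bounds \<open>(1 + s) ^ M\<close> by a multiple of \<open>r ^ (s + 1)\<close>.\<close>

lemma interpolation_bound_decay:
  assumes r: "r > 1"
  obtains B where "\<And>s. s > 0 \<Longrightarrow> interpolation_bound d r s * (1 + real s) ^ J \<le> B"
proof
  define c where "c = real d * ((r + 1) / (r - 1))"
  define M where "M = d + 1 + J"
  fix s :: nat assume s: "s > 0"
  have lr: "ln r > 0" using r by simp
  have "(ln r * (1 + real s)) ^ M \<le> fact M * exp (ln r * (1 + real s))"
    using lr by (intro power_le_fact_exp) simp
  also have "exp (ln r * (1 + real s)) = r ^ (s - 1) * r\<^sup>2"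
  proof -
    have "exp (ln r * (1 + real s)) = r powr real (s + 1)" using r by (simp add: powr_def mult.commute)
    also have "\<dots> = r ^ (s + 1)" using r by (subst powr_realpow) auto
    also have "s + 1 = (s - 1) + 2" using s by simp
    finally show ?thesis by (simp only: power_add)
  qed
  finally have "(1 + real s) ^ M * ln r ^ M \<le> fact M * (r ^ (s - 1) * r\<^sup>2)"
    by (simp only: power_mult_distrib mult.commute[of "ln r ^ M"])
  then have *: "(1 + real s) ^ M \<le> fact M * (r ^ (s - 1) * r\<^sup>2) / ln r ^ M"
    using lr by (simp only: pos_le_divide_eq zero_less_power)
  have "interpolation_bound d r s * (1 + real s) ^ J =
      c / r ^ (s - 1) * (real s ^ d * (1 + real s) * (1 + real s) ^ J)"
    by (simp add: interpolation_bound_def c_def)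
  also have "\<dots> \<le> c / r ^ (s - 1) * ((1 + real s) ^ d * (1 + real s) * (1 + real s) ^ J)"
    using r by (intro mult_left_mono mult_right_mono power_mono) (auto simp: c_def)
  also have "(1 + real s) ^ d * (1 + real s) * (1 + real s) ^ J = (1 + real s) ^ M"
    by (simp add: M_def power_add)
  also have "c / r ^ (s - 1) * (1 + real s) ^ M \<le> c / r ^ (s - 1) * (fact M * (r ^ (s - 1) * r\<^sup>2) / ln r ^ M)"
    using r by (intro mult_left_mono *) (auto simp: c_def)
  also have "\<dots> = c * (fact M * r\<^sup>2 / ln r ^ M)" using r by simp
  finally show "interpolation_bound d r s * (1 + real s) ^ J \<le> c * (fact M * r\<^sup>2 / ln r ^ M)" .
qed

lemma interpolation_bound_tendsto: 
  assumes r: "r > 1"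
  shows "(\<lambda>n. interpolation_bound d r (Suc n)) \<longlonglongrightarrow> 0"
proof -
  obtain B where B: "\<And>s. s > 0 \<Longrightarrow> interpolation_bound d r s * (1 + real s) ^ 1 \<le> B"
    using interpolation_bound_decay[OF r, of d 1] by blast
  have le: "interpolation_bound d r (Suc n) \<le> B / real (Suc (Suc n))" for n
    using B[of "Suc n"] by (simp add: field_simps)
  have lim: "(\<lambda>n. B / real (Suc (Suc n))) \<longlonglongrightarrow> 0"
    using LIMSEQ_Suc[OF LIMSEQ_Suc[OF lim_const_over_n[of B]]] .
  show ?thesis
  proof (rule tendsto_sandwich[OF always_eventually always_eventually tendsto_const lim])
    show "\<forall>n. 0 \<le> interpolation_bound d r (Suc n)" using interpolation_bound_nonneg[OF r] by simp
    show "\<forall>n. interpolation_bound d r (Suc n) \<le> B / real (Suc (Suc n))" using le by simp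
  qed
qed

context
  fixes b d \<Psi> \<rho> r and f :: "(nat \<Rightarrow> real) \<Rightarrow> 'v::{complex_hilbert,second_countable_topology}"
  assumes \<Psi>: "orthonormal_polys (measure_1d b) \<Psi>"
    and f: "f \<in> holomorphic_ball d \<rho>" and \<rho>: "\<And>k. k < d \<Longrightarrow> r < \<rho> k" and r: "1 < r"
begin

lemma degree_\<Psi>: "degree (\<Psi> j) = j" and \<Psi>_nonzero: "\<Psi> j \<noteq> 0"
proof -
  show "degree (\<Psi> j) = j" using \<Psi> by (simp add: orthonormal_polys_def)
  have "(\<integral>y. poly (\<Psi> j) y * poly (\<Psi> j) y \<partial>measure_1d b) = 1"
    using \<Psi> unfolding orthonormal_polys_def by simp
  then show "\<Psi> j \<noteq> 0" by auto
qed

lemma best_approximation: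
  assumes "s > 0"
  shows "\<exists>q. \<forall>y\<in>cube d.
    norm (f y - (tensor_sum \<Psi> d (index_box d s) q y)) \<le> interpolation_bound d r s"
proof (rule tensor_polynomial_approximation[OF f _ r degree_\<Psi> \<Psi>_nonzero assms, folded interpolation_bound_def])
  show "r < \<rho> k" if "k < d" for k using that by (rule \<rho>)
  fix q assume q: "\<And>y. y \<in> cube d \<Longrightarrow>
    norm (f y - (tensor_sum \<Psi> d (index_box d s) q y)) \<le> interpolation_bound d r s"
  show ?thesis by (intro exI[of _ q] ballI q)
qed

lemma measurable_tensor_sum:
  "(\<lambda>y. \<Sum>\<mu>\<in>S. tensor_poly \<Psi> d \<mu> y *\<^sub>R (u \<mu> :: 'v)) \<in> borel_measurable (cube_measure b d)"
  by (intro borel_measurable_sum borel_measurable_scaleR borel_measurable_const borel_measurable_tensor_poly)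

text \<open>As a uniform limit of polynomials on the cube; the definition of the ball speaks of separate derivatives
  only.\<close>

lemma measurable_f: "f \<in> borel_measurable (cube_measure b d)"
proof -
  have "\<forall>n. \<exists>q. \<forall>y\<in>cube d. norm (f y - (tensor_sum \<Psi> d (index_box d (Suc n)) q y)) \<le>
      interpolation_bound d r (Suc n)"
    by (intro allI best_approximation) simp
  from choice[OF this] obtain q where q: "\<And>n y. y \<in> cube d \<Longrightarrow>
      norm (f y - (tensor_sum \<Psi> d (index_box d (Suc n)) (q n) y)) \<le> interpolation_bound d r (Suc n)"
    by auto
  show ?thesis
  proof (rule borel_measurable_LIMSEQ_metric)
    show "(\<lambda>y. tensor_sum \<Psi> d (index_box d (Suc n)) (q n) y) \<in> borel_measurable (cube_measure b d)" for n
      by (rule measurable_tensor_sum)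
    fix y assume "y \<in> space (cube_measure b d)"
    then have y: "y \<in> cube d" by (simp add: space_cube_measure)
    have "(\<lambda>n. f y - (tensor_sum \<Psi> d (index_box d (Suc n)) (q n) y)) \<longlonglongrightarrow> 0"
      by (rule Lim_null_comparison[OF always_eventually interpolation_bound_tendsto[OF r, of d]]) (intro allI q y)
    from tendsto_diff[OF tendsto_const[of "f y"] this]
    show "(\<lambda>n. tensor_sum \<Psi> d (index_box d (Suc n)) (q n) y) \<longlonglongrightarrow> f y" by simp
  qed
qed

text \<open>Compare with the interpolation polynomial \<open>Q\<close>.  Its coefficients have norm at most \<open>1\<close> plus the
  interpolation error \<open>e0\<close> (Parseval), and its residual on the data is at most \<open>e0\<close> plus the noise.  After
  \<open>l \<ge> t\<close> steps the initial error has been divided by \<open>2 ^ l \<ge> t\<close>.  The sup norm on the span of the tensor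
  polynomials exceeds the \<open>L\<^sup>2\<close> norm by at most the factor \<open>sqrt X\<close>.\<close>

lemma landweber_approximation:
  fixes \<phi> :: "nat \<Rightarrow> 'v"
  assumes s: "s > 0" and m: "m > 0" and y: "y \<in> good_samples \<Psi> b d m s"
    and data: "is_data m K \<phi> f y noise D" and t: "t \<ge> 1" "t \<le> real l"
    and X: "X \<ge> 1" "real (s ^ d) * (16 * real s ^ 4) ^ d \<le> X"
  defines "F \<equiv> \<lambda>x. \<Sum>\<mu>\<in>index_box d s. tensor_poly \<Psi> d \<mu> x *\<^sub>R
      (\<Sum>k<K. landweber (index_box d s) m (\<lambda>i \<mu>. complex_of_real (tensor_poly \<Psi> d \<mu> (y i))) D l \<mu> k *\<^sub>C \<phi> k)"
    and "\<delta> \<equiv> interpolation_bound d r s + sqrt (\<Sum>i<m. (norm (noise i))\<^sup>2) / sqrt (real m) + 1 / t"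
  shows "L2_norm (cube_measure b d) (\<lambda>x. f x - F x) \<le> ereal (10 * \<delta>)"
    and "Linf_norm (cube_measure b d) (\<lambda>x. f x - F x) \<le> ereal (10 * sqrt X * \<delta>)"
proof -
  let ?S = "index_box d s" and ?M = "cube_measure b d"
  define \<eta> where "\<eta> = sqrt (\<Sum>i<m. (norm (noise i))\<^sup>2) / sqrt (real m)"
  define e0 where "e0 = interpolation_bound d r s"
  have e0: "e0 \<ge> 0" unfolding e0_def by (rule interpolation_bound_nonneg[OF r])
  have \<eta>: "\<eta> \<ge> 0" by (simp add: \<eta>_def sum_nonneg)
  obtain q where q: "\<forall>x\<in>cube d. norm (f x - (tensor_sum \<Psi> d ?S q x)) \<le> e0"
    using best_approximation[OF s] unfolding e0_def ..
  define Q where "Q x = (tensor_sum \<Psi> d ?S q x)" for x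
  define u where "u \<mu> = (\<Sum>k<K. landweber ?S m (\<lambda>i \<mu>. complex_of_real (tensor_poly \<Psi> d \<mu> (y i))) D l \<mu> k *\<^sub>C \<phi> k)" for \<mu>
  define e where "e \<mu> = u \<mu> - q \<mu>" for \<mu>
  define a where "a = L2_set (\<lambda>\<mu>. norm (e \<mu>)) ?S"
  have a0: "a \<ge> 0" by (simp add: a_def)
  have fQ: "norm (f x - Q x) \<le> e0" if "x \<in> cube d" for x using bspec[OF q that] by (simp add: Q_def)
  interpret prob_space ?M by (rule prob_space_cube_measure)
  interpret near_isometry ?S m "\<lambda>i \<mu>. tensor_poly \<Psi> d \<mu> (y i)"
    by unfold_locales (use y m finite_index_box in \<open>auto simp: good_samples_def\<close>)
  have ys: "y i \<in> cube d" if "i < m" for i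
    using y that sample_point_in_cube[of y b d m i] by (simp add: good_samples_def)
  have f1: "norm (f x) \<le> 1" if "x \<in> cube d" for x
    using holomorphic_ball_norm_le[OF f _ that] \<rho> r by (meson less_imp_le less_trans)
  have nq: "L2_set (\<lambda>\<mu>. norm (q \<mu>)) ?S \<le> 1 + e0"
  proof -
    have Q1: "norm (Q x) \<le> 1 + e0" if "x \<in> cube d" for x
      using norm_triangle_ineq4[of "f x" "f x - Q x"] f1[OF that] fQ[OF that] by simp
    have "(L2_set (\<lambda>\<mu>. norm (q \<mu>)) ?S)\<^sup>2 = (\<integral>x. (norm (Q x))\<^sup>2 \<partial>?M)"
      unfolding Q_def by (rule Parseval(1)[OF \<Psi>, symmetric])
    also have "\<dots> \<le> (\<integral>x. (1 + e0)\<^sup>2 \<partial>?M)"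
      using Parseval(2)[OF \<Psi>, where e = q and s = s and d = d] unfolding Q_def[symmetric]
      by (intro integral_mono power_mono Q1) (auto simp: space_cube_measure)
    also have "\<dots> = (1 + e0)\<^sup>2" by (simp add: prob_space)
    finally show ?thesis by (rule power2_le_imp_le) (use e0 in simp)
  qed
  have res: "L2_set (\<lambda>i. norm ((\<Sum>k<K. D i k *\<^sub>C \<phi> k) - apply_design q i)) {..<m} / sqrt (real m) \<le> e0 + \<eta>"
  proof -
    have "norm ((\<Sum>k<K. D i k *\<^sub>C \<phi> k) - apply_design q i) \<le> e0 + norm (noise i)" if "i \<in> {..<m}" for i
    proof -
      have "(\<Sum>k<K. D i k *\<^sub>C \<phi> k) - apply_design q i = (f (y i) - Q (y i)) + noise i"
        using data that unfolding is_data_def apply_design_def Q_def by (simp add: algebra_simps)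
      then show ?thesis using norm_triangle_ineq[of "f (y i) - Q (y i)" "noise i"] fQ[OF ys[of i]] that by simp
    qed
    then have "L2_set (\<lambda>i. norm ((\<Sum>k<K. D i k *\<^sub>C \<phi> k) - apply_design q i)) {..<m} \<le>
        L2_set (\<lambda>i. e0 + norm (noise i)) {..<m}"
      by (intro L2_set_mono) auto
    also have "\<dots> \<le> L2_set (\<lambda>i. e0) {..<m} + L2_set (\<lambda>i. norm (noise i)) {..<m}"
      by (rule L2_set_triangle_ineq)
    also have "\<dots> = sqrt (real m) * (e0 + \<eta>)"
      using m e0 by (simp add: L2_set_constant \<eta>_def L2_set_def distrib_left)
    finally show ?thesis using m by (simp add: field_simps)
  qed
  have pow: "t \<le> 2 ^ l"
    using t(2) of_nat_less_two_power[of l, where 'a = real] by linarith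
  have "a \<le> L2_set (\<lambda>\<mu>. norm (q \<mu>)) ?S / 2 ^ l + 5 / 2 * (e0 + \<eta>)"
    unfolding a_def e_def u_def
    by (rule order_trans[OF landweber_error]) (intro add_left_mono mult_left_mono res, simp)
  also have "\<dots> \<le> (1 + e0) / t + 5 / 2 * (e0 + \<eta>)"
    using nq pow t e0 by (intro add_right_mono frac_le) auto
  also have "\<dots> \<le> 1 / t + e0 + 5 / 2 * (e0 + \<eta>)"
    using t e0 by (simp add: add_divide_distrib divide_le_eq mult_left_le_one_le mult_right_le_one_le
        pos_divide_le_eq mult_le_cancel_left1)
  finally have "a \<le> 1 / t + e0 + 5 / 2 * (e0 + \<eta>)" .
  moreover have "1 / t \<ge> 0" using t by simp
  moreover have "e0 + a \<le> 5 * (e0 + \<eta> + \<tau>)" if "a \<le> \<tau> + e0 + 5 / 2 * (e0 + \<eta>)" "\<tau> \<ge> 0" for \<tau>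
    using that e0 \<eta> by argo
  ultimately have a: "e0 + a \<le> 5 * \<delta>"
    unfolding \<delta>_def e0_def[symmetric] \<eta>_def[symmetric] by blast
  have \<delta>0: "\<delta> \<ge> 0" using a e0 a0 by simp
  have FQ: "F x = Q x + (tensor_sum \<Psi> d ?S e x)" for x
    by (simp add: F_def Q_def e_def u_def scaleR_right_diff_distrib sum_subtractf)
  let ?R = "\<lambda>x. tensor_sum \<Psi> d ?S e x"
  have pt: "norm (f x - F x) \<le> e0 + norm (?R x)" if "x \<in> cube d" for x
    using norm_triangle_ineq4[of "f x - Q x" "?R x"] fQ[OF that] by (simp add: FQ algebra_simps)
  have sup: "norm (?R x) \<le> sqrt X * a" if "x \<in> cube d" for x
    unfolding a_def using X(2)
    by (intro order_trans[OF tensor_sum_sup_bound[OF \<Psi> that]] mult_right_mono real_sqrt_le_mono) auto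
  have sup': "norm (f x - F x) \<le> sqrt X * (5 * \<delta>)" if "x \<in> cube d" for x
  proof -
    have "norm (f x - F x) \<le> 1 * e0 + sqrt X * a" using pt[OF that] sup[OF that] by simp
    also have "\<dots> \<le> sqrt X * e0 + sqrt X * a" using X(1) e0 by (intro add_right_mono mult_right_mono) auto
    also have "\<dots> = sqrt X * (e0 + a)" by (simp add: distrib_left)
    also have "\<dots> \<le> sqrt X * (5 * \<delta>)" using a X(1) by (intro mult_left_mono) auto
    finally show ?thesis .
  qed
  have meas: "(\<lambda>x. f x - F x) \<in> borel_measurable ?M"
    unfolding F_def by (intro borel_measurable_diff measurable_f measurable_tensor_sum)
  show "Linf_norm ?M (\<lambda>x. f x - F x) \<le> ereal (10 * sqrt X * \<delta>)"
  proof (rule Linf_norm_le[OF meas])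
    fix x assume "x \<in> space ?M"
    then have "norm (f x - F x) \<le> sqrt X * (5 * \<delta>)" by (intro sup') (simp add: space_cube_measure)
    also have "\<dots> \<le> 10 * sqrt X * \<delta>" using \<delta>0 X(1) by simp
    finally show "norm (f x - F x) \<le> 10 * sqrt X * \<delta>" .
  qed
  show "L2_norm ?M (\<lambda>x. f x - F x) \<le> ereal (10 * \<delta>)"
  proof (rule L2_norm_le[OF prob_space_cube_measure meas, where h = "\<lambda>x. 2 * e0\<^sup>2 + 2 * (norm (?R x))\<^sup>2"])
    show "norm (f x - F x) \<le> sqrt X * (5 * \<delta>)" if "x \<in> space ?M" for x
      using that by (intro sup') (simp add: space_cube_measure)
    show int: "integrable ?M (\<lambda>x. 2 * e0\<^sup>2 + 2 * (norm (?R x))\<^sup>2)"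
      by (intro Bochner_Integration.integrable_add Bochner_Integration.integrable_mult_right
          integrable_const Parseval(2)[OF \<Psi>])
    fix x assume "x \<in> space ?M"
    then have "(norm (f x - F x))\<^sup>2 \<le> (e0 + norm (?R x))\<^sup>2"
      by (intro power_mono pt) (auto simp: space_cube_measure)
    also have "\<dots> \<le> 2 * e0\<^sup>2 + 2 * (norm (?R x))\<^sup>2"
      using sum_squares_bound[of e0 "norm (?R x)"] by (simp add: power2_sum)
    finally show "(norm (f x - F x))\<^sup>2 \<le> 2 * e0\<^sup>2 + 2 * (norm (?R x))\<^sup>2" .
  next
    have "(\<integral>x. 2 * e0\<^sup>2 + 2 * (norm (?R x))\<^sup>2 \<partial>?M) = 2 * e0\<^sup>2 + 2 * (\<integral>x. (norm (?R x))\<^sup>2 \<partial>?M)"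
      using Parseval(2)[OF \<Psi>, where e = e and d = d and s = s]
      by (subst Bochner_Integration.integral_add) (simp_all add: prob_space)
    also have "\<dots> = 2 * e0\<^sup>2 + 2 * a\<^sup>2" by (simp add: Parseval(1)[OF \<Psi>] a_def)
    also have "\<dots> \<le> 2 * (e0 + a)\<^sup>2" using e0 a0 by (simp add: power2_sum)
    also have "\<dots> \<le> 2 * (5 * \<delta>)\<^sup>2" using a e0 a0 by (intro mult_left_mono power_mono) auto
    also have "\<dots> \<le> (10 * \<delta>)\<^sup>2" by (simp add: power_mult_distrib)
    finally show "(\<integral>x. 2 * e0\<^sup>2 + 2 * (norm (?R x))\<^sup>2 \<partial>?M) \<le> (10 * \<delta>)\<^sup>2" .
  qed (use \<delta>0 in simp)
qed

lemma norms_le_one: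
  "L2_norm (cube_measure b d) f \<le> 1" "Linf_norm (cube_measure b d) f \<le> 1"
proof -
  interpret prob_space "cube_measure b d" by (rule prob_space_cube_measure)
  have f1: "norm (f x) \<le> 1" if "x \<in> space (cube_measure b d)" for x
    using holomorphic_ball_norm_le[OF f, of x] \<rho> r that unfolding space_cube_measure by (meson less_imp_le less_trans)
  have "L2_norm (cube_measure b d) f \<le> ereal 1"
    by (rule L2_norm_le[OF prob_space_cube_measure measurable_f f1, where h = "\<lambda>_. 1"])
      (use f1 in \<open>auto simp: prob_space power_le_one\<close>)
  then show "L2_norm (cube_measure b d) f \<le> 1" by (simp add: one_ereal_def)
  have "Linf_norm (cube_measure b d) f \<le> ereal 1" by (rule Linf_norm_le[OF measurable_f f1])
  then show "Linf_norm (cube_measure b d) f \<le> 1" by (simp add: one_ereal_def)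
qed

end

section \<open>Parameters\<close>

lemma log_factor_ge:
  assumes "m \<ge> 3" "d \<ge> 1" "0 < \<epsilon>" "\<epsilon> < 1"
  shows "ln (real m) \<ge> 1" "log_factor m d \<epsilon> \<ge> ln (real m) + ln (inverse \<epsilon>)" "log_factor m d \<epsilon> \<ge> 1"
proof -
  have "exp 1 \<le> real m" using exp_le assms(1) by linarith
  then have "ln (exp 1) \<le> ln (real m)" using assms(1) by (subst ln_le_cancel_iff) auto
  then show lm: "ln (real m) \<ge> 1" by simp
  have le: "ln (inverse \<epsilon>) \<ge> 0" using assms by (simp add: ln_inverse)
  have "ln (exp 1 * real d) \<ge> 1" using assms(2) by (simp add: ln_mult)
  then have "ln (exp 1 * real d) * ln (real m) \<ge> 1 * ln (real m)" using lm by (intro mult_right_mono) auto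
  then have M: "min (ln (real m) + real d) (ln (exp 1 * real d) * ln (real m)) \<ge> 1" (is "?M \<ge> 1")
    using lm by (intro min.boundedI) linarith+
  have "1 * 1 \<le> ln (real m) * ?M" using lm M by (intro mult_mono) auto
  then have "ln (real m) * (1 * 1) \<le> ln (real m) * (ln (real m) * ?M)" using lm by (intro mult_left_mono) auto
  moreover have "1 * ln (inverse \<epsilon>) \<le> ln (real m) * ln (inverse \<epsilon>)" using lm le by (intro mult_right_mono) auto
  ultimately show *: "log_factor m d \<epsilon> \<ge> ln (real m) + ln (inverse \<epsilon>)"
    by (simp add: log_factor_def distrib_left)
  then show "log_factor m d \<epsilon> \<ge> 1" using lm le by linarith
qed

text \<open>With \<open>u = s ^ d\<close>, the assumption \<open>s \<ge> 16\<close> turns the sup-norm bound \<open>(16 s ^ 4) ^ d\<close> into \<open>u ^ 5\<close>.  So the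
  exponent is at least \<open>m / (8 u ^ 12) \<ge> L u\<^sup>2 / 8 \<ge> 2 L\<close>, and \<open>exp (- 2 L) \<le> (\<epsilon> / m)\<^sup>2\<close> absorbs the
  number \<open>u\<^sup>2\<close> of entries because \<open>u ^ 14 \<le> m\<close>.\<close>

lemma failure_probability_le:
  fixes L :: real
  assumes m: "m \<ge> 3" and \<epsilon>: "0 < \<epsilon>" "\<epsilon> < 1" and L: "L \<ge> ln (real m) + ln (inverse \<epsilon>)" "L \<ge> 1"
    and s: "s \<ge> 16" and d: "d \<ge> 1" and X: "real s ^ (14 * d) \<le> real m / L"
  shows "2 * (real (s ^ d))\<^sup>2 * exp (- real m / (8 * (real (s ^ d))\<^sup>2 * ((16 * real s ^ 4) ^ d)\<^sup>2)) \<le> \<epsilon>"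
    and "real (s ^ d) * (16 * real s ^ 4) ^ d \<le> real m / L" "real m / L \<ge> 1"
proof -
  define u where "u = real s ^ d"
  have u: "u \<ge> 16"
  proof -
    have "16 \<le> real s" using s by simp
    also have "real s \<le> u" unfolding u_def using s d by (intro self_le_power) auto
    finally show ?thesis .
  qed
  have u5: "(16 * real s ^ 4) ^ d \<le> u ^ 5"
  proof -
    have "16 * real s ^ 4 \<le> real s * real s ^ 4" using s by (intro mult_right_mono) auto
    then have "(16 * real s ^ 4) ^ d \<le> (real s ^ 5) ^ d" by (intro power_mono) (auto simp: power_def eval_nat_numeral)
    then show ?thesis by (simp add: u_def power_mult[symmetric] mult.commute)
  qed
  have u14: "u ^ 14 \<le> real m / L" using X by (simp add: u_def power_mult[symmetric] mult.commute)
  have "u ^ 6 \<le> u ^ 14" using u by (intro power_increasing) auto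
  moreover have "real (s ^ d) * (16 * real s ^ 4) ^ d \<le> u * u ^ 5"
    unfolding of_nat_power u_def[symmetric] using u u5 by (intro mult_left_mono) auto
  moreover have "u * u ^ 5 = u ^ 6" by (simp add: eval_nat_numeral)
  ultimately show "real (s ^ d) * (16 * real s ^ 4) ^ d \<le> real m / L" using u14 by linarith
  have one: "1 \<le> u ^ 14" using u by (intro one_le_power) auto
  then show "real m / L \<ge> 1" using u14 by linarith
  have mL: "L * u ^ 14 \<le> real m" using u14 L(2) by (simp add: field_simps)
  have um: "u ^ 14 \<le> real m"
  proof -
    have "1 * u ^ 14 \<le> L * u ^ 14" using L(2) one by (intro mult_right_mono) auto
    then show ?thesis using mL by simp
  qed
  have expo: "2 * L \<le> real m / (8 * u\<^sup>2 * ((16 * real s ^ 4) ^ d)\<^sup>2)"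
  proof -
    have "8 * u\<^sup>2 * ((16 * real s ^ 4) ^ d)\<^sup>2 \<le> 8 * u\<^sup>2 * (u ^ 5)\<^sup>2"
      using u5 by (intro mult_left_mono power_mono) auto
    also have "\<dots> = 8 * u ^ 12" by (simp add: power_mult[symmetric] flip: power_add)
    finally have den: "8 * u\<^sup>2 * ((16 * real s ^ 4) ^ d)\<^sup>2 \<le> 8 * u ^ 12" .
    have "16 * 16 \<le> u * u" using u by (intro mult_mono) auto
    then have "16 \<le> u\<^sup>2" by (simp add: power2_eq_square)
    then have "16 * u ^ 12 \<le> u\<^sup>2 * u ^ 12" using u by (intro mult_right_mono) auto
    then have "16 * u ^ 12 \<le> u ^ 14" by (simp flip: power_add)
    then have "L * (16 * u ^ 12) \<le> L * u ^ 14" using L(2) by (intro mult_left_mono) auto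
    then have "2 * L * (8 * u ^ 12) \<le> real m" using mL by simp
    moreover have "2 * L * (8 * u\<^sup>2 * ((16 * real s ^ 4) ^ d)\<^sup>2) \<le> 2 * L * (8 * u ^ 12)"
      using den L(2) by (intro mult_left_mono) auto
    ultimately have "2 * L * (8 * u\<^sup>2 * ((16 * real s ^ 4) ^ d)\<^sup>2) \<le> real m" by linarith
    moreover have "8 * u\<^sup>2 * ((16 * real s ^ 4) ^ d)\<^sup>2 > 0" using u s by simp
    ultimately show ?thesis by (simp add: pos_le_divide_eq)
  qed
  have eL: "exp (- L) \<le> \<epsilon> / real m"
  proof -
    have "exp (- L) \<le> exp (- (ln (real m) + ln (inverse \<epsilon>)))" using L(1) by simp
    also have "\<dots> = \<epsilon> / real m" using m \<epsilon> by (simp add: exp_minus exp_add ln_inverse exp_diff field_simps)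
    finally show ?thesis .
  qed
  have "exp (- real m / (8 * u\<^sup>2 * ((16 * real s ^ 4) ^ d)\<^sup>2)) \<le> exp (- L) * exp (- L)"
    using expo by (simp flip: exp_add)
  also have "\<dots> \<le> (\<epsilon> / real m) * (\<epsilon> / real m)" using eL \<epsilon> by (intro mult_mono) auto
  finally have "2 * u\<^sup>2 * exp (- real m / (8 * u\<^sup>2 * ((16 * real s ^ 4) ^ d)\<^sup>2)) \<le> 2 * u\<^sup>2 * ((\<epsilon> / real m) * (\<epsilon> / real m))"
    by (intro mult_left_mono) auto
  also have "\<dots> \<le> real m * ((\<epsilon> / real m) * (\<epsilon> / real m))"
  proof (rule mult_right_mono)
    have "2 * u\<^sup>2 \<le> u ^ 1 * u\<^sup>2" using u by (intro mult_right_mono) auto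
    also have "\<dots> \<le> u ^ 14" using u unfolding power_add[symmetric] by (intro power_increasing) auto
    finally show "2 * u\<^sup>2 \<le> real m" using um by linarith
  qed (use \<epsilon> in simp)
  also have "\<dots> = \<epsilon> * (\<epsilon> / real m)" using m by simp
  also have "\<dots> \<le> \<epsilon> * 1" using m \<epsilon> by (intro mult_left_mono) (auto simp: field_simps)
  finally have "2 * u\<^sup>2 * exp (- real m / (8 * u\<^sup>2 * ((16 * real s ^ 4) ^ d)\<^sup>2)) \<le> \<epsilon>" by simp
  then show "2 * (real (s ^ d))\<^sup>2 * exp (- real m / (8 * (real (s ^ d))\<^sup>2 * ((16 * real s ^ 4) ^ d)\<^sup>2)) \<le> \<epsilon>"
    by (simp add: u_def)
qed

lemma obtain_resolution:
  fixes X :: real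
  assumes "X > 0" "n > 0"
  obtains s :: nat where "real s ^ n \<le> X" "X < (real s + 1) ^ n"
proof
  let ?s = "nat \<lfloor>root n X\<rfloor>"
  have root: "root n X > 0" "root n X ^ n = X" using assms by (auto simp: real_root_pow_pos)
  have "real ?s \<le> root n X" "root n X < real ?s + 1" using root(1) by linarith+
  then have "real ?s ^ n \<le> root n X ^ n" "root n X ^ n < (real ?s + 1) ^ n"
    using root(1) assms(2) power_mono[of "real ?s" "root n X" n] power_strict_mono[of "root n X" "real ?s + 1" n]
    by linarith+
  then show "real ?s ^ n \<le> X" "X < (real ?s + 1) ^ n" unfolding root(2) .
qed

lemma index_box_subset_hyp_cross:
  assumes "s ^ d \<le> n"
  shows "index_box d s \<subseteq> hyp_cross n d"
proof
  fix \<nu> assume \<nu>: "\<nu> \<in> index_box d s"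
  have "(\<Prod>k<d. \<nu> k + 1) \<le> (\<Prod>k<d. s)"
    using index_box_less[OF \<nu>] by (intro prod_mono) (auto simp: Suc_le_eq)
  then have "(\<Prod>k<d. \<nu> k + 1) \<le> n" using assms by simp
  moreover have "\<nu> \<in> {..<d} \<rightarrow>\<^sub>E UNIV" using \<nu> by (auto simp: PiE_def)
  ultimately show "\<nu> \<in> hyp_cross n d" unfolding hyp_cross_def by simp
qed

text \<open>The first claim bounds the interpolation error by \<open>X\<close> to the power \<open>- a\<close>, where \<open>a = 1 / p - 1 / 2\<close>;
  as \<open>X < (s + 1) ^ (14 d)\<close>, this is a power of \<open>s + 1\<close> with an exponent depending on \<open>d\<close> and \<open>p\<close> only.  The
  second one serves the zero approximation; it holds for large \<open>C\<close> because \<open>X\<close> is bounded and \<open>a \<ge> 1 / 2\<close>.\<close>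

lemma approximation_constant:
  assumes d: "d \<ge> 1" and r: "r > 1" and p: "0 < p" "p \<le> 1"
  obtains C :: real where
    "\<And>X s. s > 0 \<Longrightarrow> 0 < X \<Longrightarrow> X < (real s + 1) ^ (14 * d) \<Longrightarrow>
       interpolation_bound d r s \<le> C * X powr (1 / 2 - 1 / p)"
    "\<And>X. 0 < X \<Longrightarrow> X < 16 ^ (14 * d) \<Longrightarrow>
       1 \<le> C * X powr (1 / 2 - 1 / p) \<and> 1 \<le> C * (sqrt X * X powr (1 / 2 - 1 / p))"
proof -
  define a where "a = 1 / p - 1 / 2"
  have a: "a \<ge> 1 / 2" using p by (simp add: a_def field_simps)
  define J where "J = nat \<lceil>real (14 * d) * a\<rceil>"
  have J: "real (14 * d) * a \<le> real J" unfolding J_def by linarith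
  obtain B where B: "\<And>s. s > 0 \<Longrightarrow> interpolation_bound d r s * (1 + real s) ^ J \<le> B"
    using interpolation_bound_decay[OF r, of d J] by blast
  define Y where "Y = (16 :: real) ^ (14 * d)"
  have Y: "Y \<ge> 1" by (simp add: Y_def)
  define C where "C = max B (Y powr a)"
  have exp: "1 / 2 - 1 / p = - a" by (simp add: a_def)
  show thesis
  proof
    fix X :: real and s :: nat
    assume s: "s > 0" and X: "0 < X" "X < (real s + 1) ^ (14 * d)"
    have "X powr a \<le> ((real s + 1) ^ (14 * d)) powr a" using X a by (intro powr_mono2) auto
    also have "\<dots> = (real s + 1) powr (real (14 * d) * a)"
      by (simp add: powr_realpow[symmetric] powr_powr del: of_nat_mult)
    also have "\<dots> \<le> (real s + 1) powr real J" using J by (intro powr_mono) auto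
    also have "\<dots> = (1 + real s) ^ J" by (simp add: powr_realpow add.commute)
    finally have "interpolation_bound d r s * X powr a \<le> interpolation_bound d r s * (1 + real s) ^ J"
      by (intro mult_left_mono interpolation_bound_nonneg r)
    also have "\<dots> \<le> C" using B[OF s] by (simp add: C_def)
    finally have "interpolation_bound d r s \<le> C / X powr a" using X by (simp add: field_simps)
    then show "interpolation_bound d r s \<le> C * X powr (1 / 2 - 1 / p)"
      unfolding exp by (simp add: powr_minus field_simps)
  next
    fix X :: real assume X: "0 < X" "X < 16 ^ (14 * d)"
    have "X powr a \<le> Y powr a" using X a by (intro powr_mono2) (auto simp: Y_def)
    then have 1: "X powr a \<le> C" by (simp add: C_def)
    have "sqrt X * X powr (- a) = X powr (1 / 2 + - a)"
      using X by (simp add: powr_half_sqrt[symmetric] flip: powr_add)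
    moreover have "X powr (a - 1 / 2) \<le> C"
    proof -
      have "X powr (a - 1 / 2) \<le> Y powr (a - 1 / 2)" using X a by (intro powr_mono2) (auto simp: Y_def)
      also have "\<dots> \<le> Y powr a" using Y by (intro powr_mono) auto
      finally show ?thesis by (simp add: C_def)
    qed
    moreover have "X powr (1 / 2 + - a) = 1 / X powr (a - 1 / 2)"
      using powr_minus_divide[of X "a - 1 / 2"] by (simp add: algebra_simps)
    moreover have "1 \<le> C * (1 / v)" if "v \<le> C" "v > 0" for v using that by (simp add: field_simps)
    ultimately have 2: "1 \<le> C * (sqrt X * X powr (- a))" using X by simp
    show "1 \<le> C * X powr (1 / 2 - 1 / p) \<and> 1 \<le> C * (sqrt X * X powr (1 / 2 - 1 / p))"
      unfolding exp using 1 2 X by (simp add: powr_minus field_simps)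
  qed
qed

text \<open>A single choice of the constants \<open>C d p \<rho>\<close>, together with a radius \<open>R d \<rho>\<close> of the ellipses.\<close>

lemma uniform_approximation_constant:
  obtains C :: "nat \<Rightarrow> real \<Rightarrow> (nat \<Rightarrow> real) \<Rightarrow> real" and R :: "nat \<Rightarrow> (nat \<Rightarrow> real) \<Rightarrow> real" where
    "\<And>d \<rho>. \<rho> \<in> {..<d} \<rightarrow>\<^sub>E {1<..} \<Longrightarrow> R d \<rho> > 1 \<and> (\<forall>k<d. R d \<rho> < \<rho> k)"
    "\<And>d p \<rho> X s. d \<ge> 1 \<Longrightarrow> \<rho> \<in> {..<d} \<rightarrow>\<^sub>E {1<..} \<Longrightarrow> 0 < p \<Longrightarrow> p \<le> 1 \<Longrightarrow> s > 0 \<Longrightarrow> 0 < X \<Longrightarrow>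
       X < (real s + 1) ^ (14 * d) \<Longrightarrow> interpolation_bound d (R d \<rho>) s \<le> C d p \<rho> * X powr (1 / 2 - 1 / p)"
    "\<And>d p \<rho> X. d \<ge> 1 \<Longrightarrow> \<rho> \<in> {..<d} \<rightarrow>\<^sub>E {1<..} \<Longrightarrow> 0 < p \<Longrightarrow> p \<le> 1 \<Longrightarrow> 0 < X \<Longrightarrow> X < 16 ^ (14 * d) \<Longrightarrow>
       1 \<le> C d p \<rho> * X powr (1 / 2 - 1 / p) \<and> 1 \<le> C d p \<rho> * (sqrt X * X powr (1 / 2 - 1 / p))"
proof -
  have ex_r: "\<exists>r. r > 1 \<and> (\<forall>k<d. r < \<rho> k)" if "\<rho> \<in> {..<d} \<rightarrow>\<^sub>E {1<..}" for d and \<rho> :: "nat \<Rightarrow> real"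
  proof -
    \<comment> \<open>The element \<open>2\<close> keeps the set nonempty if \<open>d = 0\<close>.\<close>
    define M where "M = Min (insert 2 (\<rho> ` {..<d}))"
    have "\<rho> k > 1" if "k < d" for k
      using PiE_mem[OF \<open>\<rho> \<in> {..<d} \<rightarrow>\<^sub>E {1<..}\<close>, of k] that by simp
    then have M: "M > 1" unfolding M_def by auto
    have "M \<le> \<rho> k" if "k < d" for k unfolding M_def using that by (intro Min_le) auto
    then show ?thesis using M by (intro exI[of _ "(1 + M) / 2"]) force
  qed
  define R where "R d \<rho> = (SOME r. r > 1 \<and> (\<forall>k<d. r < \<rho> k))" for d and \<rho> :: "nat \<Rightarrow> real"
  have R: "R d \<rho> > 1 \<and> (\<forall>k<d. R d \<rho> < \<rho> k)" if "\<rho> \<in> {..<d} \<rightarrow>\<^sub>E {1<..}" for d \<rho>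
    unfolding R_def by (rule someI_ex[OF ex_r[OF that]])
  define good where "good d p \<rho> C \<longleftrightarrow> (\<forall>X s. s > 0 \<longrightarrow> 0 < X \<longrightarrow> X < (real s + 1) ^ (14 * d) \<longrightarrow>
         interpolation_bound d (R d \<rho>) s \<le> C * X powr (1 / 2 - 1 / p)) \<and>
      (\<forall>X. 0 < X \<longrightarrow> X < 16 ^ (14 * d) \<longrightarrow>
         1 \<le> C * X powr (1 / 2 - 1 / p) \<and> 1 \<le> C * (sqrt X * X powr (1 / 2 - 1 / p)))" for d p \<rho> C
  define C where "C d p \<rho> = (SOME C. good d p \<rho> C)" for d p \<rho>
  have C: "good d p \<rho> (C d p \<rho>)" if d: "d \<ge> 1" and \<rho>: "\<rho> \<in> {..<d} \<rightarrow>\<^sub>E {1<..}" and p: "0 < p" "p \<le> 1" for d p \<rho>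
  proof -
    have "R d \<rho> > 1" using R[OF \<rho>] ..
    then obtain c where c:
      "\<And>X s. s > 0 \<Longrightarrow> 0 < X \<Longrightarrow> X < (real s + 1) ^ (14 * d) \<Longrightarrow>
         interpolation_bound d (R d \<rho>) s \<le> c * X powr (1 / 2 - 1 / p)"
      "\<And>X. 0 < X \<Longrightarrow> X < 16 ^ (14 * d) \<Longrightarrow>
         1 \<le> c * X powr (1 / 2 - 1 / p) \<and> 1 \<le> c * (sqrt X * X powr (1 / 2 - 1 / p))"
      by (rule approximation_constant[OF d _ p]) blast
    have "good d p \<rho> c" unfolding good_def by (intro conjI allI impI c(1)) (use c(2) in blast)+
    then show ?thesis unfolding C_def by (rule someI)
  qed
  show thesis
  proof (rule that[of R C])
    show "interpolation_bound d (R d \<rho>) s \<le> C d p \<rho> * X powr (1 / 2 - 1 / p)"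
      if "d \<ge> 1" "\<rho> \<in> {..<d} \<rightarrow>\<^sub>E {1<..}" "0 < p" "p \<le> 1" "s > 0" "0 < X" "X < (real s + 1) ^ (14 * d)" for d p \<rho> X s
      using C[OF that(1-4)] that(5-7) unfolding good_def by blast
    show "1 \<le> C d p \<rho> * X powr (1 / 2 - 1 / p) \<and> 1 \<le> C d p \<rho> * (sqrt X * X powr (1 / 2 - 1 / p))"
      if "d \<ge> 1" "\<rho> \<in> {..<d} \<rightarrow>\<^sub>E {1<..}" "0 < p" "p \<le> 1" "0 < X" "X < 16 ^ (14 * d)" for d p \<rho> X
      using C[OF that(1-4)] that(5-6) unfolding good_def by blast
  qed (rule R)
qed

text \<open>The term \<open>L\<close> stands for the distance of \<open>f\<close> to the subspace, which may be infinite.\<close>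

lemma ereal_error_mono:
  assumes "A \<le> ereal (c * (x + y + z))" "x \<le> x'" "c \<ge> 0" "L \<ge> 0"
  shows "A \<le> ereal c * (ereal x' + ereal y + L + ereal z)"
proof (cases L)
  case (real l)
  have "c * (x + y + z) \<le> c * (x' + y + l + z)"
    using assms(2-4) real by (intro mult_left_mono) auto
  then show ?thesis using assms(1) real by (auto intro: order_trans)
next
  case PInf
  then show ?thesis using assms(1,3)
    by (cases "c = 0") (auto simp: zero_ereal_def[symmetric])
qed (use assms in auto)

lemma sum_reindex_restrict:
  fixes u :: "(nat \<Rightarrow> nat) \<Rightarrow> 'v::complex_inner"
  assumes bij: "bij_betw \<nu> {..<N} H" and S: "S \<subseteq> H" and fin: "finite H"
  shows "(\<Sum>j<N. g (\<nu> j) *\<^sub>R (if \<nu> j \<in> S then u (\<nu> j) else 0)) = (\<Sum>\<mu>\<in>S. g \<mu> *\<^sub>R u \<mu>)"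
proof -
  have "(\<Sum>j<N. g (\<nu> j) *\<^sub>R (if \<nu> j \<in> S then u (\<nu> j) else 0)) =
      (\<Sum>\<mu>\<in>H. g \<mu> *\<^sub>R (if \<mu> \<in> S then u \<mu> else 0))"
    using sum.reindex_bij_betw[OF bij, of "\<lambda>\<mu>. g \<mu> *\<^sub>R (if \<mu> \<in> S then u \<mu> else 0)"] .
  also have "\<dots> = (\<Sum>\<mu>\<in>S. g \<mu> *\<^sub>R u \<mu>)"
    by (rule sum.mono_neutral_cong_right) (use S fin in auto)
  finally show ?thesis .
qed

section \<open>Assembly of the algorithm and its guarantee\<close>

text \<open>The hypothesis on \<open>N\<close> absorbs the quadratic cost \<open>s\<^sup>2\<close> of Horner's scheme for all degrees below \<open>s\<close>.\<close>

lemma landweber_cost_le: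
  assumes d: "d \<ge> 1" and s: "s \<ge> 1" and t: "t \<ge> 1" and N: "s ^ (2 * d) \<le> N" and \<alpha>: "\<alpha> \<ge> 0"
    and cost: "c \<le> 2 * m * d * s\<^sup>2 + m * s ^ d * d + nat \<lceil>t\<rceil> * (7 * m * s ^ d * K)"
  shows "real c \<le> 14 * (real (m * N * d) + t * real (m * N * K + (N + m) * (g + K)) * real N powr \<alpha>)"
proof -
  have "s\<^sup>2 = s ^ (2 * 1)" by simp
  also have "\<dots> \<le> s ^ (2 * d)" using s d by (intro power_increasing) auto
  finally have s2: "s\<^sup>2 \<le> N" using N by simp
  have "s ^ d \<le> s ^ (2 * d)" using s by (intro power_increasing) auto
  then have sd: "s ^ d \<le> N" using N by simp
  have N1: "N \<ge> 1" using sd s by (metis le_trans one_le_power)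
  have \<alpha>1: "real N powr \<alpha> \<ge> 1" using N1 \<alpha> by (simp add: ge_one_powr_ge_zero)
  have tl: "real (nat \<lceil>t\<rceil>) \<le> 2 * t" using t by linarith
  have "2 * m * d * s\<^sup>2 \<le> 2 * m * d * N" using s2 by (rule mult_le_mono2)
  moreover have "m * s ^ d * d \<le> m * N * d" using sd by simp
  moreover have "nat \<lceil>t\<rceil> * (7 * m * s ^ d * K) \<le> nat \<lceil>t\<rceil> * (7 * m * N * K)" using sd by simp
  ultimately have "c \<le> 2 * m * d * N + m * N * d + nat \<lceil>t\<rceil> * (7 * m * N * K)" using cost by linarith
  then have "real c \<le> real (2 * m * d * N + m * N * d + nat \<lceil>t\<rceil> * (7 * m * N * K))" by (simp only: of_nat_le_iff)
  also have "\<dots> = 3 * real (m * N * d) + 7 * (real (nat \<lceil>t\<rceil>) * real (m * N * K))" by simp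
  also have "\<dots> \<le> 14 * real (m * N * d) + 7 * (2 * t * real (m * N * K))"
    using tl by (intro add_mono mult_left_mono mult_right_mono) auto
  also have "\<dots> = 14 * (real (m * N * d) + t * real (m * N * K) * 1)" by simp
  also have "\<dots> \<le> 14 * (real (m * N * d) + t * real (m * N * K + (N + m) * (g + K)) * real N powr \<alpha>)"
    using t \<alpha>1 by (intro mult_left_mono add_left_mono mult_mono) (auto intro!: mult_nonneg_nonneg)
  finally show ?thesis .
qed

lemma cost_exponent_nonneg: "cost_exponent b \<ge> 0"
  by (cases b) auto

text \<open>For large samples the event is the set of good samples, which involves neither the function nor the
  noise; for small ones it is the whole space.\<close>

lemma approx_guarantee_exists:
  "\<exists>C. approx_guarantee TYPE('v::{complex_hilbert,second_countable_topology}) 1 10 10 14 C"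
proof -
  obtain C R where
    R: "\<And>d \<rho>. \<rho> \<in> {..<d} \<rightarrow>\<^sub>E {1<..} \<Longrightarrow> R d \<rho> > 1 \<and> (\<forall>k<d. R d \<rho> < \<rho> k)" and
    C: "\<And>d p \<rho> X s. d \<ge> 1 \<Longrightarrow> \<rho> \<in> {..<d} \<rightarrow>\<^sub>E {1<..} \<Longrightarrow> 0 < p \<Longrightarrow> p \<le> 1 \<Longrightarrow> s > 0 \<Longrightarrow> 0 < X \<Longrightarrow>
       X < (real s + 1) ^ (14 * d) \<Longrightarrow> interpolation_bound d (R d \<rho>) s \<le> C d p \<rho> * X powr (1 / 2 - 1 / p)" and
    C_small: "\<And>d p \<rho> X. d \<ge> 1 \<Longrightarrow> \<rho> \<in> {..<d} \<rightarrow>\<^sub>E {1<..} \<Longrightarrow> 0 < p \<Longrightarrow> p \<le> 1 \<Longrightarrow> 0 < X \<Longrightarrow> X < 16 ^ (14 * d) \<Longrightarrow>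
       1 \<le> C d p \<rho> * X powr (1 / 2 - 1 / p) \<and> 1 \<le> C d p \<rho> * (sqrt X * X powr (1 / 2 - 1 / p))"
    by (rule uniform_approximation_constant) blast
  have "approx_guarantee TYPE('v) 1 10 10 14 C"
    unfolding approx_guarantee_def Let_def
  proof (intro allI impI)
    fix b d \<Psi> m K n N \<nu> and \<epsilon> L t :: real and Vh :: "'v set" and \<phi> :: "nat \<Rightarrow> 'v"
    assume H: "1 \<le> d \<and> orthonormal_polys (measure_1d b) \<Psi> \<and> basis_of K \<phi> Vh \<and> 3 \<le> m \<and> 0 < \<epsilon> \<and> \<epsilon> < 1 \<and>
       1 \<le> K \<and> L = log_factor m d \<epsilon> \<and> n = nat \<lceil>real m / L\<rceil> \<and> N = Theta n d \<and>
       bij_betw \<nu> {..<N} (hyp_cross n d) \<and> 1 \<le> t"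
    then have d: "d \<ge> 1" and \<Psi>: "orthonormal_polys (measure_1d b) \<Psi>" and m: "m \<ge> 3"
      and \<epsilon>: "0 < \<epsilon>" "\<epsilon> < 1" and n: "n = nat \<lceil>real m / L\<rceil>" and N: "N = Theta n d"
      and bij: "bij_betw \<nu> {..<N} (hyp_cross n d)" and t: "t \<ge> 1" by blast+
    have L: "L \<ge> ln (real m) + ln (inverse \<epsilon>)" "L \<ge> 1"
      using H log_factor_ge[OF m d \<epsilon>] by simp_all
    define X where "X = real m / L"
    have X0: "X > 0" using m L by (simp add: X_def)
    have d14: "14 * d > 0" using d by simp
    obtain s :: nat where s: "real s ^ (14 * d) \<le> X" "X < (real s + 1) ^ (14 * d)"
      by (rule obtain_resolution[OF X0 d14])
    have fin: "finite (hyp_cross n d)" using bij bij_betw_finite by blast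
    have arg: "real m / (1 * L) = X" by (simp add: X_def)
    define \<eta> where "\<eta> noise = sqrt (\<Sum>i<m. (norm (noise i))\<^sup>2) / sqrt (real m)" for noise :: "nat \<Rightarrow> 'v"
    have \<eta>0: "\<eta> noise \<ge> 0" for noise by (simp add: \<eta>_def sum_nonneg)
    let ?error = "\<lambda>p \<rho> f noise. error_term b d m L 1 p (C d p \<rho>) Vh f noise + ereal (1 / t)"
    let ?rate = "\<lambda>p \<rho>. C d p \<rho> * X powr (1 / 2 - 1 / p)"
    have error: "?error p \<rho> f noise = ereal (?rate p \<rho>) + ereal (\<eta> noise) +
        Linf_norm (cube_measure b d) (\<lambda>y. f y - orth_proj Vh (f y)) + ereal (1 / t)" for p \<rho> f noise
      unfolding error_term_def arg \<eta>_def ..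
    have lift: "A \<le> ereal c * ?error p \<rho> f noise"
      if "A \<le> ereal (c * (x + \<eta> noise + 1 / t))" "x \<le> ?rate p \<rho>" "c \<ge> 0" for A c p \<rho> f noise x
      unfolding error by (rule ereal_error_mono[OF that Linf_norm_nonneg[OF prob_space_cube_measure]])
    show "\<exists>A. approx_algorithm d m K N A \<and>
        (\<forall>\<rho> \<in> {..<d} \<rightarrow>\<^sub>E {1<..}. \<forall>f \<in> holomorphic_ball d \<rho>.
           accurate_recovery b d \<Psi> Vh \<phi> m \<epsilon> K L N \<nu> t 1 10 10 C A \<rho> f) \<and>
        real (algorithm_cost d m K \<phi> A) \<le> cost_bound b 14 d m N K (gram_cost K \<phi>) t"
    \<comment> \<open>Below the threshold the zero function is output, above it the Landweber iterate.\<close>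
    proof (cases "s < 16")
      case True
      have X16: "X < 16 ^ (14 * d)"
      proof -
        have "(real s + 1) ^ (14 * d) \<le> 16 ^ (14 * d)" using True by (intro power_mono) auto
        then show ?thesis using s(2) by linarith
      qed
      obtain A where A: "approx_algorithm d m K N A"
        and out: "\<And>(\<phi> :: nat \<Rightarrow> 'v) y D j k. j < N \<Longrightarrow> k < K \<Longrightarrow> algorithm_output d m K \<phi> A y D j k = 0"
        and cost: "\<And>\<phi> :: nat \<Rightarrow> 'v. algorithm_cost d m K \<phi> A = 0"
        by (rule zero_algorithm) blast
      have zero: "approximant d K N \<phi> \<Psi> \<nu> (algorithm_output d m K \<phi> A y D) x = 0" for y D x
        by (simp add: approximant_def out)
      show ?thesis
      proof (intro exI[of _ A] conjI ballI A)
        show "real (algorithm_cost d m K \<phi> A) \<le> cost_bound b 14 d m N K (gram_cost K \<phi>) t"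
          unfolding cost using t by simp
        fix \<rho> and f :: "(nat \<Rightarrow> real) \<Rightarrow> 'v"
        assume \<rho>: "\<rho> \<in> {..<d} \<rightarrow>\<^sub>E {1<..}" and f: "f \<in> holomorphic_ball d \<rho>"
        have r: "1 < R d \<rho>" "\<And>k. k < d \<Longrightarrow> R d \<rho> < \<rho> k" using R[OF \<rho>] by blast+
        note bounds = norms_le_one[OF \<Psi> f r(2,1)]
        interpret P: prob_space "sample_measure b d m" by (rule prob_space_sample_measure)
        show "accurate_recovery b d \<Psi> Vh \<phi> m \<epsilon> K L N \<nu> t 1 10 10 C A \<rho> f"
        proof (intro bexI[of _ "space (sample_measure b d m)"] conjI ballI allI impI)
          fix y noise D and p :: real assume p: "0 < p \<and> p \<le> 1"
          have rate: "1 \<le> ?rate p \<rho>" "1 \<le> sqrt X * ?rate p \<rho>"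
            using C_small[OF d \<rho> _ _ X0 X16, of p] p by (simp_all add: mult.left_commute)
          have "1 / t \<ge> 0" using t by simp
          then have pos: "\<eta> noise + 1 / t \<ge> 0" using \<eta>0 by (intro add_nonneg_nonneg)
          have "1 \<le> ereal (10 * (?rate p \<rho> + \<eta> noise + 1 / t))"
            using rate(1) pos by (simp add: one_ereal_def)
          then show "L2_norm (cube_measure b d) (\<lambda>x. f x - approximant d K N \<phi> \<Psi> \<nu> (algorithm_output d m K \<phi> A y D) x) \<le>
                         ereal 10 * ?error p \<rho> f noise"
            unfolding zero diff_zero by (intro lift[OF order_trans[OF bounds(1)] order_refl]) auto
          have "sqrt X * (\<eta> noise + 1 / t) \<ge> 0" using pos X0 by simp
          moreover have "sqrt X * (?rate p \<rho> + \<eta> noise + 1 / t) = sqrt X * ?rate p \<rho> + sqrt X * (\<eta> noise + 1 / t)"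
            by (simp only: distrib_left add.assoc)
          ultimately have "1 \<le> 10 * (sqrt X * (?rate p \<rho> + \<eta> noise + 1 / t))"
            using rate(2) by linarith
          then have "1 \<le> ereal (10 * sqrt X * (?rate p \<rho> + \<eta> noise + 1 / t))"
            by (simp only: one_ereal_def ereal_less_eq mult.assoc)
          then show "Linf_norm (cube_measure b d) (\<lambda>x. f x - approximant d K N \<phi> \<Psi> \<nu> (algorithm_output d m K \<phi> A y D) x) \<le>
                         ereal (10 * sqrt (m / L)) * ?error p \<rho> f noise"
            unfolding zero diff_zero X_def[symmetric] using X0
            by (intro lift[OF order_trans[OF bounds(2)] order_refl]) auto
        qed (use \<epsilon> P.prob_space in auto)
      qed
    next
      case False
      then have s16: "s \<ge> 16" by simp
      note prob = failure_probability_le[OF m \<epsilon> L s16 d s(1)[unfolded X_def]]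
      have m0: "m > 0" and s0: "s > 0" using m s16 by auto
      have sn: "s ^ (14 * d) \<le> n"
      proof -
        have "real (s ^ (14 * d)) \<le> X" using s(1) by simp
        also have "X \<le> real_of_int \<lceil>X\<rceil>" by (rule le_of_int_ceiling)
        finally have "real (s ^ (14 * d)) \<le> real_of_int \<lceil>X\<rceil>" .
        then have "int (s ^ (14 * d)) \<le> \<lceil>X\<rceil>" by linarith
        then show ?thesis unfolding n X_def by linarith
      qed
      \<comment> \<open>The larger box only serves to bound the number \<open>N\<close> of coefficients from below.\<close>
      have "s ^ d \<le> s ^ (14 * d)" "(s ^ 2) ^ d \<le> s ^ (14 * d)"
        using s0 by (auto simp flip: power_mult intro: power_increasing)
      then have box: "index_box d s \<subseteq> hyp_cross n d" "index_box d (s ^ 2) \<subseteq> hyp_cross n d"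
        using sn by (intro index_box_subset_hyp_cross; simp)+
      have "card (index_box d (s ^ 2)) \<le> N"
        unfolding N Theta_def by (rule card_mono[OF fin box(2)])
      then have sN: "s ^ (2 * d) \<le> N" by (simp add: card_index_box power_mult)
      define l where "l = nat \<lceil>t\<rceil>"
      have tl: "t \<le> real l" unfolding l_def by linarith
      have ne: "index_box d s \<noteq> {}" using s0 by (auto simp: PiE_eq_empty_iff)
      have deg: "\<And>j. degree (\<Psi> j) = j" using \<Psi> by (simp add: orthonormal_polys_def)
      obtain A where A: "approx_algorithm d m K N A"
        and out: "\<And>(\<phi> :: nat \<Rightarrow> 'v) y D j k. j < N \<Longrightarrow> k < K \<Longrightarrow>
          algorithm_output d m K \<phi> A y D j k =
          (if \<nu> j \<in> index_box d s
           then landweber (index_box d s) m (\<lambda>i \<mu>. complex_of_real (tensor_poly \<Psi> d \<mu> (y i))) D l (\<nu> j) k else 0)"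
        and cost: "\<And>\<phi> :: nat \<Rightarrow> 'v. algorithm_cost d m K \<phi> A \<le>
          2 * m * d * s\<^sup>2 + m * card (index_box d s) * d + l * (7 * m * card (index_box d s) * K)"
        by (rule landweber_algorithm[of m "index_box d s" d s \<Psi> K N \<nu> l])
          (use m0 finite_index_box ne deg in auto)
      define F where "F y D x = (\<Sum>\<mu>\<in>index_box d s. tensor_poly \<Psi> d \<mu> x *\<^sub>R
        (\<Sum>k<K. landweber (index_box d s) m (\<lambda>i \<mu>. complex_of_real (tensor_poly \<Psi> d \<mu> (y i))) D l \<mu> k *\<^sub>C \<phi> k))"
        for y D x
      have F: "approximant d K N \<phi> \<Psi> \<nu> (algorithm_output d m K \<phi> A y D) x = F y D x" for y D x
      proof -
        let ?u = "\<lambda>\<mu>. \<Sum>k<K. landweber (index_box d s) m (\<lambda>i \<mu>. complex_of_real (tensor_poly \<Psi> d \<mu> (y i))) D l \<mu> k *\<^sub>C \<phi> k"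
        have "approximant d K N \<phi> \<Psi> \<nu> (algorithm_output d m K \<phi> A y D) x =
            (\<Sum>j<N. tensor_poly \<Psi> d (\<nu> j) x *\<^sub>R (if \<nu> j \<in> index_box d s then ?u (\<nu> j) else 0))"
          unfolding approximant_def by (intro sum.cong refl arg_cong2[of _ _ _ _ scaleR]) (simp add: out)
        also have "\<dots> = F y D x"
          unfolding F_def by (rule sum_reindex_restrict[OF bij box(1) fin])
        finally show ?thesis .
      qed
      show ?thesis
      proof (intro exI[of _ A] conjI ballI A)
        show "real (algorithm_cost d m K \<phi> A) \<le> cost_bound b 14 d m N K (gram_cost K \<phi>) t"
          by (rule landweber_cost_le[OF d _ t sN cost_exponent_nonneg cost[of \<phi>, unfolded card_index_box l_def]])
            (use s0 in simp)
        fix \<rho> and f :: "(nat \<Rightarrow> real) \<Rightarrow> 'v"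
        assume \<rho>: "\<rho> \<in> {..<d} \<rightarrow>\<^sub>E {1<..}" and f: "f \<in> holomorphic_ball d \<rho>"
        have r: "1 < R d \<rho>" "\<And>k. k < d \<Longrightarrow> R d \<rho> < \<rho> k" using R[OF \<rho>] by blast+
        show "accurate_recovery b d \<Psi> Vh \<phi> m \<epsilon> K L N \<nu> t 1 10 10 C A \<rho> f"
        proof (intro bexI[of _ "good_samples \<Psi> b d m s"] conjI ballI allI impI)
          show "good_samples \<Psi> b d m s \<in> sets (sample_measure b d m)"
            by (rule good_samples_probability(1)[OF \<Psi> m0 s0])
          show "measure (sample_measure b d m) (good_samples \<Psi> b d m s) \<ge> 1 - \<epsilon>"
            by (rule order_trans[OF _ good_samples_probability(2)[OF \<Psi> m0 s0]]) (use prob(1) in linarith)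
          fix y noise D and p :: real
          assume y: "y \<in> good_samples \<Psi> b d m s" and data: "is_data m K \<phi> f y noise D" and p: "0 < p \<and> p \<le> 1"
          have rate: "interpolation_bound d (R d \<rho>) s \<le> ?rate p \<rho>"
            using C[OF d \<rho> _ _ s0 X0 s(2), of p] p by simp
          note bounds = landweber_approximation[OF \<Psi> f r(2,1) s0 m0 y data t tl prob(3,2)[folded X_def],
              folded F_def \<eta>_def]
          show "L2_norm (cube_measure b d) (\<lambda>x. f x - approximant d K N \<phi> \<Psi> \<nu> (algorithm_output d m K \<phi> A y D) x) \<le>
                         ereal 10 * ?error p \<rho> f noise"
            unfolding F by (rule lift[OF bounds(1) rate zero_le_numeral])
          have nonneg: "0 \<le> 10 * sqrt X" using X0 by simp
          show "Linf_norm (cube_measure b d) (\<lambda>x. f x - approximant d K N \<phi> \<Psi> \<nu> (algorithm_output d m K \<phi> A y D) x) \<le>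
                         ereal (10 * sqrt (m / L)) * ?error p \<rho> f noise"
            unfolding F X_def[symmetric] by (rule lift[OF bounds(2) rate nonneg])
        qed
      qed
    qed
  qed
  then show ?thesis by (rule exI[of _ C])
qed

(* The constants must not depend on the Hilbert space, but HOL cannot quantify over the type 'v
   after c0, ..., C. Hence they are asked to exist for the space l^2 of square-summable
   sequences, and all constants valid for l^2 are asserted to be valid for every separable
   complex Hilbert space. *)

theorem theorem3p5:
  shows "(\<exists>c0 c1 c2 c3 C. c0 \<ge> 1 \<and> c1 \<ge> 1 \<and> c2 \<ge> 1 \<and> c3 > 0 \<and>
           approx_guarantee TYPE(ell2) c0 c1 c2 c3 C) \<and>
         (\<forall>c0 c1 c2 c3 C. c0 \<ge> 1 \<and> c1 \<ge> 1 \<and> c2 \<ge> 1 \<and> c3 > 0 \<and>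
           approx_guarantee TYPE(ell2) c0 c1 c2 c3 C \<longrightarrow>
           approx_guarantee TYPE('v::{complex_hilbert,second_countable_topology}) c0 c1 c2 c3 C)"
proof (intro conjI allI impI)
  obtain C where "approx_guarantee TYPE(ell2) 1 10 10 14 C"
    using approx_guarantee_exists by blast
  then show "\<exists>c0 c1 c2 c3 C. c0 \<ge> 1 \<and> c1 \<ge> 1 \<and> c2 \<ge> 1 \<and> c3 > 0 \<and>
      approx_guarantee TYPE(ell2) c0 c1 c2 c3 C"
    by (intro exI[of _ 1] exI[of _ 10] exI[of _ 14] exI[of _ C]) simp
qed (use approx_guarantee_transfer in blast)

end
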